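(* Let $1\le p<\infty$. A Banach lattice $E$ has the strong $p$-GP property if and only if every weakly null almost $p$-limited sequence in $E$ is norm null.
   Context: A sequence $(x_n^* )_n\subset E^*$ is weak* $p$-summable if $(x_n^*(x))_n\in\ell_p$ for every $x\in E$. A subset $A$ of a Banach lattice $E$ is almost $p$-limited if for each pairwise disjoint weak* $p$-summable sequence $(x_n^* )_n\subset E^*$ there is $(a_n)_n\in\ell_p$ such that $|x_n^*(x)|\le a_n$ for every $x\in A$ and $n\in\mathbb{N}$. A sequence is almost $p$-limited if the set of its terms is. $E$ has the strong $p$-GP property if every almost $p$-limited set in $E$ is relatively compact. *)

theory Defs
  imports "HOL-Analysis.Analysis" "HOL-Library.Lattice_Algebras"
begin

class banach_lattice = banach + ordered_real_vector + lattice_ab_group_add_abs +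
  assumes norm_mono_abs: "\<bar>x\<bar> \<le> \<bar>y\<bar> \<Longrightarrow> norm x \<le> norm y"

(* The dual order on E*: f \<le> g iff g - f is nonnegative on the positive cone. *)
definition dual_le :: "('a::banach_lattice \<Rightarrow>\<^sub>L real) \<Rightarrow> ('a \<Rightarrow>\<^sub>L real) \<Rightarrow> bool" where
  "dual_le f g \<longleftrightarrow> (\<forall>x\<ge>0. blinfun_apply f x \<le> blinfun_apply g x)"

definition is_dual_sup ::
  "('a::banach_lattice \<Rightarrow>\<^sub>L real) \<Rightarrow> ('a \<Rightarrow>\<^sub>L real) \<Rightarrow> ('a \<Rightarrow>\<^sub>L real) \<Rightarrow> bool" where
  "is_dual_sup f g h \<longleftrightarrow>
     dual_le f h \<and> dual_le g h \<and> (\<forall>k. dual_le f k \<and> dual_le g k \<longrightarrow> dual_le h k)"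

definition is_dual_inf ::
  "('a::banach_lattice \<Rightarrow>\<^sub>L real) \<Rightarrow> ('a \<Rightarrow>\<^sub>L real) \<Rightarrow> ('a \<Rightarrow>\<^sub>L real) \<Rightarrow> bool" where
  "is_dual_inf f g h \<longleftrightarrow>
     dual_le h f \<and> dual_le h g \<and> (\<forall>k. dual_le k f \<and> dual_le k g \<longrightarrow> dual_le k h)"

definition is_dual_abs :: "('a::banach_lattice \<Rightarrow>\<^sub>L real) \<Rightarrow> ('a \<Rightarrow>\<^sub>L real) \<Rightarrow> bool" where
  "is_dual_abs f h \<longleftrightarrow> is_dual_sup f (- f) h"

(* Disjointness in the Banach lattice E*: inf |f| |g| = 0.  The lattice operations of E* are
   those of dual_le; F and G are the moduli of f and g, which exist (Riesz-Kantorovich) and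
   are unique because dual_le is antisymmetric. *)
definition dual_disjoint :: "('a::banach_lattice \<Rightarrow>\<^sub>L real) \<Rightarrow> ('a \<Rightarrow>\<^sub>L real) \<Rightarrow> bool" where
  "dual_disjoint f g \<longleftrightarrow>
     (\<exists>F G. is_dual_abs f F \<and> is_dual_abs g G \<and> is_dual_inf F G 0)"

definition pairwise_dual_disjoint :: "(nat \<Rightarrow> ('a::banach_lattice \<Rightarrow>\<^sub>L real)) \<Rightarrow> bool" where
  "pairwise_dual_disjoint f \<longleftrightarrow> (\<forall>m n. m \<noteq> n \<longrightarrow> dual_disjoint (f m) (f n))"

definition ell :: "real \<Rightarrow> (nat \<Rightarrow> real) set" where
  "ell p = {a. summable (\<lambda>n. \<bar>a n\<bar> powr p)}"

definition weak_star_p_summable ::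
  "real \<Rightarrow> (nat \<Rightarrow> ('a::real_normed_vector \<Rightarrow>\<^sub>L real)) \<Rightarrow> bool" where
  "weak_star_p_summable p f \<longleftrightarrow> (\<forall>x. (\<lambda>n. blinfun_apply (f n) x) \<in> ell p)"

definition almost_p_limited :: "real \<Rightarrow> 'a::banach_lattice set \<Rightarrow> bool" where
  "almost_p_limited p A \<longleftrightarrow>
     (\<forall>f :: nat \<Rightarrow> ('a \<Rightarrow>\<^sub>L real).
        pairwise_dual_disjoint f \<and> weak_star_p_summable p f \<longrightarrow>
        (\<exists>a\<in>ell p. \<forall>x\<in>A. \<forall>n. \<bar>blinfun_apply (f n) x\<bar> \<le> a n))"

definition almost_p_limited_seq :: "real \<Rightarrow> (nat \<Rightarrow> 'a::banach_lattice) \<Rightarrow> bool" where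
  "almost_p_limited_seq p x \<longleftrightarrow> almost_p_limited p (range x)"

definition relatively_compact :: "'a::topological_space set \<Rightarrow> bool" where
  "relatively_compact A \<longleftrightarrow> compact (closure A)"

definition weakly_null :: "(nat \<Rightarrow> 'a::real_normed_vector) \<Rightarrow> bool" where
  "weakly_null x \<longleftrightarrow> (\<forall>f :: 'a \<Rightarrow>\<^sub>L real. (\<lambda>n. blinfun_apply f (x n)) \<longlonglongrightarrow> 0)"

definition norm_null :: "(nat \<Rightarrow> 'a::real_normed_vector) \<Rightarrow> bool" where
  "norm_null x \<longleftrightarrow> (\<lambda>n. norm (x n)) \<longlonglongrightarrow> 0"

definition strong_p_GP :: "real \<Rightarrow> 'a::banach_lattice itself \<Rightarrow> bool" where
  "strong_p_GP p E \<longleftrightarrow>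
     (\<forall>A :: 'a set. almost_p_limited p A \<longrightarrow> relatively_compact A)"

end

theory Submission
  imports Defs "HOL-Library.Diagonal_Subsequence"
begin

text \<open>
  The forward implication is a subsequence argument: a weakly null sequence with relatively compact
  range that stays away from \<open>0\<close> has a subsequence with a nonzero norm limit, and by the
  Hahn--Banach theorem some functional does not vanish at that limit.

  For the converse, suppose that weakly null almost p-limited sequences are norm null, and let \<open>A\<close>
  be almost p-limited. The proof shows that \<open>A\<close> is totally bounded, in four steps.

  \<^bold>\<open>Solid hulls.\<close> Finitely many disjoint functionals \<open>f\<^sub>i\<close> live on almost complementary pieces of
  an element \<open>x \<ge> 0\<close>, so one single \<open>y\<close> with \<open>\<bar>y\<bar> \<le> x\<close> nearly realizes all the values
  \<open>\<bar>f\<^sub>i\<bar> x\<close> (\<open>simultaneous_norming\<close>). Hence the moduli of a disjoint weak* p-summable sequence are again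
  weak* p-summable (\<open>modulus_p_summable\<close>), and so is every sequence \<open>g\<^sub>n\<close> with \<open>\<bar>g\<^sub>n\<bar> \<le> \<bar>f\<^sub>n\<bar>\<close>. Choosing
  \<open>g\<^sub>n\<close> so that it takes the value \<open>\<bar>f\<^sub>n\<bar> \<bar>x\<^sub>n\<bar>\<close> at a nearly maximizing \<open>x\<^sub>n \<in> A\<close> shows that the solid
  hull of \<open>A\<close> is almost p-limited (\<open>almost_p_limited_solid_hull\<close>). In particular order intervals are.

  \<^bold>\<open>Disjoint sequences.\<close> If \<open>x\<^sub>n \<ge> 0\<close> is a disjoint sequence in an almost p-limited set and \<open>F\<close> is a
  positive functional, then the parts of \<open>F\<close> carried by the bands of the \<open>x\<^sub>n\<close> are disjoint and have
  sum at most \<open>F\<close>. They form an admissible test sequence, which gives \<open>F x\<^sub>n \<rightarrow> 0\<close>. So disjoint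
  sequences in the solid hull of \<open>A\<close> are weakly null, hence norm null (\<open>disjoint_null_solid_hull\<close>). This has
  two consequences: monotone order bounded sequences converge (\<open>incseq_convergent\<close>), and \<open>A\<close> lies
  within any given distance of some order interval (\<open>approximately_order_bounded\<close>).

  \<^bold>\<open>Weak compactness of order intervals.\<close> A sequence in \<open>[-u, u]\<close> lies in a separable closed
  sublattice \<open>F\<close>. Countably many functionals separate the points of \<open>F\<close>, and a weighted sum of their moduli
  is a functional \<open>f\<close> that is strictly positive on \<open>F\<close>; by convergence of monotone sequences,
  \<open>f\<close> controls the norm on order intervals of \<open>F\<close> (\<open>norm_tendsto_0_of_strictly_positive\<close>). Minimizing a
  strictly convex functional built from \<open>f\<close> over the convex hulls of the tails gives norm convergent
  forward convex combinations (\<open>convergent_forward_convex_combinations\<close>). After passing to a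
  subsequence along which all separating functionals converge, the limit of such combinations is the
  same for every further subsequence, and this forces weak convergence
  (\<open>weakly_convergent_subsequence\<close>).

  \<^bold>\<open>Conclusion.\<close> The difference between a weakly convergent sequence in \<open>[-u, u]\<close> and its limit is weakly null
  and lies in \<open>[-2u, 2u]\<close>, which is almost p-limited; so it is norm null. Thus order intervals are norm compact, and \<open>A\<close>, being
  close to order intervals, is totally bounded.
\<close>

section \<open>Vector lattice inequalities\<close>

text \<open>As simplification rules these push negations and differences through lattice operations and hide
  the order inequalities that the proofs below rely on.\<close>

declare neg_inf_eq_sup [simp del] neg_sup_eq_inf [simp del]
  diff_inf_eq_sup [simp del] diff_sup_eq_inf [simp del]

lemma abs_eq_pprt_add: "\<bar>x\<bar> = pprt x + pprt (- x)" for x :: "'a::lattice_ab_group_add_abs"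
  by (simp add: abs_prts pprt_neg)

lemma eq_pprt_diff: "x = pprt x - pprt (- x)" for x :: "'a::lattice_ab_group_add_abs"
  using prts[of x] by (simp add: pprt_neg)

lemma pprt_le_iff: "0 \<le> y \<Longrightarrow> pprt x \<le> y \<longleftrightarrow> x \<le> y" for x y :: "'a::lattice_ab_group_add_abs"
  by (simp add: pprt_def)

lemma le_pprt: "x \<le> pprt x" for x :: "'a::lattice_ab_group_add_abs"
  by (simp add: pprt_def)

lemma pprt_le_abs: "pprt x \<le> \<bar>x\<bar>" for x :: "'a::lattice_ab_group_add_abs"
  by (simp add: pprt_le_iff abs_ge_self)

lemma inf_pprt_pprt_uminus: "inf (pprt x) (pprt (- x)) = 0" for x :: "'a::lattice_ab_group_add_abs"
proof -
  have "inf (pprt x) (pprt (- x)) = inf (x - nprt x) (0 - nprt x)"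
    using prts[of x] by (metis add_diff_cancel_right' diff_0 pprt_neg)
  also have "\<dots> = inf x 0 - nprt x"
    using add_inf_distrib_right[of x 0 "- nprt x"] by simp
  finally show ?thesis by (simp add: nprt_def)
qed

lemma inf_eq_0_mono:
  fixes a b :: "'a::lattice_ab_group_add_abs"
  assumes "inf a' b' = 0" "0 \<le> a" "a \<le> a'" "0 \<le> b" "b \<le> b'"
  shows "inf a b = 0"
  using assms by (metis inf_mono le_inf_iff order_antisym)

lemma inf_scaleR:
  fixes x y :: "'a::banach_lattice"
  assumes "0 \<le> c"
  shows "inf (c *\<^sub>R x) (c *\<^sub>R y) = c *\<^sub>R inf x y"
proof (cases "c = 0")
  case False
  then have c: "c > 0" using assms by simp
  show ?thesis
  proof (rule order_antisym)
    have "(1 / c) *\<^sub>R inf (c *\<^sub>R x) (c *\<^sub>R y) \<le> inf x y"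
      using scaleR_left_mono[of "inf (c *\<^sub>R x) (c *\<^sub>R y)" "c *\<^sub>R x" "1 / c"]
        scaleR_left_mono[of "inf (c *\<^sub>R x) (c *\<^sub>R y)" "c *\<^sub>R y" "1 / c"] c
      by simp
    from scaleR_left_mono[OF this, of c] c show "inf (c *\<^sub>R x) (c *\<^sub>R y) \<le> c *\<^sub>R inf x y"
      by simp
  qed (use assms in \<open>auto intro: scaleR_left_mono\<close>)
qed simp

lemma sup_scaleR:
  fixes x y :: "'a::banach_lattice"
  assumes "0 \<le> c"
  shows "sup (c *\<^sub>R x) (c *\<^sub>R y) = c *\<^sub>R sup x y"
  using inf_scaleR[OF assms, of "- x" "- y"] by (simp add: sup_eq_neg_inf)

lemma pprt_scaleR: "0 \<le> c \<Longrightarrow> pprt (c *\<^sub>R x) = c *\<^sub>R pprt x" for x :: "'a::banach_lattice"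
  using sup_scaleR[of c x 0] by (simp add: pprt_def)

lemma abs_scaleR_nonneg: "0 \<le> c \<Longrightarrow> \<bar>c *\<^sub>R x\<bar> = c *\<^sub>R \<bar>x\<bar>" for x :: "'a::banach_lattice"
  using pprt_scaleR[of c x] pprt_scaleR[of c "- x"] by (simp add: abs_eq_pprt_add scaleR_add_right)

lemma abs_scaleR_real: "\<bar>c *\<^sub>R x\<bar> = \<bar>c\<bar> *\<^sub>R \<bar>x\<bar>" for x :: "'a::banach_lattice"
  using abs_scaleR_nonneg[of c x] abs_scaleR_nonneg[of "-c" x] by (cases "0 \<le> c") auto

lemma sup_eq_half: "sup x y = (1/2) *\<^sub>R (x + y + \<bar>x - y\<bar>)" for x y :: "'a::banach_lattice"
proof -
  have "\<bar>x - y\<bar> = sup (x - y) (y - x)" by (simp add: abs_lattice)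
  then have "x + y + \<bar>x - y\<bar> = sup (x + x) (y + y)"
    by (simp add: add_sup_distrib_left algebra_simps)
  also have "\<dots> = 2 *\<^sub>R sup x y"
    using sup_scaleR[of 2 x y] by (simp add: scaleR_2)
  finally show ?thesis by simp
qed

lemma inf_scaleR_eq_0:
  fixes a b :: "'a::banach_lattice"
  assumes "inf a b = 0" "0 \<le> c" "0 \<le> d"
  shows "inf (c *\<^sub>R a) (d *\<^sub>R b) = 0"
proof -
  let ?M = "max c d"
  have ab: "0 \<le> a" "0 \<le> b" using assms(1) by (metis inf_le1 inf_le2)+
  have "inf (?M *\<^sub>R a) (?M *\<^sub>R b) = 0" using assms by (simp add: inf_scaleR)
  then show ?thesis
    by (rule inf_eq_0_mono) (use assms ab in \<open>auto intro: scaleR_right_mono scaleR_nonneg_nonneg\<close>)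
qed

lemma inf_add_le:
  fixes a b c :: "'a::lattice_ab_group_add_abs"
  assumes "0 \<le> a" "0 \<le> b" "0 \<le> c"
  shows "inf (a + b) c \<le> inf a c + inf b c"
proof -
  have "inf (a + b) c \<le> a + inf b c"
    using assms by (simp add: add_inf_distrib_left add_increasing le_infI2)
  moreover have "inf (a + b) c \<le> c + inf b c"
    using assms by (simp add: add_inf_distrib_left le_infI2 add_increasing2)
  ultimately show ?thesis by (simp add: add_inf_distrib_right)
qed

text \<open>Riesz decomposition: \<open>c\<close> is \<open>y\<close> truncated to \<open>[-a, a]\<close>.\<close>

text \<open>Take for \<open>c\<close> the truncation of \<open>y\<close> to \<open>[-a, a]\<close>; what is left over is at most \<open>b\<close>.\<close>

lemma riesz_decomposition:
  fixes y a b :: "'a::lattice_ab_group_add_abs"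
  assumes "\<bar>y\<bar> \<le> a + b" "0 \<le> a" "0 \<le> b"
  obtains c d where "y = c + d" "\<bar>c\<bar> \<le> a" "\<bar>d\<bar> \<le> b"
proof -
  define c where "c = sup (- a) (inf y a)"
  have na: "- a \<le> a" using assms(2) by (simp add: minus_le_self_iff)
  have y: "y \<le> a + b" "- y \<le> a + b" using assms(1) by (simp_all add: abs_le_iff)
  have c: "\<bar>c\<bar> \<le> a"
    by (rule abs_leI) (use na in \<open>auto simp: c_def minus_le_iff\<close>)
  have "y - c = y + inf a (sup (- y) (- a))"
    by (simp add: c_def neg_inf_eq_sup diff_sup_eq_inf)
  then have d: "y - c = inf (y + a) (sup 0 (y - a))"
    by (simp add: add_inf_distrib_left add_sup_distrib_left)
  have "\<bar>y - c\<bar> \<le> b"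
  proof (rule abs_leI)
    have "sup 0 (y - a) \<le> b" using y assms by (simp add: algebra_simps)
    then show "y - c \<le> b" unfolding d by (rule le_infI2)
    have "- b \<le> y + a" using add_left_mono[OF y(2), of "y - b"] by (simp add: algebra_simps)
    moreover have "- b \<le> sup 0 (y - a)" using assms by (intro le_supI1) simp
    ultimately show "- (y - c) \<le> b" unfolding d
      by (metis le_inf_iff minus_le_iff)
  qed
  then show ?thesis using c that[of c "y - c"] by simp
qed

text \<open>The triangle inequality with a remainder: where \<open>a > 0\<close> and \<open>b < 0\<close>, the smaller of the two moduli
  cancels completely and therefore counts twice. This is the source of strict convexity below.\<close>

lemma abs_add_abs_diff_ge:
  fixes a b :: "'a::lattice_ab_group_add_abs"
  shows "\<bar>a + b\<bar> + (inf (pprt a) (pprt (- b)) + inf (pprt a) (pprt (- b))) \<le> \<bar>a\<bar> + \<bar>b\<bar>"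
proof -
  let ?q = "inf (pprt a) (pprt (- b))"
  let ?P = "(pprt a - ?q) + pprt b" and ?N = "pprt (- a) + (pprt (- b) - ?q)"
  have nn: "0 \<le> ?P" "0 \<le> ?N" by (auto intro!: add_nonneg_nonneg)
  have "a + b = ?P - ?N"
    using arg_cong2[OF eq_pprt_diff[of a] eq_pprt_diff[of b], of "(+)"]
    by (simp add: algebra_simps)
  then have "\<bar>a + b\<bar> \<le> ?P + ?N"
    using nn abs_triangle_ineq4[of ?P ?N] by (simp only: abs_of_nonneg)
  then show ?thesis
    by (simp add: abs_eq_pprt_add[of a] abs_eq_pprt_add[of b] algebra_simps)
qed

text \<open>Lattice-ordered groups are distributive: \<open>r + c = sup r c + inf r c\<close> turns the claim into
  \<open>inf\<close>-monotonicity.\<close>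

lemma inf_sup_le_sup_inf:
  fixes r a b :: "'a::lattice_ab_group_add_abs"
  shows "inf (sup r a) (sup r b) \<le> sup r (inf a b)"
proof -
  let ?v = "inf (sup r a) (sup r b)" and ?w = "inf r (inf a b) - r"
  have *: "?v + ?w \<le> c" if "?v \<le> sup r c" "inf r (inf a b) \<le> inf r c" for c
  proof -
    have "?v + inf r (inf a b) \<le> sup r c + inf r c" using that by (rule add_mono)
    moreover have "sup r c + inf r c = r + c" by (rule add_eq_inf_sup[symmetric])
    ultimately have "?v + inf r (inf a b) \<le> c + r" by (simp only: add.commute)
    then show ?thesis by (simp only: add_diff_eq diff_le_eq)
  qed
  have "?v + ?w \<le> inf a b"
    by (intro inf_greatest *) (auto intro: le_infI2)
  then have "?v + inf r (inf a b) \<le> inf a b + r" by (simp only: add_diff_eq diff_le_eq)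
  also have "\<dots> = sup r (inf a b) + inf r (inf a b)"
    using add_eq_inf_sup[of r "inf a b"] by (simp only: add.commute)
  finally show ?thesis by (rule add_le_imp_le_right)
qed

text \<open>Think of functions and of \<open>c\<close>, \<open>c + h\<close> as consecutive levels. Raising the truncation level of \<open>y\<close> from \<open>c\<close> to
  \<open>c + h\<close> either happens where \<open>c - z \<le> h\<close>, and then the truncation exceeds \<open>z\<close> by at most \<open>2h\<close>, or it
  increases the truncation by at most \<open>min h (y - c) \<le> min (c - z) (y - c)\<close>.\<close>

lemma level_step:
  fixes y z c :: "'a::banach_lattice"
  assumes "0 \<le> h"
  shows "inf y (c + h) - z \<le> sup (h + h) (inf y c - z + inf (pprt (y - c)) (pprt (c - z)))"
proof -
  let ?a = "pprt (y - c)" and ?b = "pprt (c - z)" and ?r = "(h + h) - (c - z)"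
  have step: "inf y (c + h) \<le> inf y c + inf ?a h"
  proof -
    have "inf y (c + h) - inf y c = inf y (c + h) + sup (- y) (- c)" by (rule diff_inf_eq_sup)
    also have "\<dots> = sup (inf y (c + h) - y) (inf y (c + h) - c)"
      by (simp add: add_sup_distrib_left)
    also have "\<dots> \<le> inf ?a h"
    proof (rule sup_least)
      have "inf y (c + h) - y \<le> 0" by simp
      also have "0 \<le> inf ?a h" using assms by simp
      finally show "inf y (c + h) - y \<le> inf ?a h" .
      have "inf y (c + h) - c = inf (y - c) h"
        using add_inf_distrib_right[of y "c + h" "- c"] by simp
      also have "\<dots> \<le> inf ?a h" by (intro inf_mono le_pprt) simp
      finally show "inf y (c + h) - c \<le> inf ?a h" .
    qed
    finally show ?thesis by (simp only: diff_le_eq add.commute)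
  qed
  have "h \<le> sup ?r ?b"
  proof -
    have "(h + h) = ?r + (c - z)" by simp
    also have "\<dots> \<le> sup ?r ?b + sup ?r ?b"
      by (intro add_mono sup_ge1 le_supI2 le_pprt)
    finally have "2 *\<^sub>R h \<le> 2 *\<^sub>R sup ?r ?b" by (simp only: scaleR_2)
    from scaleR_left_mono[OF this, of "1/2"] show ?thesis by simp
  qed
  then have "inf ?a h \<le> inf (sup ?r ?a) (sup ?r ?b)"
    by (intro inf_mono) auto
  also have "\<dots> \<le> sup ?r (inf ?a ?b)" by (rule inf_sup_le_sup_inf)
  finally have "inf ?a h \<le> sup ?r (inf ?a ?b)" .
  with step have "inf y (c + h) \<le> inf y c + sup ?r (inf ?a ?b)"
    by (meson add_left_mono order_trans)
  then have "inf y (c + h) - z \<le> inf y c - z + sup ?r (inf ?a ?b)"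
    by (simp add: algebra_simps)
  also have "\<dots> = sup (inf y c - z + ?r) (inf y c - z + inf ?a ?b)"
    by (rule add_sup_distrib_left)
  also have "\<dots> \<le> sup (h + h) (inf y c - z + inf ?a ?b)"
  proof (rule sup_mono[OF _ order_refl])
    have "inf y c - z + ?r = inf y c + (h + h - c)" by (simp add: algebra_simps)
    also have "\<dots> \<le> c + (h + h - c)" by (intro add_right_mono) simp
    finally show "inf y c - z + ?r \<le> h + h" by simp
  qed
  finally show ?thesis .
qed

section \<open>The Hahn--Banach theorem\<close>

definition sublinear :: "('a::real_vector \<Rightarrow> real) \<Rightarrow> bool" where
  "sublinear q \<longleftrightarrow> (\<forall>x y. q (x + y) \<le> q x + q y) \<and> (\<forall>c x. 0 < c \<longrightarrow> q (c *\<^sub>R x) = c * q x)"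

lemma sublinear_add: "sublinear q \<Longrightarrow> q (x + y) \<le> q x + q y"
  and sublinear_scale: "sublinear q \<Longrightarrow> 0 < c \<Longrightarrow> q (c *\<^sub>R x) = c * q x"
  by (auto simp: sublinear_def)

lemma sublinear_0:
  assumes "sublinear q"
  shows "q 0 = 0"
  using sublinear_scale[OF assms, of 2 0] by simp

lemma sublinear_neg: "sublinear q \<Longrightarrow> - q (- x) \<le> q x"
  using sublinear_add[of q x "- x"] sublinear_0[of q] by simp

text \<open>For sublinear \<open>q\<close>, the largest sublinear functional below \<open>q\<close> whose value at \<open>- x\<close> is at most \<open>- q x\<close>.\<close>

definition tilt :: "('a::real_vector \<Rightarrow> real) \<Rightarrow> 'a \<Rightarrow> 'a \<Rightarrow> real" where
  "tilt q x y = (INF t\<in>{0..}. q (y + t *\<^sub>R x) - t * q x)"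

text \<open>The infimum defining the tilt is finite, since \<open>t q x = q (t x) \<le> q (y + t x) + q (- y)\<close>. The value \<open>t = 0\<close> shows
  that the tilt is below \<open>q\<close>. As it is sublinear again, a minimal sublinear functional equals all of its tilts.\<close>

lemma tilt:
  fixes q :: "'a::real_vector \<Rightarrow> real"
  assumes q: "sublinear q"
  shows tilt_le: "0 \<le> t \<Longrightarrow> tilt q x y \<le> q (y + t *\<^sub>R x) - t * q x"
    and tilt_greatest: "(\<And>t. 0 \<le> t \<Longrightarrow> c \<le> q (y + t *\<^sub>R x) - t * q x) \<Longrightarrow> c \<le> tilt q x y"
    and sublinear_tilt: "sublinear (tilt q x)"
proof -
  have lb: "- q (- y) \<le> q (y + t *\<^sub>R x) - t * q x" if "0 \<le> t" for t y
  proof -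
    have "t * q x = q (t *\<^sub>R x)"
      using that sublinear_scale[OF q] sublinear_0[OF q] by (cases "t = 0") auto
    also have "\<dots> \<le> q (y + t *\<^sub>R x) + q (- y)"
      using sublinear_add[OF q, of "y + t *\<^sub>R x" "- y"] by simp
    finally show ?thesis by simp
  qed
  have bdd: "bdd_below ((\<lambda>t. q (y + t *\<^sub>R x) - t * q x) ` {0..})" for y
    using lb by (intro bdd_belowI2[where m = "- q (- y)"]) auto
  show le: "tilt q x y \<le> q (y + t *\<^sub>R x) - t * q x" if "0 \<le> t" for t y
    unfolding tilt_def by (rule cINF_lower[OF bdd]) (use that in simp)
  show gr: "c \<le> tilt q x y" if "\<And>t. 0 \<le> t \<Longrightarrow> c \<le> q (y + t *\<^sub>R x) - t * q x" for c y
    unfolding tilt_def by (rule cINF_greatest) (use that in auto)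
  have add: "tilt q x (y + z) \<le> tilt q x y + tilt q x z" for y z
  proof -
    have "tilt q x (y + z) \<le> (q (y + s *\<^sub>R x) - s * q x) + (q (z + t *\<^sub>R x) - t * q x)"
      if "0 \<le> s" "0 \<le> t" for s t
    proof -
      have "tilt q x (y + z) \<le> q ((y + z) + (s + t) *\<^sub>R x) - (s + t) * q x"
        using that by (intro le) simp
      also have "(y + z) + (s + t) *\<^sub>R x = (y + s *\<^sub>R x) + (z + t *\<^sub>R x)"
        by (simp add: algebra_simps)
      also have "q \<dots> \<le> q (y + s *\<^sub>R x) + q (z + t *\<^sub>R x)" by (rule sublinear_add[OF q])
      finally show ?thesis by (simp add: algebra_simps)
    qed
    then have "tilt q x (y + z) - (q (y + s *\<^sub>R x) - s * q x) \<le> tilt q x z" if "0 \<le> s" for s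
      using that by (intro gr) (force simp: algebra_simps)
    then have "tilt q x (y + z) - tilt q x z \<le> tilt q x y"
      by (intro gr) (force simp: algebra_simps)
    then show ?thesis by simp
  qed
  have le1: "tilt q x (c *\<^sub>R y) \<le> c * tilt q x y" if c: "0 < c" for c y
  proof -
    have "tilt q x (c *\<^sub>R y) / c \<le> tilt q x y"
    proof (rule gr)
      fix t :: real assume t: "0 \<le> t"
      have "tilt q x (c *\<^sub>R y) \<le> q (c *\<^sub>R y + (c * t) *\<^sub>R x) - (c * t) * q x"
        using c t by (intro le) simp
      also have "c *\<^sub>R y + (c * t) *\<^sub>R x = c *\<^sub>R (y + t *\<^sub>R x)" by (simp add: algebra_simps)
      also have "q \<dots> = c * q (y + t *\<^sub>R x)" by (rule sublinear_scale[OF q c])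
      finally show "tilt q x (c *\<^sub>R y) / c \<le> q (y + t *\<^sub>R x) - t * q x"
        using c by (simp add: field_simps)
    qed
    then show ?thesis using c by (simp add: field_simps)
  qed
  have "tilt q x (c *\<^sub>R y) = c * tilt q x y" if c: "0 < c" for c y
  proof (rule order_antisym[OF le1[OF c]])
    show "c * tilt q x y \<le> tilt q x (c *\<^sub>R y)"
      using le1[of "1 / c" "c *\<^sub>R y"] c by (simp add: field_simps)
  qed
  with add show "sublinear (tilt q x)" by (simp add: sublinear_def)
qed

text \<open>Zorn's lemma, with the pointwise infimum as lower bound of a chain; the values stay above
  \<open>- p (- x)\<close>.\<close>

lemma minimal_sublinear_exists:
  assumes p: "sublinear p"
  shows "\<exists>q. sublinear q \<and> (\<forall>x. q x \<le> p x) \<and>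
           (\<forall>q'. sublinear q' \<longrightarrow> (\<forall>x. q' x \<le> q x) \<longrightarrow> q' = q)"
proof -
  define A where "A = {q. sublinear q \<and> (\<forall>x. q x \<le> p x)}"
  define P where "P f g \<longleftrightarrow> (\<forall>x. g x \<le> f x)" for f g :: "'a \<Rightarrow> real"
  have "\<exists>m\<in>A. \<forall>a\<in>A. P m a \<longrightarrow> a = m"
  proof (rule predicate_Zorn)
    show "partial_order_on A (relation_of P A)"
      by (rule partial_order_on_relation_ofI)
        (auto simp: P_def fun_eq_iff intro: order_trans order_antisym)
    fix C assume C: "C \<in> Chains (relation_of P A)"
    show "\<exists>u\<in>A. \<forall>a\<in>C. P a u"
    proof (cases "C = {}")
      case True
      then show ?thesis using p by (auto simp: A_def)
    next
      case False
      have CA: "q \<in> A" if "q \<in> C" for q using C that unfolding Chains_def relation_of_def by auto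
      have tot: "P q r \<or> P r q" if "q \<in> C" "r \<in> C" for q r
        using C that unfolding Chains_def relation_of_def by auto
      define u where "u x = (INF q\<in>C. q x)" for x
      have "- p (- x) \<le> q x" if "q \<in> C" for q x
      proof -
        have "sublinear q" "q (- x) \<le> p (- x)" using CA[OF that] by (auto simp: A_def)
        then show ?thesis using sublinear_neg[of q x] by linarith
      qed
      then have bdd: "bdd_below ((\<lambda>q. q x) ` C)" for x
        by (intro bdd_belowI2[where m = "- p (- x)"]) auto
      have le: "u x \<le> q x" if "q \<in> C" for q x
        unfolding u_def by (rule cINF_lower[OF bdd that])
      have gr: "c \<le> u x" if "\<And>q. q \<in> C \<Longrightarrow> c \<le> q x" for c x
        unfolding u_def by (rule cINF_greatest[OF False]) (rule that)
      have "u (x + y) \<le> u x + u y" for x y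
      proof -
        have *: "u (x + y) \<le> q x + r y" if "q \<in> C" "r \<in> C" for q r
        proof -
          have "P q r \<or> P r q" using that by (rule tot)
          then show ?thesis
          proof
            assume 1: "P q r"
            have "u (x + y) \<le> r (x + y)" by (rule le[OF that(2)])
            also have "\<dots> \<le> r x + r y" using CA[OF that(2)] by (auto simp: A_def sublinear_add)
            finally show ?thesis using 1 unfolding P_def by (smt (verit))
          next
            assume 2: "P r q"
            have "u (x + y) \<le> q (x + y)" by (rule le[OF that(1)])
            also have "\<dots> \<le> q x + q y" using CA[OF that(1)] by (auto simp: A_def sublinear_add)
            finally show ?thesis using 2 unfolding P_def by (smt (verit))
          qed
        qed
        have "u (x + y) - q x \<le> u y" if "q \<in> C" for q
          using *[OF that] by (intro gr) (simp add: algebra_simps)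
        then have "u (x + y) - u y \<le> u x"
          by (intro gr) (force simp: algebra_simps)
        then show ?thesis by simp
      qed
      moreover have "u (c *\<^sub>R x) = c * u x" if c: "0 < c" for c x
      proof (rule order_antisym)
        have sc: "q (c *\<^sub>R x) = c * q x" if "q \<in> C" for q
          using CA[OF that] c by (simp add: A_def sublinear_scale)
        have "u (c *\<^sub>R x) / c \<le> u x"
        proof (rule gr)
          fix q assume q: "q \<in> C"
          show "u (c *\<^sub>R x) / c \<le> q x" using le[OF q, of "c *\<^sub>R x"] sc[OF q] c by (simp add: field_simps)
        qed
        then show "u (c *\<^sub>R x) \<le> c * u x" using c by (simp add: field_simps)
        show "c * u x \<le> u (c *\<^sub>R x)"
        proof (rule gr)
          fix q assume q: "q \<in> C"
          have "c * u x \<le> c * q x" using le[OF q] c by simp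
          then show "c * u x \<le> q (c *\<^sub>R x)" using sc[OF q] by simp
        qed
      qed
      ultimately have "sublinear u" by (simp add: sublinear_def)
      moreover obtain q where "q \<in> C" using False by auto
      then have "u x \<le> p x" for x using le[of q x] CA[of q] unfolding A_def
        by (auto intro: order_trans)
      ultimately have "u \<in> A" by (simp add: A_def)
      then show ?thesis using le by (auto simp: P_def)
    qed
  qed
  then obtain m where m: "m \<in> A" "\<And>a. a \<in> A \<Longrightarrow> P m a \<Longrightarrow> a = m" by blast
  have "q' = m" if "sublinear q'" "\<forall>x. q' x \<le> m x" for q'
  proof (rule m(2))
    show "q' \<in> A" using that m(1) unfolding A_def by (auto intro: order_trans)
  qed (use that in \<open>simp add: P_def\<close>)
  then show ?thesis using m(1) by (auto simp: A_def)
qed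

text \<open>A minimal sublinear functional \<open>f\<close> equals each of its tilts, which says that it is additive. Starting the
  minimization from the tilt of \<open>p\<close> at \<open>x\<^sub>0\<close> instead of \<open>p\<close> itself forces \<open>f (- x\<^sub>0) \<le> - p x\<^sub>0\<close>, that is
  \<open>f x\<^sub>0 = p x\<^sub>0\<close>.\<close>

theorem hahn_banach_sublinear:
  fixes p :: "'a::real_vector \<Rightarrow> real"
  assumes p: "sublinear p"
  obtains f where "linear f" "\<And>x. f x \<le> p x" "f x0 = p x0"
proof -
  note t0 = tilt[OF p, where x = x0]
  obtain f where f: "sublinear f" "\<And>x. f x \<le> tilt p x0 x"
    and min: "\<And>q'. sublinear q' \<Longrightarrow> (\<And>x. q' x \<le> f x) \<Longrightarrow> q' = f"
    using minimal_sublinear_exists[OF t0(3)] by blast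
  have add: "f (x + y) = f x + f y" for x y
  proof (rule order_antisym[OF sublinear_add[OF f(1)]])
    \<comment> \<open>minimality makes \<open>f\<close> its own tilt; the parameter value \<open>1\<close> then gives superadditivity\<close>
    have "tilt f x z \<le> f z" for z using tilt_le[OF f(1), of 0 x z] by simp
    then have "tilt f x = f" by (intro min sublinear_tilt f)
    then have "f y \<le> f (y + 1 *\<^sub>R x) - 1 * f x"
      using tilt_le[OF f(1), of 1 x y] by simp
    then show "f x + f y \<le> f (x + y)" by (simp add: add.commute)
  qed
  have neg: "f (- x) = - f x" for x using add[of x "- x"] sublinear_0[OF f(1)] by simp
  have scale: "f (c *\<^sub>R x) = c * f x" for c x
  proof -
    consider "c = 0" | "0 < c" | "c < 0" by linarith
    then show ?thesis
    proof cases
      case 3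
      then have "f ((- c) *\<^sub>R x) = (- c) * f x" by (intro sublinear_scale f) simp
      then show ?thesis using neg[of "c *\<^sub>R x"] by simp
    qed (auto simp: sublinear_0[OF f(1)] sublinear_scale[OF f(1)])
  qed
  have "linear f" by (rule linearI) (auto simp: add scale)
  moreover have fp: "f x \<le> p x" for x
    using f(2)[of x] t0(1)[of 0 x] by simp
  moreover have "f (- x0) \<le> - p x0"
    using f(2)[of "- x0"] t0(1)[of 1 "- x0"] sublinear_0[OF p] by simp
  then have "f x0 = p x0" using neg[of x0] fp[of x0] by simp
  ultimately show ?thesis by (rule that)
qed

corollary norming_functional:
  fixes x :: "'a::real_normed_vector"
  obtains f :: "'a \<Rightarrow>\<^sub>L real" where "norm f \<le> 1" "blinfun_apply f x = norm x"
proof -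
  have "sublinear (norm :: 'a \<Rightarrow> real)"
    by (simp add: sublinear_def norm_triangle_ineq)
  then obtain g where g: "linear g" "\<And>y. g y \<le> norm y" "g x = norm (x::'a)"
    by (rule hahn_banach_sublinear[where ?x0.0 = x]) blast
  have "norm (g y) \<le> 1 * norm y" for y
    using g(2)[of y] g(2)[of "- y"] linear_neg[OF g(1), of y] by simp
  then have bl: "bounded_linear g"
    using g(1) by (intro bounded_linear_intro[where K = 1]) (auto simp: linear_add linear_scale)
  show ?thesis
  proof
    show "norm (Blinfun g) \<le> 1"
      using \<open>\<And>y. norm (g y) \<le> 1 * norm y\<close>
      by (intro norm_blinfun_bound) (simp_all add: bounded_linear_Blinfun_apply[OF bl])
    show "blinfun_apply (Blinfun g) x = norm x"
      by (simp add: bounded_linear_Blinfun_apply[OF bl] g(3))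
  qed
qed

section \<open>Uniform boundedness\<close>

text \<open>The Baire category argument of the uniform boundedness principle, for families that are only
  quasi-subadditive and homogeneous of degree \<open>p\<close>. It covers both functionals (\<open>p = 1\<close>) and the p-th
  powers of the norms of partial sums in the sequence space.\<close>

lemma uniform_bound_of_pointwise_bound:
  fixes Q :: "'i \<Rightarrow> 'a::banach \<Rightarrow> real"
  assumes cont: "\<And>i. continuous_on UNIV (Q i)"
    and sub: "\<And>i x y. Q i (x - y) \<le> c * (Q i x + Q i y)"
    and scale: "\<And>i t x. 0 < t \<Longrightarrow> Q i (t *\<^sub>R x) = t powr p * Q i x"
    and bdd: "\<And>x. \<exists>K. \<forall>i. Q i x \<le> K" and c: "0 \<le> c"
  shows "\<exists>C. \<forall>i x. norm x \<le> 1 \<longrightarrow> Q i x \<le> C"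
proof -
  define S where "S k = {x. \<forall>i. Q i x \<le> real k}" for k
  have cl: "closed (S k)" for k
    unfolding S_def by (intro closed_Collect_all closed_Collect_le cont continuous_intros)
  have cover: "(\<Union>k. S k) = UNIV"
  proof -
    have "\<exists>k. x \<in> S k" for x
    proof -
      obtain K where K: "\<And>i. Q i x \<le> K" using bdd by blast
      obtain k where "K \<le> real k" using real_arch_simple by blast
      then show ?thesis using K by (auto simp: S_def intro: order_trans)
    qed
    then show ?thesis by auto
  qed
  have "\<exists>k. interior (S k) \<noteq> {}"
  proof (rule ccontr)
    assume "\<not> ?thesis"
    then have int: "interior (S k) = {}" for k by blast
    have "euclidean interior_of (\<Union> (range S)) = {}"
      using Met_TC.metric_Baire_category_alt[of "range S"] cl int complete_UNIV
      by (auto simp: interior_of_def interior_def)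
    then show False using cover by simp
  qed
  then obtain k x0 where "x0 \<in> interior (S k)" by blast
  then obtain r where r: "0 < r" "cball x0 r \<subseteq> S k"
    by (meson mem_interior_cball)
  have small: "Q i z \<le> c * (real k + real k)" if "norm z \<le> r" for i z
  proof -
    have "x0 + z \<in> S k" "x0 \<in> S k" using r that by (auto simp: dist_norm subset_iff)
    then have "Q i (x0 + z) + Q i x0 \<le> real k + real k" unfolding S_def by (intro add_mono) auto
    then have "c * (Q i (x0 + z) + Q i x0) \<le> c * (real k + real k)" using c by (rule mult_left_mono)
    moreover have "Q i ((x0 + z) - x0) \<le> c * (Q i (x0 + z) + Q i x0)" by (rule sub)
    ultimately show ?thesis by simp
  qed
  have "Q i x \<le> c * (real k + real k) / r powr p" if "norm x \<le> 1" for i x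
  proof -
    have "r powr p * Q i x = Q i (r *\<^sub>R x)" using scale[OF r(1)] by simp
    also have "\<dots> \<le> c * (real k + real k)" using r(1) that by (intro small) (simp add: mult_left_le)
    finally show ?thesis using r(1) by (simp add: field_simps)
  qed
  then show ?thesis by blast
qed

lemma bounded_of_weakly_bounded:
  fixes A :: "'a::real_normed_vector set"
  assumes "\<And>f :: 'a \<Rightarrow>\<^sub>L real. \<exists>K. \<forall>x\<in>A. \<bar>blinfun_apply f x\<bar> \<le> K"
  shows "bounded A"
proof -
  define Q :: "'a \<Rightarrow> ('a \<Rightarrow>\<^sub>L real) \<Rightarrow> real" where
    "Q x f = (if x \<in> A then \<bar>blinfun_apply f x\<bar> else 0)" for x f
  have "\<exists>C. \<forall>x f. norm f \<le> 1 \<longrightarrow> Q x f \<le> C"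
  proof (rule uniform_bound_of_pointwise_bound[where c = 1 and p = 1])
    fix x
    show "continuous_on UNIV (Q x)"
      by (cases "x \<in> A") (auto simp: Q_def intro!: continuous_intros)
  next
    fix f show "\<exists>K. \<forall>x. Q x f \<le> K"
      using assms[of f] by (auto simp: Q_def) (metis (full_types) abs_ge_zero order.trans le_cases)
  qed (auto simp: Q_def blinfun.diff_left blinfun.scaleR_left abs_mult)
  then obtain C where C: "\<And>x f. norm f \<le> 1 \<Longrightarrow> Q x f \<le> C" by blast
  have "norm x \<le> C" if "x \<in> A" for x
  proof -
    obtain f :: "'a \<Rightarrow>\<^sub>L real" where f: "norm f \<le> 1" "blinfun_apply f x = norm x"
      by (rule norming_functional)
    then show ?thesis using C[of f x] that by (simp add: Q_def)
  qed
  then show ?thesis by (auto simp: bounded_iff)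
qed

section \<open>Norm and order limits\<close>

lemma norm_abs_eq: "norm \<bar>x\<bar> = norm x" for x :: "'a::banach_lattice"
  by (intro order_antisym norm_mono_abs) simp_all

lemma norm_mono: "0 \<le> x \<Longrightarrow> x \<le> y \<Longrightarrow> norm x \<le> norm y" for x :: "'a::banach_lattice"
  by (rule norm_mono_abs) (simp add: abs_of_nonneg order_trans[of 0 x y])

lemma norm_le_of_abs_le: "\<bar>x\<bar> \<le> y \<Longrightarrow> norm x \<le> norm y" for x :: "'a::banach_lattice"
  using norm_mono[of "\<bar>x\<bar>" y] by (simp add: norm_abs_eq)

lemma tendsto_of_abs_diff_le:
  fixes f :: "'b \<Rightarrow> 'a::banach_lattice"
  assumes "(f \<longlongrightarrow> l) F" "\<And>x. \<bar>g x - m\<bar> \<le> \<bar>f x - l\<bar>"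
  shows "(g \<longlongrightarrow> m) F"
proof -
  have "((\<lambda>x. norm (f x - l)) \<longlongrightarrow> 0) F"
    by (intro tendsto_norm_zero LIM_zero assms(1))
  then have "((\<lambda>x. g x - m) \<longlongrightarrow> 0) F"
    by (rule Lim_null_comparison[rotated]) (simp add: assms(2) norm_mono_abs)
  then show ?thesis by (simp add: LIM_zero_iff)
qed

lemma tendsto_abs_lattice:
  "(f \<longlongrightarrow> l) F \<Longrightarrow> ((\<lambda>x. \<bar>f x\<bar>) \<longlongrightarrow> \<bar>l\<bar>) F" for l :: "'a::banach_lattice"
  by (erule tendsto_of_abs_diff_le) (rule abs_triangle_ineq3)

text \<open>The modulus is norm continuous, so the positive cone is closed.\<close>

lemma nonneg_tendsto:
  fixes l :: "'a::banach_lattice"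
  assumes "(f \<longlongrightarrow> l) F" "F \<noteq> bot" "\<And>x. 0 \<le> f x"
  shows "0 \<le> l"
proof -
  have "((\<lambda>x. f x) \<longlongrightarrow> \<bar>l\<bar>) F"
    using tendsto_abs_lattice[OF assms(1)] by (simp add: assms(3))
  then have "l = \<bar>l\<bar>" by (rule tendsto_unique[OF assms(2,1)])
  then show ?thesis using abs_ge_zero[of l] by simp
qed

lemma tendsto_upper:
  fixes l :: "'a::banach_lattice"
  assumes "(f \<longlongrightarrow> l) F" "F \<noteq> bot" "\<And>x. f x \<le> b"
  shows "l \<le> b"
proof -
  have "((\<lambda>x. b - f x) \<longlongrightarrow> b - l) F" by (intro tendsto_intros assms(1))
  then have "0 \<le> b - l" by (rule nonneg_tendsto[OF _ assms(2)]) (simp add: assms(3))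
  then show ?thesis by simp
qed

text \<open>With \<open>N\<close> levels between \<open>-u\<close> and \<open>u\<close>, wherever \<open>y\<close> exceeds \<open>z\<close> by more than two
  level distances, there are levels strictly between them, and the summands of
  these levels add up to most of the difference. The inequality is used twice: for consecutive terms of a monotone sequence, where
  the summands of a fixed level are disjoint, and for minimizing sequences of a convex functional.\<close>

lemma diff_le_sum_levels:
  fixes y z u :: "'a::banach_lattice"
  assumes "0 < N" "0 \<le> u" "y \<le> u" "- u \<le> z"
  defines "t \<equiv> \<lambda>k. (2 * real k / real N - 1)"
  shows "y - z \<le> (4 / real N) *\<^sub>R u
           + (\<Sum>k<N. inf (pprt (y - t k *\<^sub>R u)) (pprt (t k *\<^sub>R u - z)))"
proof -
  let ?h = "(2 / real N) *\<^sub>R u"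
  let ?P = "\<lambda>k. inf (pprt (y - t k *\<^sub>R u)) (pprt (t k *\<^sub>R u - z))"
  have h: "0 \<le> ?h" using assms by (simp add: scaleR_nonneg_nonneg)
  have hh: "?h + ?h = (4 / real N) *\<^sub>R u" by (simp flip: scaleR_add_left)
  have P: "0 \<le> ?P k" for k by simp
  have S: "0 \<le> (\<Sum>i<k. ?P i)" for k by (intro sum_nonneg P)
  have t: "t (Suc k) *\<^sub>R u = t k *\<^sub>R u + ?h" for k
    using assms(1) by (simp add: t_def scaleR_add_left[symmetric] field_simps)
  have "inf y (t k *\<^sub>R u) - z \<le> (?h + ?h) + (\<Sum>i<k. ?P i)" for k
  proof (induction k)
    case 0
    have "inf y (t 0 *\<^sub>R u) \<le> z" using assms(4) by (simp add: t_def le_infI2)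
    then have "inf y (t 0 *\<^sub>R u) - z \<le> 0" by (simp only: diff_le_0_iff_le)
    also have "0 \<le> ?h + ?h" using h by (intro add_nonneg_nonneg)
    finally show ?case by simp
  next
    case (Suc k)
    have "inf y (t (Suc k) *\<^sub>R u) - z \<le> sup (?h + ?h) (inf y (t k *\<^sub>R u) - z + ?P k)"
      unfolding t by (rule level_step[OF h])
    also have "\<dots> \<le> (?h + ?h) + (\<Sum>i<Suc k. ?P i)"
    proof (rule sup_least)
      show "?h + ?h \<le> (?h + ?h) + (\<Sum>i<Suc k. ?P i)" using S[of "Suc k"] by simp
      show "inf y (t k *\<^sub>R u) - z + ?P k \<le> (?h + ?h) + (\<Sum>i<Suc k. ?P i)"
        using add_right_mono[OF Suc.IH, of "?P k"] by (simp only: sum.lessThan_Suc add.assoc)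
    qed
    finally show ?case .
  qed
  from this[of N] have "inf y (t N *\<^sub>R u) - z \<le> (4 / real N) *\<^sub>R u + (\<Sum>i<N. ?P i)"
    by (simp only: hh)
  moreover have "inf y (t N *\<^sub>R u) = y" using assms(1,3) by (simp add: t_def inf_absorb1)
  ultimately show ?thesis by simp
qed

section \<open>Monotone order bounded sequences\<close>

definition disjoint_seq :: "(nat \<Rightarrow> 'a::banach_lattice) \<Rightarrow> bool" where
  "disjoint_seq x \<longleftrightarrow> (\<forall>m n. m \<noteq> n \<longrightarrow> inf \<bar>x m\<bar> \<bar>x n\<bar> = 0)"

lemma disjoint_seqI:
  assumes "\<And>m n. m < n \<Longrightarrow> inf \<bar>x m\<bar> \<bar>x n\<bar> = 0"
  shows "disjoint_seq x"
  using assms unfolding disjoint_seq_def by (metis inf_commute linorder_neqE_nat)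

text \<open>A monotone sequence of functions crosses a fixed level at most once at each point. So for fixed \<open>t\<close> the
  elements measuring how far the step from \<open>x n\<close> to \<open>x (Suc n)\<close> crosses \<open>t u\<close> are disjoint and
  tend to \<open>0\<close>; finitely many levels control the whole step.\<close>

lemma incseq_diff_tendsto_0:
  fixes x :: "nat \<Rightarrow> 'a::banach_lattice"
  assumes dis: "\<And>w. disjoint_seq w \<Longrightarrow> (\<And>n. 0 \<le> w n \<and> w n \<le> 2 *\<^sub>R u) \<Longrightarrow> w \<longlonglongrightarrow> 0"
    and mono: "incseq x" and bd: "\<And>n. - u \<le> x n" "\<And>n. x n \<le> u" and u: "0 \<le> u"
  shows "(\<lambda>n. x (Suc n) - x n) \<longlonglongrightarrow> 0"
proof (rule LIMSEQ_I)
  fix e :: real assume e: "0 < e"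
  define P where "P t n = inf (pprt (x (Suc n) - t *\<^sub>R u)) (pprt (t *\<^sub>R u - x n))" for t n
  have P0: "0 \<le> P t n" for t n by (simp add: P_def)
  have le2: "P t n \<le> 2 *\<^sub>R u" if "- 1 \<le> t" for t n
  proof -
    have "(- 1) *\<^sub>R u \<le> t *\<^sub>R u" using that u by (intro scaleR_right_mono) auto
    then have "x (Suc n) - t *\<^sub>R u \<le> u + u"
      using bd(2)[of "Suc n"] diff_mono[of "x (Suc n)" u "- u" "t *\<^sub>R u"] by simp
    then have "pprt (x (Suc n) - t *\<^sub>R u) \<le> 2 *\<^sub>R u"
      using u by (simp add: pprt_le_iff scaleR_2)
    then show ?thesis unfolding P_def by (rule le_infI1)
  qed
  have P_lim: "P t \<longlonglongrightarrow> 0" if "- 1 \<le> t" for t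
  proof (rule dis)
    show "disjoint_seq (P t)"
    proof (rule disjoint_seqI)
      fix m n :: nat assume "m < n"
      then have "x (Suc m) \<le> x n" using mono by (simp add: incseq_def)
      then have "P t m \<le> pprt (x n - t *\<^sub>R u)"
        unfolding P_def by (intro le_infI1 pprt_mono) simp
      moreover have "P t n \<le> pprt (- (x n - t *\<^sub>R u))" by (simp add: P_def)
      ultimately have "inf (P t m) (P t n) = 0"
        using P0 inf_eq_0_mono[OF inf_pprt_pprt_uminus] by blast
      then show "inf \<bar>P t m\<bar> \<bar>P t n\<bar> = 0" by (simp add: P0)
    qed
  qed (use P0 le2 that in auto)
  obtain N :: nat where N: "0 < N" "4 * norm u / real N < e / 2"
  proof -
    obtain N :: nat where N: "8 * norm u / e < real N"
      using reals_Archimedean2 by blast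
    moreover have "0 \<le> 8 * norm u / e" using e by simp
    ultimately have "0 < N" by linarith
    then show ?thesis using N e by (intro that[of N]) (simp_all add: field_simps)
  qed
  let ?t = "\<lambda>k. (2 * real k / real N - 1)"
  have "(\<lambda>n. \<Sum>k<N. P (?t k) n) \<longlonglongrightarrow> 0"
    by (intro tendsto_null_sum P_lim) simp
  then have "\<exists>n0. \<forall>n\<ge>n0. norm ((\<Sum>k<N. P (?t k) n) - 0) < e / 2"
    using e by (intro LIMSEQ_D) auto
  then obtain n0 where n0: "\<And>n. n \<ge> n0 \<Longrightarrow> norm (\<Sum>k<N. P (?t k) n) < e / 2"
    by auto
  have "norm (x (Suc n) - x n - 0) < e" if "n \<ge> n0" for n
  proof -
    have "x (Suc n) - x n \<le> (4 / real N) *\<^sub>R u + (\<Sum>k<N. P (?t k) n)"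
      unfolding P_def by (rule diff_le_sum_levels) (use N u bd in auto)
    moreover have "0 \<le> x (Suc n) - x n" using mono by (simp add: incseq_SucD)
    ultimately have "norm (x (Suc n) - x n) \<le> norm ((4 / real N) *\<^sub>R u + (\<Sum>k<N. P (?t k) n))"
      by (rule norm_mono[rotated])
    also have "\<dots> \<le> norm ((4 / real N) *\<^sub>R u) + norm (\<Sum>k<N. P (?t k) n)"
      by (rule norm_triangle_ineq)
    also have "\<dots> < e / 2 + e / 2"
      using n0[OF that] N by (intro add_strict_mono) simp_all
    finally show ?thesis by simp
  qed
  then show "\<exists>no. \<forall>n\<ge>no. norm (x (Suc n) - x n - 0) < e" by blast
qed

text \<open>A sequence that is not Cauchy has a subsequence whose steps are bounded away from \<open>0\<close>.\<close>

lemma incseq_Cauchy: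
  fixes x :: "nat \<Rightarrow> 'a::banach_lattice"
  assumes dis: "\<And>w. disjoint_seq w \<Longrightarrow> (\<And>n. 0 \<le> w n \<and> w n \<le> 2 *\<^sub>R u) \<Longrightarrow> w \<longlonglongrightarrow> 0"
    and mono: "incseq x" and bd: "\<And>n. - u \<le> x n" "\<And>n. x n \<le> u" and u: "0 \<le> u"
  shows "Cauchy x"
proof (rule ccontr)
  assume "\<not> Cauchy x"
  then obtain e where e: "0 < e" "\<forall>M. \<exists>n\<ge>M. \<not> dist (x n) (x M) < e"
    unfolding Cauchy_altdef2 by auto
  \<comment> \<open>iterating \<open>g\<close> below gives a subsequence whose consecutive terms have distance at least \<open>e\<close>\<close>
  have "\<exists>n>M. norm (x n - x M) \<ge> e" for M
  proof -
    obtain n where n: "n \<ge> M" "\<not> dist (x n) (x M) < e" using e(2) by blast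
    then have "n \<noteq> M" using e(1) by auto
    then show ?thesis using n by (intro exI[of _ n]) (auto simp: dist_norm)
  qed
  then have "\<exists>g. \<forall>M. g M > M \<and> norm (x (g M) - x M) \<ge> e" by (intro choice) blast
  then obtain g where g: "\<And>M. g M > M \<and> norm (x (g M) - x M) \<ge> e" by blast
  define r where "r n = (g ^^ n) 0" for n
  have r: "strict_mono r" using g by (simp add: strict_mono_Suc_iff r_def)
  have "(\<lambda>n. (x \<circ> r) (Suc n) - (x \<circ> r) n) \<longlonglongrightarrow> 0"
  proof (rule incseq_diff_tendsto_0[where u = u])
    show "incseq (x \<circ> r)" using mono r
      by (simp add: incseq_def strict_mono_less_eq)
  qed (use assms in auto)
  then have "\<exists>n0. \<forall>n\<ge>n0. norm ((x \<circ> r) (Suc n) - (x \<circ> r) n - 0) < e"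
    using e(1) by (rule LIMSEQ_D)
  then obtain n where "norm ((x \<circ> r) (Suc n) - (x \<circ> r) n) < e"
    by auto
  moreover have "(x \<circ> r) (Suc n) = x (g (r n))" by (simp add: r_def)
  ultimately show False using g[of "r n"] by (simp add: not_less[symmetric])
qed

section \<open>The modulus of a bounded functional\<close>

text \<open>The extension is \<open>x \<mapsto> T (x\<^sup>+) - T (x\<^sup>-)\<close>. Additivity of \<open>T\<close> makes \<open>T a - T b\<close> depend only on \<open>a - b\<close>.\<close>

lemma positive_cone_extension:
  fixes T :: "'a::banach_lattice \<Rightarrow> real"
  assumes add: "\<And>x y. 0 \<le> x \<Longrightarrow> 0 \<le> y \<Longrightarrow> T (x + y) = T x + T y"
    and scale: "\<And>c x. 0 < c \<Longrightarrow> 0 \<le> x \<Longrightarrow> T (c *\<^sub>R x) = c * T x"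
    and bound: "\<And>x. 0 \<le> x \<Longrightarrow> \<bar>T x\<bar> \<le> M * norm x"
  obtains f :: "'a \<Rightarrow>\<^sub>L real" where "\<And>x. 0 \<le> x \<Longrightarrow> blinfun_apply f x = T x"
proof -
  define g where "g x = T (pprt x) - T (pprt (- x))" for x
  have T0: "T 0 = 0" using add[of 0 0] by simp
  have g_diff: "g (a - b) = T a - T b" if "0 \<le> a" "0 \<le> b" for a b
  proof -
    have "pprt (a - b) + b = a + pprt (- (a - b))"
      using eq_pprt_diff[of "a - b"] by (simp add: algebra_simps)
    then have "T (pprt (a - b)) + T b = T a + T (pprt (- (a - b)))"
      using add that by (metis zero_le_pprt)
    then show ?thesis by (simp add: g_def)
  qed
  have g_add: "g (x + y) = g x + g y" for x y
  proof -
    have "x + y = (pprt x + pprt y) - (pprt (- x) + pprt (- y))"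
      using arg_cong2[OF eq_pprt_diff[of x] eq_pprt_diff[of y], of "(+)"]
      by (simp add: algebra_simps)
    then have "g (x + y) = T (pprt x + pprt y) - T (pprt (- x) + pprt (- y))"
      by (metis g_diff add_nonneg_nonneg zero_le_pprt)
    then show ?thesis by (simp add: add g_def)
  qed
  have g_pos: "g x = T x" if "0 \<le> x" for x
    using g_diff[OF that order_refl] by (simp add: T0)
  have g_neg: "g (- x) = - g x" for x by (simp add: g_def)
  have g_sc: "g (c *\<^sub>R x) = c * g x" if "0 < c" for c x
    using that pprt_scaleR[of c x] pprt_scaleR[of c "- x"] scale[OF that]
    by (simp add: g_def algebra_simps)
  have g_scale: "g (c *\<^sub>R x) = c * g x" for c x
  proof -
    consider "c = 0" | "0 < c" | "c < 0" by linarith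
    then show ?thesis
    proof cases
      case 3
      then show ?thesis using g_sc[of "- c" x] g_neg[of "c *\<^sub>R x"] by simp
    qed (auto simp: g_sc g_pos T0)
  qed
  have M: "\<bar>g x\<bar> \<le> (2 * \<bar>M\<bar>) * norm x" for x
  proof -
    have *: "\<bar>T (pprt z)\<bar> \<le> \<bar>M\<bar> * norm z" for z
    proof -
      have "\<bar>T (pprt z)\<bar> \<le> M * norm (pprt z)" by (rule bound) simp
      also have "\<dots> \<le> \<bar>M\<bar> * norm (pprt z)" by (intro mult_right_mono) auto
      also have "\<dots> \<le> \<bar>M\<bar> * norm z"
        by (intro mult_left_mono norm_mono_abs) (auto simp: pprt_le_abs)
      finally show ?thesis .
    qed
    show ?thesis using *[of x] *[of "- x"] by (simp add: g_def)
  qed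
  have "bounded_linear g"
    by (rule bounded_linear_intro[where K = "2 * \<bar>M\<bar>"]) 
      (use g_add g_scale M in \<open>auto simp: mult.commute\<close>)
  then show ?thesis
    using that[of "Blinfun g"] g_pos by (simp add: bounded_linear_Blinfun_apply)
qed

text \<open>The Riesz--Kantorovich formula. The supremum is additive on the positive cone because, by Riesz decomposition,
  every \<open>y\<close> with \<open>\<bar>y\<bar> \<le> x + z\<close> splits into parts dominated by \<open>x\<close> and \<open>z\<close>.\<close>

lemma exists_modulus:
  fixes f :: "'a::banach_lattice \<Rightarrow>\<^sub>L real"
  shows "\<exists>h :: 'a \<Rightarrow>\<^sub>L real. \<forall>x\<ge>0. blinfun_apply h x = (SUP y\<in>{y. \<bar>y\<bar> \<le> x}. blinfun_apply f y)"
proof -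
  define S where "S x = (SUP y\<in>{y. \<bar>y\<bar> \<le> x}. blinfun_apply f y)" for x
  have fb: "blinfun_apply f y \<le> norm f * norm x" if "\<bar>y\<bar> \<le> x" for x y
    using norm_blinfun[of f y] norm_le_of_abs_le[OF that]
    by (smt (verit) mult_left_mono norm_ge_zero real_norm_def)
  then have bdd: "bdd_above (blinfun_apply f ` {y. \<bar>y\<bar> \<le> x})" for x
    by (intro bdd_aboveI2) auto
  have up: "blinfun_apply f y \<le> S x" if "\<bar>y\<bar> \<le> x" for x y
    unfolding S_def by (rule cSUP_upper[OF _ bdd]) (use that in simp)
  have least: "S x \<le> c" if "0 \<le> x" "\<And>y. \<bar>y\<bar> \<le> x \<Longrightarrow> blinfun_apply f y \<le> c" for x c
    unfolding S_def by (rule cSUP_least) (use that in \<open>auto intro: exI[of _ 0]\<close>)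
  have S0: "0 \<le> S x" if "0 \<le> x" for x using up[of 0 x] that by simp
  have "S (x + z) = S x + S z" if x: "0 \<le> x" and z: "0 \<le> z" for x z
  proof (rule order_antisym)
    show "S (x + z) \<le> S x + S z"
    proof (rule least)
      fix y assume "\<bar>y\<bar> \<le> x + z"
      then obtain c d where "y = c + d" "\<bar>c\<bar> \<le> x" "\<bar>d\<bar> \<le> z"
        using riesz_decomposition[OF _ x z] by blast
      then show "blinfun_apply f y \<le> S x + S z"
        using up[of c x] up[of d z] by (simp add: blinfun.add_right)
    qed (use x z in simp)
    have "blinfun_apply f c + blinfun_apply f d \<le> S (x + z)" if "\<bar>c\<bar> \<le> x" "\<bar>d\<bar> \<le> z" for c d
    proof -
      have "\<bar>c + d\<bar> \<le> x + z"
        using abs_triangle_ineq[of c d] add_mono[OF that] by (rule order_trans)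
      then show ?thesis using up by (fastforce simp flip: blinfun.add_right)
    qed
    then have "blinfun_apply f c \<le> S (x + z) - S z" if "\<bar>c\<bar> \<le> x" for c
      using least[OF z, of "S (x + z) - blinfun_apply f c"] that by (force simp: algebra_simps)
    then have "S x \<le> S (x + z) - S z" by (rule least[OF x])
    then show "S x + S z \<le> S (x + z)" by simp
  qed
  moreover have "S (c *\<^sub>R x) = c * S x" if c: "0 < c" and x: "0 \<le> x" for c x
  proof -
    have le: "c * S x \<le> S (c *\<^sub>R x)" if c: "0 < c" and x: "0 \<le> x" for c x
    proof -
      have "blinfun_apply f y \<le> S (c *\<^sub>R x) / c" if "\<bar>y\<bar> \<le> x" for y
        using up[of "c *\<^sub>R y" "c *\<^sub>R x"] that c
        by (simp add: abs_scaleR_nonneg scaleR_left_mono blinfun.scaleR_right field_simps)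
      then have "S x \<le> S (c *\<^sub>R x) / c" by (rule least[OF x])
      then show ?thesis using c by (simp add: field_simps)
    qed
    have "S (c *\<^sub>R x) \<le> c * S x"
      using le[of "1 / c" "c *\<^sub>R x"] c x by (simp add: field_simps scaleR_nonneg_nonneg)
    then show ?thesis using le[OF c x] by simp
  qed
  moreover have "\<bar>S x\<bar> \<le> norm f * norm x" if "0 \<le> x" for x
    using S0[OF that] least[OF that fb] by simp
  ultimately obtain h :: "'a \<Rightarrow>\<^sub>L real" where "\<And>x. 0 \<le> x \<Longrightarrow> blinfun_apply h x = S x"
    using positive_cone_extension[of S "norm f"] by blast
  then show ?thesis unfolding S_def by blast
qed

text \<open>The condition fixes the functional on the positive cone and therefore everywhere.\<close>

definition modulus :: "('a::banach_lattice \<Rightarrow>\<^sub>L real) \<Rightarrow> ('a \<Rightarrow>\<^sub>L real)" where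
  "modulus f = (SOME h. \<forall>x\<ge>0. blinfun_apply h x = (SUP y\<in>{y. \<bar>y\<bar> \<le> x}. blinfun_apply f y))"

lemma modulus_apply:
  "0 \<le> x \<Longrightarrow> blinfun_apply (modulus f) x = (SUP y\<in>{y. \<bar>y\<bar> \<le> x}. blinfun_apply f y)"
  unfolding modulus_def using someI_ex[OF exists_modulus[of f]] by blast

lemma modulus_upper:
  fixes f :: "'a::banach_lattice \<Rightarrow>\<^sub>L real"
  assumes "\<bar>y\<bar> \<le> x"
  shows "blinfun_apply f y \<le> blinfun_apply (modulus f) x"
proof -
  have x: "0 \<le> x" using assms abs_ge_zero order_trans by blast
  have "bdd_above (blinfun_apply f ` {y. \<bar>y\<bar> \<le> x})"
  proof (rule bdd_aboveI2)
    fix y assume "y \<in> {y. \<bar>y\<bar> \<le> x}"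
    then have "norm y \<le> norm x" by (simp add: norm_le_of_abs_le)
    then have "norm f * norm y \<le> norm f * norm x" by (simp add: mult_left_mono)
    then show "blinfun_apply f y \<le> norm f * norm x" using norm_blinfun[of f y] by simp
  qed
  then show ?thesis unfolding modulus_apply[OF x] by (rule cSUP_upper[rotated]) (use assms in simp)
qed

lemma modulus_least:
  fixes f :: "'a::banach_lattice \<Rightarrow>\<^sub>L real"
  assumes "0 \<le> x" "\<And>y. \<bar>y\<bar> \<le> x \<Longrightarrow> blinfun_apply f y \<le> c"
  shows "blinfun_apply (modulus f) x \<le> c"
  unfolding modulus_apply[OF assms(1)]
  by (rule cSUP_least) (use assms in \<open>auto intro: exI[of _ 0]\<close>)

lemma modulus_approx:
  fixes f :: "'a::banach_lattice \<Rightarrow>\<^sub>L real"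
  assumes "0 \<le> x" "0 < e"
  obtains y where "\<bar>y\<bar> \<le> x" "blinfun_apply (modulus f) x - e < blinfun_apply f y"
  using modulus_least[OF assms(1), of f "blinfun_apply (modulus f) x - e"] assms(2) by force

lemma abs_apply_le_modulus:
  fixes f :: "'a::banach_lattice \<Rightarrow>\<^sub>L real"
  assumes "\<bar>y\<bar> \<le> x"
  shows "\<bar>blinfun_apply f y\<bar> \<le> blinfun_apply (modulus f) x"
  using modulus_upper[OF assms, of f] modulus_upper[of "- y" x f] assms
  by (simp add: blinfun.minus_right abs_le_iff)

lemma modulus_nonneg: "0 \<le> x \<Longrightarrow> 0 \<le> blinfun_apply (modulus f) x"
  using modulus_upper[of 0 x f] by simp

definition pos_functional :: "('a::banach_lattice \<Rightarrow>\<^sub>L real) \<Rightarrow> bool" where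
  "pos_functional f \<longleftrightarrow> (\<forall>x\<ge>0. 0 \<le> blinfun_apply f x)"

lemma pos_functional_nonneg: "pos_functional f \<Longrightarrow> 0 \<le> x \<Longrightarrow> 0 \<le> blinfun_apply f x"
  by (simp add: pos_functional_def)

lemma pos_functional_mono:
  "pos_functional f \<Longrightarrow> x \<le> y \<Longrightarrow> blinfun_apply f x \<le> blinfun_apply f y"
  unfolding pos_functional_def by (metis blinfun.diff_right diff_ge_0_iff_ge)

lemma pos_functional_modulus: "pos_functional (modulus f)"
  by (simp add: pos_functional_def modulus_nonneg)

lemma modulus_of_pos:
  assumes "pos_functional f" "0 \<le> x"
  shows "blinfun_apply (modulus f) x = blinfun_apply f x"
proof (rule order_antisym)
  show "blinfun_apply (modulus f) x \<le> blinfun_apply f x"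
    using assms by (intro modulus_least pos_functional_mono) (auto simp: abs_le_iff)
  show "blinfun_apply f x \<le> blinfun_apply (modulus f) x"
    using assms by (intro modulus_upper) simp
qed

lemma norm_modulus_le: "norm (modulus f) \<le> norm f"
proof (rule norm_blinfun_bound)
  fix x :: 'a
  have "\<bar>blinfun_apply (modulus f) x\<bar> \<le> blinfun_apply (modulus (modulus f)) \<bar>x\<bar>"
    by (rule abs_apply_le_modulus) simp
  also have "\<dots> = blinfun_apply (modulus f) \<bar>x\<bar>"
    by (simp add: modulus_of_pos pos_functional_modulus)
  also have "\<dots> \<le> norm f * norm x"
  proof (rule modulus_least)
    fix y assume "\<bar>y\<bar> \<le> \<bar>x\<bar>"
    then have "norm f * norm y \<le> norm f * norm x" by (simp add: norm_mono_abs mult_left_mono)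
    then show "blinfun_apply f y \<le> norm f * norm x" using norm_blinfun[of f y] by simp
  qed simp
  finally show "norm (blinfun_apply (modulus f) x) \<le> norm f * norm x" by simp
qed simp

lemma is_dual_abs_modulus: "is_dual_abs f (modulus f)"
proof -
  have "dual_le (modulus f) k" if "dual_le f k" "dual_le (- f) k" for k
    unfolding dual_le_def
  proof (intro allI impI)
    fix x :: 'a assume x: "0 \<le> x"
    show "blinfun_apply (modulus f) x \<le> blinfun_apply k x"
    proof (rule modulus_least[OF x])
      fix y assume y: "\<bar>y\<bar> \<le> x"
      have "blinfun_apply f y = blinfun_apply f (pprt y) + blinfun_apply (- f) (pprt (- y))"
        using arg_cong[OF eq_pprt_diff[of y], of "blinfun_apply f"]
        by (simp add: blinfun.diff_right uminus_blinfun.rep_eq)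
      also have "\<dots> \<le> blinfun_apply k (pprt y) + blinfun_apply k (pprt (- y))"
        using that by (intro add_mono) (auto simp: dual_le_def)
      also have "\<dots> = blinfun_apply k \<bar>y\<bar>" by (simp add: abs_eq_pprt_add blinfun.add_right)
      also have "\<dots> \<le> blinfun_apply k x"
      proof -
        have "0 \<le> blinfun_apply k z" if "0 \<le> z" for z
          using \<open>dual_le f k\<close> \<open>dual_le (- f) k\<close> that
          unfolding dual_le_def by (fastforce simp: uminus_blinfun.rep_eq)
        then show ?thesis by (intro pos_functional_mono[OF _ y]) (simp add: pos_functional_def)
      qed
      finally show "blinfun_apply f y \<le> blinfun_apply k x" .
    qed
  qed
  moreover have "dual_le f (modulus f)"
    unfolding dual_le_def by (auto intro: modulus_upper)
  moreover have "dual_le (- f) (modulus f)"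
    unfolding dual_le_def
  proof (intro allI impI)
    fix x :: 'a assume "0 \<le> x"
    then show "blinfun_apply (- f) x \<le> blinfun_apply (modulus f) x"
      using abs_apply_le_modulus[of x x f] by (simp add: uminus_blinfun.rep_eq abs_le_iff)
  qed
  ultimately show ?thesis unfolding is_dual_abs_def is_dual_sup_def by blast
qed

lemma is_dual_abs_unique:
  assumes "is_dual_abs f F" "0 \<le> x"
  shows "blinfun_apply F x = blinfun_apply (modulus f) x"
  using assms is_dual_abs_modulus[of f]
  unfolding is_dual_abs_def is_dual_sup_def dual_le_def by (meson order_antisym)

section \<open>Disjoint functionals\<close>

text \<open>A lower bound \<open>k\<close> of both moduli is at most \<open>2e\<close> at \<open>x = a + b\<close>.\<close>

lemma dual_disjointI:
  fixes f g :: "'a::banach_lattice \<Rightarrow>\<^sub>L real"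
  assumes "\<And>x e. 0 \<le> x \<Longrightarrow> 0 < e \<Longrightarrow> \<exists>a b. 0 \<le> a \<and> 0 \<le> b \<and> x = a + b \<and>
             blinfun_apply (modulus f) a \<le> e \<and> blinfun_apply (modulus g) b \<le> e"
  shows "dual_disjoint f g"
proof -
  have "blinfun_apply k x \<le> 0" if k: "dual_le k (modulus f)" "dual_le k (modulus g)" and x: "0 \<le> x" for k x
  proof (rule field_le_epsilon)
    fix e :: real assume "0 < e"
    then obtain a b where ab: "0 \<le> a" "0 \<le> b" "x = a + b"
      "blinfun_apply (modulus f) a \<le> e / 2" "blinfun_apply (modulus g) b \<le> e / 2"
      using assms[OF x, of "e / 2"] by auto
    have "blinfun_apply k a \<le> e / 2" "blinfun_apply k b \<le> e / 2"
      using k ab unfolding dual_le_def by (meson order_trans)+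
    then show "blinfun_apply k x \<le> 0 + e" by (simp add: ab(3) blinfun.add_right)
  qed
  then have "is_dual_inf (modulus f) (modulus g) 0"
    by (auto simp: is_dual_inf_def dual_le_def modulus_nonneg)
  then show ?thesis unfolding dual_disjoint_def using is_dual_abs_modulus by blast
qed

text \<open>For positive \<open>F\<close>, \<open>G\<close> the infimum is \<open>(F + G - \<bar>F - G\<bar>) / 2\<close>. If it is at most \<open>0\<close>, then
  \<open>\<bar>F - G\<bar> x \<ge> F x + G x\<close>, so some \<open>y\<close> with \<open>\<bar>y\<bar> \<le> x\<close> nearly satisfies \<open>F y - G y = F x + G x\<close>. The
  pieces are \<open>(x - y) / 2\<close> and \<open>(x + y) / 2\<close>.\<close>

lemma dual_disjointD:
  fixes f g :: "'a::banach_lattice \<Rightarrow>\<^sub>L real"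
  assumes "dual_disjoint f g" "0 \<le> x" "0 < e"
  obtains a b where "0 \<le> a" "0 \<le> b" "x = a + b"
    "blinfun_apply (modulus f) a \<le> e" "blinfun_apply (modulus g) b \<le> e"
proof -
  let ?F = "modulus f" and ?G = "modulus g"
  \<comment> \<open>the infimum of \<open>?F\<close> and \<open>?G\<close>\<close>
  define k where "k = (1/2) *\<^sub>R (?F + ?G - modulus (?F - ?G))"
  obtain F G where FG: "is_dual_abs f F" "is_dual_abs g G" "is_dual_inf F G 0"
    using assms(1) unfolding dual_disjoint_def by blast
  have D: "\<bar>blinfun_apply ?F z - blinfun_apply ?G z\<bar> \<le> blinfun_apply (modulus (?F - ?G)) z" if "0 \<le> z" for z
    using abs_apply_le_modulus[of z z "?F - ?G"] that by (simp add: blinfun.diff_left)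
  have "dual_le k F" "dual_le k G"
    unfolding dual_le_def k_def
    using D is_dual_abs_unique[OF FG(1)] is_dual_abs_unique[OF FG(2)]
    by (fastforce simp: blinfun.add_left blinfun.diff_left blinfun.scaleR_left abs_le_iff)+
  then have "dual_le k 0" using FG(3) by (simp add: is_dual_inf_def)
  then have "blinfun_apply ?F x + blinfun_apply ?G x \<le> blinfun_apply (modulus (?F - ?G)) x"
    using assms(2)
    by (simp add: dual_le_def k_def blinfun.add_left blinfun.diff_left blinfun.scaleR_left)
  moreover obtain y where y: "\<bar>y\<bar> \<le> x"
    "blinfun_apply (modulus (?F - ?G)) x - 2 * e < blinfun_apply (?F - ?G) y"
    using modulus_approx[OF assms(2), of "2 * e" "?F - ?G"] assms(3) by auto
  ultimately have "(blinfun_apply ?F x - blinfun_apply ?F y) + (blinfun_apply ?G x + blinfun_apply ?G y) \<le> 2 * e"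
    by (simp add: blinfun.diff_left)
  moreover have nn: "0 \<le> x - y" "0 \<le> x + y"
    using y(1) by (simp_all add: abs_le_iff) (metis add.commute diff_ge_0_iff_ge diff_minus_eq_add minus_le_iff)
  moreover have "blinfun_apply ?F x - blinfun_apply ?F y \<ge> 0" "blinfun_apply ?G x + blinfun_apply ?G y \<ge> 0"
    using modulus_nonneg[OF nn(1), of f] modulus_nonneg[OF nn(2), of g]
    by (simp_all add: blinfun.diff_right blinfun.add_right)
  ultimately have "blinfun_apply ?F ((1/2) *\<^sub>R (x - y)) \<le> e" "blinfun_apply ?G ((1/2) *\<^sub>R (x + y)) \<le> e"
    by (simp_all add: blinfun.diff_right blinfun.add_right blinfun.scaleR_right)
  moreover have "x = (1/2) *\<^sub>R (x - y) + (1/2) *\<^sub>R (x + y)"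
    by (simp add: scaleR_add_right[symmetric] scaleR_2[symmetric])
  moreover have "0 \<le> (1/2) *\<^sub>R (x - y)" "0 \<le> (1/2) *\<^sub>R (x + y)"
    using nn by (simp_all only: scaleR_nonneg_nonneg)
  ultimately show ?thesis by (intro that) 
qed

lemma dual_disjoint_mono:
  fixes f g f' g' :: "'a::banach_lattice \<Rightarrow>\<^sub>L real"
  assumes "dual_disjoint f g"
    and "\<And>x. 0 \<le> x \<Longrightarrow> blinfun_apply (modulus f') x \<le> blinfun_apply (modulus f) x"
    and "\<And>x. 0 \<le> x \<Longrightarrow> blinfun_apply (modulus g') x \<le> blinfun_apply (modulus g) x"
  shows "dual_disjoint f' g'"
proof (rule dual_disjointI)
  fix x :: 'a and e :: real assume "0 \<le> x" "0 < e"
  then obtain a b where "0 \<le> a" "0 \<le> b" "x = a + b"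
    "blinfun_apply (modulus f) a \<le> e" "blinfun_apply (modulus g) b \<le> e"
    by (rule dual_disjointD[OF assms(1)])
  then show "\<exists>a b. 0 \<le> a \<and> 0 \<le> b \<and> x = a + b \<and>
             blinfun_apply (modulus f') a \<le> e \<and> blinfun_apply (modulus g') b \<le> e"
    using assms(2)[of a] assms(3)[of b] by (intro exI[of _ a] exI[of _ b]) auto
qed

lemma dual_disjoint_zero: "dual_disjoint f 0" "dual_disjoint 0 f"
proof -
  have 0: "blinfun_apply (modulus 0) x = 0" if "0 \<le> x" for x :: 'a
    using modulus_of_pos[of 0 x] that by (simp add: pos_functional_def)
  show "dual_disjoint f 0"
    by (rule dual_disjointI) (rule exI[of _ 0], auto simp: 0)
  show "dual_disjoint 0 f"
    by (rule dual_disjointI) (use 0 in force)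
qed

section \<open>The sequence space\<close>

lemma ell_dominated:
  assumes "a \<in> ell p" "\<And>n. \<bar>b n\<bar> \<le> \<bar>a n\<bar>" "0 \<le> p"
  shows "b \<in> ell p"
proof -
  have "summable (\<lambda>n. \<bar>a n\<bar> powr p)" using assms(1) by (simp add: ell_def)
  then have "summable (\<lambda>n. \<bar>b n\<bar> powr p)"
    by (rule summable_comparison_test'[where N = 0]) (use assms in \<open>auto intro: powr_mono2\<close>)
  then show ?thesis by (simp add: ell_def)
qed

lemma ell_scale: "a \<in> ell p \<Longrightarrow> (\<lambda>n. c * a n) \<in> ell p"
  by (simp add: ell_def abs_mult powr_mult summable_mult)

lemma ell_tendsto_0:
  assumes "a \<in> ell p" "0 < p"
  shows "a \<longlonglongrightarrow> 0"
proof -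
  have "(\<lambda>n. \<bar>a n\<bar> powr p) \<longlonglongrightarrow> 0" using assms by (intro summable_LIMSEQ_zero) (simp add: ell_def)
  then have "(\<lambda>n. (\<bar>a n\<bar> powr p) powr (1 / p)) \<longlonglongrightarrow> 0 powr (1 / p)"
    using assms by (intro tendsto_powr2) auto
  then show ?thesis using assms(2) by (simp add: powr_powr tendsto_rabs_zero_iff)
qed

lemma summable_imp_ell:
  assumes "summable b" "\<And>n. 0 \<le> b n" "1 \<le> p"
  shows "b \<in> ell p"
proof -
  have "\<forall>\<^sub>F n in sequentially. b n < 1"
    using summable_LIMSEQ_zero[OF assms(1)] by (rule order_tendstoD) simp
  then have "\<forall>\<^sub>F n in sequentially. norm (\<bar>b n\<bar> powr p) \<le> b n"
  proof eventually_elim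
    case (elim n)
    show ?case
    proof (cases "b n = 0")
      case False
      then have "b n powr p \<le> b n powr 1"
        using assms elim by (intro powr_mono') (auto simp: order_less_le)
      then show ?thesis using assms(2)[of n] by simp
    qed simp
  qed
  then have "summable (\<lambda>n. \<bar>b n\<bar> powr p)" using assms(1) by (rule summable_comparison_test_ev)
  then show ?thesis by (simp add: ell_def)
qed

section \<open>Moduli of disjoint weak* p-summable sequences\<close>

text \<open>Split off repeatedly: the part \<open>b\<close> on which the first \<open>n\<close> functionals are small is split again, using
  disjointness of \<open>f n\<close> and \<open>g\<close>.\<close>

lemma disjoint_from_finitely_many:
  fixes f :: "nat \<Rightarrow> ('a::banach_lattice \<Rightarrow>\<^sub>L real)"
  assumes "\<And>j. j < n \<Longrightarrow> dual_disjoint (f j) g" "0 \<le> x" "0 < e"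
  shows "\<exists>a b. 0 \<le> a \<and> 0 \<le> b \<and> x = a + b \<and>
    (\<forall>j<n. blinfun_apply (modulus (f j)) b \<le> e) \<and> blinfun_apply (modulus g) a \<le> e"
  using assms
proof (induction n arbitrary: e)
  case 0
  then show ?case by (intro exI[of _ 0] exI[of _ x]) simp
next
  case (Suc n)
  have "\<exists>a b. 0 \<le> a \<and> 0 \<le> b \<and> x = a + b \<and>
    (\<forall>j<n. blinfun_apply (modulus (f j)) b \<le> e / 2) \<and> blinfun_apply (modulus g) a \<le> e / 2"
    by (rule Suc.IH) (use Suc.prems in auto)
  then obtain a b where ab: "0 \<le> a" "0 \<le> b" "x = a + b" "blinfun_apply (modulus g) a \<le> e / 2"
    and b: "\<And>j. j < n \<Longrightarrow> blinfun_apply (modulus (f j)) b \<le> e / 2"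
    by blast
  have "dual_disjoint (f n) g" "0 < e / 2" using Suc.prems by auto
  then obtain b' a' where ab': "0 \<le> b'" "0 \<le> a'" "b = b' + a'"
     "blinfun_apply (modulus (f n)) b' \<le> e / 2" "blinfun_apply (modulus g) a' \<le> e / 2"
    using ab(2) dual_disjointD[of "f n" g b "e / 2"] by blast
  have "0 \<le> a + a'" using ab(1) ab'(2) by (rule add_nonneg_nonneg)
  moreover have "x = (a + a') + b'" by (simp add: ab(3) ab'(3) ac_simps)
  moreover have "blinfun_apply (modulus g) (a + a') \<le> e"
    using ab(4) ab'(5) by (simp add: blinfun.add_right)
  moreover have "blinfun_apply (modulus (f j)) b' \<le> e" if "j < Suc n" for j
  proof (cases "j = n")
    case False
    have "b' \<le> b" using ab'(2,3) by simp
    then have "blinfun_apply (modulus (f j)) b' \<le> blinfun_apply (modulus (f j)) b"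
      by (rule pos_functional_mono[OF pos_functional_modulus])
    then show ?thesis using b[of j] False that Suc.prems(3) by simp
  qed (use ab'(4) Suc.prems(3) in simp)
  ultimately show ?case using ab'(1) by blast
qed

text \<open>Split \<open>x = a + b\<close> so that the first \<open>n\<close> functionals are small on \<open>b\<close> and the last one is small on \<open>a\<close>.
  An element near-optimal for the former on \<open>a\<close> and one near-optimal for the latter on \<open>b\<close> hardly disturb
  each other when they are added.\<close>

lemma simultaneous_norming:
  fixes f :: "nat \<Rightarrow> ('a::banach_lattice \<Rightarrow>\<^sub>L real)"
  assumes "pairwise_dual_disjoint f" "0 \<le> x" "0 < e"
  shows "\<exists>y. \<bar>y\<bar> \<le> x \<and> (\<forall>i<n. blinfun_apply (modulus (f i)) x - e \<le> blinfun_apply (f i) y)"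
  using assms(2,3)
proof (induction n arbitrary: x e)
  case 0
  then show ?case by (intro exI[of _ 0]) simp
next
  case (Suc n)
  have "\<exists>a b. 0 \<le> a \<and> 0 \<le> b \<and> x = a + b \<and>
    (\<forall>j<n. blinfun_apply (modulus (f j)) b \<le> e / 4) \<and> blinfun_apply (modulus (f n)) a \<le> e / 4"
    by (rule disjoint_from_finitely_many)
      (use assms(1) Suc.prems in \<open>auto simp: pairwise_dual_disjoint_def\<close>)
  then obtain a b where ab: "0 \<le> a" "0 \<le> b" "x = a + b" "blinfun_apply (modulus (f n)) a \<le> e / 4"
    and b: "\<And>j. j < n \<Longrightarrow> blinfun_apply (modulus (f j)) b \<le> e / 4"
    by blast
  have "\<exists>y. \<bar>y\<bar> \<le> a \<and> (\<forall>i<n. blinfun_apply (modulus (f i)) a - e / 4 \<le> blinfun_apply (f i) y)"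
    by (rule Suc.IH) (use ab Suc.prems in auto)
  then obtain y where y: "\<bar>y\<bar> \<le> a"
    "\<And>i. i < n \<Longrightarrow> blinfun_apply (modulus (f i)) a - e / 4 \<le> blinfun_apply (f i) y" by blast
  obtain z where z: "\<bar>z\<bar> \<le> b" "blinfun_apply (modulus (f n)) b - e / 4 < blinfun_apply (f n) z"
    using modulus_approx[OF ab(2), of "e / 4" "f n"] Suc.prems by auto
  have "\<bar>y + z\<bar> \<le> x"
    using abs_triangle_ineq[of y z] add_mono[OF y(1) z(1)] unfolding ab(3) by (rule order_trans)
  moreover have "blinfun_apply (modulus (f i)) x - e \<le> blinfun_apply (f i) (y + z)" if "i < Suc n" for i
  proof (cases "i = n")
    case True
    then show ?thesis
      using abs_apply_le_modulus[OF y(1), of "f n"] z(2) ab(4)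
      by (simp add: ab(3) blinfun.add_right abs_le_iff)
  next
    case False
    then have "i < n" using that by simp
    then show ?thesis
      using abs_apply_le_modulus[OF z(1), of "f i"] y(2)[of i] b[of i] Suc.prems(2)
      by (simp add: ab(3) blinfun.add_right abs_le_iff)
  qed
  ultimately show ?case by blast
qed

lemma abs_diff_powr_le:
  fixes a b :: real
  assumes "0 \<le> p"
  shows "\<bar>a - b\<bar> powr p \<le> 2 powr p * (\<bar>a\<bar> powr p + \<bar>b\<bar> powr p)"
proof -
  have "\<bar>a - b\<bar> powr p \<le> (2 * max \<bar>a\<bar> \<bar>b\<bar>) powr p"
    using assms by (intro powr_mono2) auto
  also have "\<dots> = 2 powr p * max \<bar>a\<bar> \<bar>b\<bar> powr p" by (simp add: powr_mult)
  also have "\<dots> \<le> 2 powr p * (\<bar>a\<bar> powr p + \<bar>b\<bar> powr p)"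
    by (intro mult_left_mono) (auto simp: max_def)
  finally show ?thesis .
qed

lemma weak_star_p_summable_bound:
  fixes f :: "nat \<Rightarrow> ('a::banach \<Rightarrow>\<^sub>L real)"
  assumes f: "weak_star_p_summable p f" and p: "1 \<le> p"
  shows "\<exists>C. \<forall>N x. norm x \<le> r \<longrightarrow> (\<Sum>n<N. \<bar>blinfun_apply (f n) x\<bar> powr p) \<le> C"
proof -
  define Q where "Q N x = (\<Sum>n<N. \<bar>blinfun_apply (f n) x\<bar> powr p)" for N x
  have scale: "Q N (t *\<^sub>R x) = t powr p * Q N x" if "0 < t" for N t x
    using that by (simp add: Q_def blinfun.scaleR_right abs_mult powr_mult sum_distrib_left)
  have "\<exists>C. \<forall>N x. norm x \<le> 1 \<longrightarrow> Q N x \<le> C"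
  proof (rule uniform_bound_of_pointwise_bound[where c = "2 powr p" and p = p])
    show "continuous_on UNIV (Q N)" for N
      unfolding Q_def using p by (intro continuous_intros continuous_on_powr') auto
    show "Q N (x - y) \<le> 2 powr p * (Q N x + Q N y)" for N x y
      unfolding Q_def sum.distrib[symmetric] sum_distrib_left
      using p by (intro sum_mono) (simp add: blinfun.diff_right abs_diff_powr_le)
    show "\<exists>K. \<forall>N. Q N x \<le> K" for x
    proof (intro exI allI)
      fix N
      have "summable (\<lambda>n. \<bar>blinfun_apply (f n) x\<bar> powr p)"
        using f by (simp add: weak_star_p_summable_def ell_def)
      then show "Q N x \<le> (\<Sum>n. \<bar>blinfun_apply (f n) x\<bar> powr p)"
        unfolding Q_def by (intro sum_le_suminf) auto
    qed
  qed (use scale in auto)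
  then obtain C where C: "\<And>N x. norm x \<le> 1 \<Longrightarrow> Q N x \<le> C" by blast
  define s where "s = max r 1"
  have "Q N x \<le> s powr p * C" if "norm x \<le> r" for N x
  proof -
    have s: "0 < s" by (simp add: s_def)
    have "Q N x = s powr p * Q N ((1 / s) *\<^sub>R x)"
      using scale[OF s, of N "(1 / s) *\<^sub>R x"] s by simp
    also have "\<dots> \<le> s powr p * C"
      using s that by (intro mult_left_mono C) (auto simp: s_def)
    finally show ?thesis .
  qed
  then show ?thesis unfolding Q_def by blast
qed

text \<open>By uniform boundedness the p-th power sums of \<open>f n y\<close> are bounded uniformly over \<open>\<bar>y\<bar> \<le> x\<close>. Simultaneous norming
  transfers this bound to every finite p-th power sum of the values \<open>\<bar>f n\<bar> x\<close>.\<close>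

lemma modulus_p_summable:
  fixes f :: "nat \<Rightarrow> ('a::banach_lattice \<Rightarrow>\<^sub>L real)"
  assumes f: "pairwise_dual_disjoint f" "weak_star_p_summable p f" and p: "1 \<le> p" and x: "0 \<le> x"
  shows "(\<lambda>n. blinfun_apply (modulus (f n)) x) \<in> ell p"
proof -
  let ?F = "\<lambda>n. blinfun_apply (modulus (f n)) x"
  have F0: "0 \<le> ?F n" for n by (rule modulus_nonneg[OF x])
  obtain C where C: "\<And>N y. norm y \<le> norm x \<Longrightarrow> (\<Sum>n<N. \<bar>blinfun_apply (f n) y\<bar> powr p) \<le> C"
    using weak_star_p_summable_bound[OF f(2) p, of "norm x"] by blast
  have "(\<Sum>n<N. ?F n powr p) \<le> C" for N
  proof (rule LIMSEQ_le_const2)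
    show "(\<lambda>k. \<Sum>n<N. max 0 (?F n - inverse (real (Suc k))) powr p) \<longlonglongrightarrow> (\<Sum>n<N. ?F n powr p)"
    proof (intro tendsto_sum)
      fix n
      have "(\<lambda>k. max 0 (?F n - inverse (real (Suc k)))) \<longlonglongrightarrow> max 0 (?F n - 0)"
        by (intro tendsto_intros LIMSEQ_inverse_real_of_nat)
      then show "(\<lambda>k. max 0 (?F n - inverse (real (Suc k))) powr p) \<longlonglongrightarrow> ?F n powr p"
        using F0[of n] p by (intro tendsto_powr2) auto
    qed
    have "(\<Sum>n<N. max 0 (?F n - inverse (real (Suc k))) powr p) \<le> C" for k
    proof -
      obtain y where y: "\<bar>y\<bar> \<le> x" "\<And>i. i < N \<Longrightarrow> ?F i - inverse (real (Suc k)) \<le> blinfun_apply (f i) y"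
        using simultaneous_norming[OF f(1) x, of "inverse (real (Suc k))" N] by auto
      have "(\<Sum>n<N. max 0 (?F n - inverse (real (Suc k))) powr p) \<le> (\<Sum>n<N. \<bar>blinfun_apply (f n) y\<bar> powr p)"
        using p y(2) by (intro sum_mono powr_mono2) (auto intro: order_trans[OF _ abs_ge_self])
      also have "\<dots> \<le> C" by (rule C[OF norm_le_of_abs_le[OF y(1)]])
      finally show ?thesis .
    qed
    then show "\<exists>M. \<forall>k\<ge>M. (\<Sum>n<N. max 0 (?F n - inverse (real (Suc k))) powr p) \<le> C" by blast
  qed
  then have "summable (\<lambda>n. ?F n powr p)"
    by (intro summableI_nonneg_bounded) auto
  then show ?thesis by (simp add: ell_def F0)
qed

section \<open>Solid hulls of almost p-limited sets\<close>

definition solid_hull :: "'a::banach_lattice set \<Rightarrow> 'a set" where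
  "solid_hull A = {z. \<exists>x\<in>A. \<bar>z\<bar> \<le> \<bar>x\<bar>}"

lemma almost_p_limited_subset: "almost_p_limited p A \<Longrightarrow> B \<subseteq> A \<Longrightarrow> almost_p_limited p B"
  unfolding almost_p_limited_def by (meson subsetD)

text \<open>The sequence \<open>f, 0, 0, \<dots>\<close> is an admissible test sequence for every functional \<open>f\<close>.\<close>

lemma almost_p_limited_bounded:
  fixes A :: "'a::banach_lattice set"
  assumes A: "almost_p_limited p A"
  shows "bounded A"
proof (rule bounded_of_weakly_bounded)
  fix f :: "'a \<Rightarrow>\<^sub>L real"
  define g where "g n = (if n = 0 then f else 0)" for n :: nat
  have "pairwise_dual_disjoint g"
    by (auto simp: pairwise_dual_disjoint_def g_def dual_disjoint_zero)
  moreover have "weak_star_p_summable p g"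
    unfolding weak_star_p_summable_def ell_def
  proof (intro allI, rule CollectI, rule summable_finite[of "{0}"])
  qed (auto simp: g_def)
  ultimately obtain a where "\<forall>x\<in>A. \<forall>n. \<bar>blinfun_apply (g n) x\<bar> \<le> a n"
    using A unfolding almost_p_limited_def by blast
  then have "\<forall>x\<in>A. \<bar>blinfun_apply (g 0) x\<bar> \<le> a 0" by blast
  then have "\<forall>x\<in>A. \<bar>blinfun_apply f x\<bar> \<le> a 0" by (simp add: g_def)
  then show "\<exists>K. \<forall>x\<in>A. \<bar>blinfun_apply f x\<bar> \<le> K" by blast
qed

text \<open>Hahn--Banach for the sublinear functional \<open>y \<mapsto> F \<bar>y\<bar>\<close>.\<close>

lemma norming_functional_below_modulus:
  fixes F :: "'a::banach_lattice \<Rightarrow>\<^sub>L real"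
  assumes F: "pos_functional F"
  obtains g where "blinfun_apply g x = blinfun_apply F \<bar>x\<bar>" "\<And>y. 0 \<le> y \<Longrightarrow> blinfun_apply (modulus g) y \<le> blinfun_apply F y"
proof -
  have "sublinear (\<lambda>y. blinfun_apply F \<bar>y\<bar>)"
    unfolding sublinear_def
  proof (intro conjI allI impI)
    fix y z :: 'a
    show "blinfun_apply F \<bar>y + z\<bar> \<le> blinfun_apply F \<bar>y\<bar> + blinfun_apply F \<bar>z\<bar>"
      using pos_functional_mono[OF F abs_triangle_ineq[of y z]] by (simp add: blinfun.add_right)
  qed (simp add: abs_scaleR_nonneg blinfun.scaleR_right)
  then obtain h where h: "linear h" "\<And>y. h y \<le> blinfun_apply F \<bar>y\<bar>" "h x = blinfun_apply F \<bar>x\<bar>"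
    by (rule hahn_banach_sublinear[where ?x0.0 = x]) blast
  have "\<bar>h y\<bar> \<le> norm F * norm y" for y
  proof -
    have "\<bar>h y\<bar> \<le> blinfun_apply F \<bar>y\<bar>"
      using h(2)[of y] h(2)[of "- y"] linear_neg[OF h(1), of y] by (simp add: abs_le_iff)
    also have "\<dots> \<le> norm F * norm y"
      using norm_blinfun[of F "\<bar>y\<bar>"] by (simp add: norm_abs_eq)
    finally show ?thesis .
  qed
  then have bl: "bounded_linear h"
    using h(1) by (intro bounded_linear_intro[where K = "norm F"])
      (auto simp: linear_add linear_scale mult.commute)
  show ?thesis
  proof
    show "blinfun_apply (Blinfun h) x = blinfun_apply F \<bar>x\<bar>"
      by (simp add: bounded_linear_Blinfun_apply[OF bl] h(3))
    show "blinfun_apply (modulus (Blinfun h)) y \<le> blinfun_apply F y" if "0 \<le> y" for y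
    proof (rule modulus_least[OF that])
      fix z assume "\<bar>z\<bar> \<le> y"
      then have "blinfun_apply F \<bar>z\<bar> \<le> blinfun_apply F y" by (rule pos_functional_mono[OF F])
      then show "blinfun_apply (Blinfun h) z \<le> blinfun_apply F y"
        using h(2)[of z] by (simp add: bounded_linear_Blinfun_apply[OF bl])
    qed
  qed
qed

lemma exists_half_maximal:
  fixes h :: "'b \<Rightarrow> real"
  assumes "A \<noteq> {}" "\<And>x. x \<in> A \<Longrightarrow> 0 \<le> h x" "\<And>x. x \<in> A \<Longrightarrow> h x \<le> K"
  shows "\<exists>x\<in>A. \<forall>y\<in>A. h y \<le> 2 * h x"
proof -
  have bdd: "bdd_above (h ` A)" using assms(3) by (intro bdd_aboveI2) auto
  have up: "h y \<le> Sup (h ` A)" if "y \<in> A" for y using that bdd by (simp add: cSUP_upper)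
  show ?thesis
  proof (cases "Sup (h ` A) \<le> 0")
    case True
    obtain x where "x \<in> A" using assms(1) by blast
    moreover have "h y \<le> 2 * h x" if "y \<in> A" for y
      using up[OF that] True assms(2)[OF \<open>x \<in> A\<close>] by simp
    ultimately show ?thesis by blast
  next
    case False
    then have "Sup (h ` A) / 2 < Sup (h ` A)" by simp
    then obtain s where "s \<in> h ` A" "Sup (h ` A) / 2 < s"
      using less_cSup_iff[OF _ bdd] assms(1) by blast
    then obtain x where x: "x \<in> A" "Sup (h ` A) / 2 < h x" by blast
    have "h y \<le> 2 * h x" if "y \<in> A" for y using up[OF that] x(2) by simp
    then show ?thesis using x(1) by blast
  qed
qed

text \<open>For a test sequence \<open>f\<close> pick \<open>x n \<in> A\<close> that nearly maximizes \<open>\<bar>f n\<bar> \<bar>x\<bar>\<close> and \<open>g n\<close> with \<open>\<bar>g n\<bar> \<le> \<bar>f n\<bar>\<close>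
  and \<open>g n (x n) = \<bar>f n\<bar> \<bar>x n\<bar>\<close>. Then \<open>g\<close> is a test sequence as well, and twice its bound on \<open>A\<close>
  bounds \<open>f\<close> on the solid hull.\<close>

lemma almost_p_limited_solid_hull:
  fixes A :: "'a::banach_lattice set"
  assumes A: "almost_p_limited p A" and p: "1 \<le> p"
  shows "almost_p_limited p (solid_hull A)"
proof (cases "A = {}")
  case True
  then show ?thesis using A by (simp add: solid_hull_def)
next
  case False
  obtain B where B: "\<And>x. x \<in> A \<Longrightarrow> norm x \<le> B"
    using almost_p_limited_bounded[OF A] by (auto simp: bounded_iff)
  show ?thesis unfolding almost_p_limited_def
  proof (intro allI impI, elim conjE)
    fix f :: "nat \<Rightarrow> ('a \<Rightarrow>\<^sub>L real)"
    assume f: "pairwise_dual_disjoint f" "weak_star_p_summable p f"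
    have "\<exists>x\<in>A. \<forall>y\<in>A. blinfun_apply (modulus (f n)) \<bar>y\<bar> \<le> 2 * blinfun_apply (modulus (f n)) \<bar>x\<bar>" for n
    proof (rule exists_half_maximal[OF False])
      fix x assume "x \<in> A"
      show "0 \<le> blinfun_apply (modulus (f n)) \<bar>x\<bar>" by (simp add: modulus_nonneg)
      have "blinfun_apply (modulus (f n)) \<bar>x\<bar> \<le> norm (modulus (f n)) * norm x"
        using norm_blinfun[of "modulus (f n)" "\<bar>x\<bar>"] by (simp add: norm_abs_eq)
      also have "\<dots> \<le> norm (modulus (f n)) * B" using B[OF \<open>x \<in> A\<close>] by (rule mult_left_mono) simp
      finally show "blinfun_apply (modulus (f n)) \<bar>x\<bar> \<le> norm (modulus (f n)) * B" .
    qed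
    then have "\<forall>n. \<exists>x. x \<in> A \<and> (\<forall>y\<in>A. blinfun_apply (modulus (f n)) \<bar>y\<bar> \<le> 2 * blinfun_apply (modulus (f n)) \<bar>x\<bar>)"
      by blast
    then obtain x where x: "\<And>n. x n \<in> A"
      "\<And>n y. y \<in> A \<Longrightarrow> blinfun_apply (modulus (f n)) \<bar>y\<bar> \<le> 2 * blinfun_apply (modulus (f n)) \<bar>x n\<bar>"
      by (auto dest!: choice)
    have "\<forall>n. \<exists>g. blinfun_apply g (x n) = blinfun_apply (modulus (f n)) \<bar>x n\<bar> \<and>
        (\<forall>y\<ge>0. blinfun_apply (modulus g) y \<le> blinfun_apply (modulus (f n)) y)"
      using norming_functional_below_modulus[OF pos_functional_modulus] by metis
    then obtain g where g: "\<And>n. blinfun_apply (g n) (x n) = blinfun_apply (modulus (f n)) \<bar>x n\<bar>"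
      "\<And>n y. 0 \<le> y \<Longrightarrow> blinfun_apply (modulus (g n)) y \<le> blinfun_apply (modulus (f n)) y"
      by (auto dest!: choice)
    have "pairwise_dual_disjoint g"
      using f(1) g(2) unfolding pairwise_dual_disjoint_def by (meson dual_disjoint_mono)
    moreover have "weak_star_p_summable p g"
      unfolding weak_star_p_summable_def
    proof
      fix y
      show "(\<lambda>n. blinfun_apply (g n) y) \<in> ell p"
      proof (rule ell_dominated)
        show "(\<lambda>n. blinfun_apply (modulus (f n)) \<bar>y\<bar>) \<in> ell p"
          by (rule modulus_p_summable[OF f p]) simp
        show "\<bar>blinfun_apply (g n) y\<bar> \<le> \<bar>blinfun_apply (modulus (f n)) \<bar>y\<bar>\<bar>" for n
          using abs_apply_le_modulus[of y "\<bar>y\<bar>" "g n"] g(2)[of "\<bar>y\<bar>" n] by simp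
      qed (use p in simp)
    qed
    ultimately obtain a where a: "a \<in> ell p" "\<And>z n. z \<in> A \<Longrightarrow> \<bar>blinfun_apply (g n) z\<bar> \<le> a n"
      using A unfolding almost_p_limited_def by blast
    show "\<exists>a\<in>ell p. \<forall>z\<in>solid_hull A. \<forall>n. \<bar>blinfun_apply (f n) z\<bar> \<le> a n"
    proof (intro bexI ballI allI)
      fix z n assume "z \<in> solid_hull A"
      then obtain y where y: "y \<in> A" "\<bar>z\<bar> \<le> \<bar>y\<bar>" by (auto simp: solid_hull_def)
      have "\<bar>blinfun_apply (f n) z\<bar> \<le> blinfun_apply (modulus (f n)) \<bar>y\<bar>"
        by (rule abs_apply_le_modulus[OF y(2)])
      also have "\<dots> \<le> 2 * blinfun_apply (g n) (x n)" using x(2)[OF y(1)] by (simp add: g(1))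
      also have "\<dots> \<le> 2 * a n" using a(2)[OF x(1), of n n] by simp
      finally show "\<bar>blinfun_apply (f n) z\<bar> \<le> 2 * a n" .
    qed (rule ell_scale[OF a(1)])
  qed
qed

section \<open>Disjoint sequences in solid almost p-limited sets\<close>

text \<open>The functional \<open>G\<close> is the part of \<open>F\<close> carried by the band generated by \<open>w\<close>. Its two properties say that
  \<open>G x\<close> is the supremum of \<open>F (inf x (k w))\<close> over \<open>k\<close>.\<close>

lemma exists_carrier_functional:
  fixes F :: "'a::banach_lattice \<Rightarrow>\<^sub>L real"
  assumes F: "pos_functional F" and w: "0 \<le> w"
  shows "\<exists>G. (\<forall>x\<ge>0. \<forall>k::nat. blinfun_apply F (inf x (real k *\<^sub>R w)) \<le> blinfun_apply G x) \<and>
    (\<forall>x\<ge>0. \<forall>e>0. \<exists>k::nat. blinfun_apply G x - e < blinfun_apply F (inf x (real k *\<^sub>R w)))"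
proof -
  define T where "T x = (SUP k::nat. blinfun_apply F (inf x (real k *\<^sub>R w)))" for x
  have kw: "0 \<le> real k *\<^sub>R w" for k using w by (simp add: scaleR_nonneg_nonneg)
  have le: "blinfun_apply F (inf x (real k *\<^sub>R w)) \<le> blinfun_apply F x" for x k
    by (rule pos_functional_mono[OF F]) simp
  have bdd: "bdd_above (range (\<lambda>k::nat. blinfun_apply F (inf x (real k *\<^sub>R w))))" for x
    using le by (intro bdd_aboveI2) auto
  have up: "blinfun_apply F (inf x (real k *\<^sub>R w)) \<le> T x" for x k
    unfolding T_def by (rule cSUP_upper[OF _ bdd]) simp
  have least: "T x \<le> c" if "\<And>k::nat. blinfun_apply F (inf x (real k *\<^sub>R w)) \<le> c" for x c
    unfolding T_def by (rule cSUP_least) (use that in auto)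
  have T0: "0 \<le> T x" if "0 \<le> x" for x
    using up[of x 0] that by (simp add: inf_absorb2)
  have TF: "T x \<le> blinfun_apply F x" for x by (rule least[OF le])
  have add: "T (x + y) = T x + T y" if x: "0 \<le> x" and y: "0 \<le> y" for x y
  proof (rule order_antisym)
    show "T (x + y) \<le> T x + T y"
    proof (rule least)
      fix k
      have "blinfun_apply F (inf (x + y) (real k *\<^sub>R w)) \<le>
          blinfun_apply F (inf x (real k *\<^sub>R w) + inf y (real k *\<^sub>R w))"
        by (intro pos_functional_mono[OF F] inf_add_le x y kw)
      also have "\<dots> \<le> T x + T y" unfolding blinfun.add_right by (intro add_mono up)
      finally show "blinfun_apply F (inf (x + y) (real k *\<^sub>R w)) \<le> T x + T y" .
    qed
    have *: "blinfun_apply F (inf x (real k *\<^sub>R w)) + blinfun_apply F (inf y (real l *\<^sub>R w)) \<le> T (x + y)" for k l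
    proof -
      have "inf x (real k *\<^sub>R w) + inf y (real l *\<^sub>R w) \<le> inf (x + y) (real (k + l) *\<^sub>R w)"
        by (intro inf_greatest) (simp_all add: add_mono scaleR_add_left)
      then have "blinfun_apply F (inf x (real k *\<^sub>R w) + inf y (real l *\<^sub>R w)) \<le>
         blinfun_apply F (inf (x + y) (real (k + l) *\<^sub>R w))" by (rule pos_functional_mono[OF F])
      also have "\<dots> \<le> T (x + y)" by (rule up)
      finally show ?thesis by (simp add: blinfun.add_right)
    qed
    have "T y \<le> T (x + y) - blinfun_apply F (inf x (real k *\<^sub>R w))" for k
      by (rule least) (use *[of k] in \<open>simp add: algebra_simps\<close>)
    then have "T x \<le> T (x + y) - T y" by (intro least) (simp add: algebra_simps)
    then show "T x + T y \<le> T (x + y)" by simp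
  qed
  have sc: "T (c *\<^sub>R x) \<le> c * T x" if c: "0 < c" and x: "0 \<le> x" for c x
  proof (rule least)
    fix k :: nat
    obtain l :: nat where l: "real k / c \<le> real l" using real_arch_simple by blast
    have "inf (c *\<^sub>R x) (real k *\<^sub>R w) \<le> inf (c *\<^sub>R x) (c *\<^sub>R (real l *\<^sub>R w))"
      using l c w by (intro inf_mono) (auto simp: field_simps intro: scaleR_right_mono)
    also have "\<dots> = c *\<^sub>R inf x (real l *\<^sub>R w)" using c by (simp only: inf_scaleR less_imp_le)
    finally have "blinfun_apply F (inf (c *\<^sub>R x) (real k *\<^sub>R w)) \<le> blinfun_apply F (c *\<^sub>R inf x (real l *\<^sub>R w))"
      by (rule pos_functional_mono[OF F])
    also have "\<dots> \<le> c * T x" using up[of x l] c by (simp add: blinfun.scaleR_right)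
    finally show "blinfun_apply F (inf (c *\<^sub>R x) (real k *\<^sub>R w)) \<le> c * T x" .
  qed
  have scale: "T (c *\<^sub>R x) = c * T x" if c: "0 < c" and x: "0 \<le> x" for c x
    using sc[OF c x] sc[of "1 / c" "c *\<^sub>R x"] c x
    by (simp add: scaleR_nonneg_nonneg field_simps)
  have "\<bar>T x\<bar> \<le> norm F * norm x" if "0 \<le> x" for x
    using T0[OF that] TF[of x] norm_blinfun[of F x] by simp
  then obtain G where G: "\<And>x. 0 \<le> x \<Longrightarrow> blinfun_apply G x = T x"
    using positive_cone_extension[of T "norm F"] add scale by blast
  have "\<exists>k::nat. T x - e < blinfun_apply F (inf x (real k *\<^sub>R w))" if "0 < e" for x e
  proof (rule ccontr)
    assume "\<not> ?thesis"
    then have "T x \<le> T x - e" by (intro least) (simp add: not_less)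
    then show False using that by simp
  qed
  then show ?thesis using up G by (intro exI[of _ G]) auto
qed

text \<open>For disjoint elements the sum is the supremum.\<close>

lemma sum_disjoint_le:
  fixes b :: "nat \<Rightarrow> 'a::banach_lattice"
  assumes "\<And>n. 0 \<le> b n" "\<And>n. b n \<le> y" "\<And>m n. m \<noteq> n \<Longrightarrow> inf (b m) (b n) = 0" "0 \<le> y"
  shows "(\<Sum>n<N. b n) \<le> y"
proof (induction N)
  case (Suc N)
  have S: "0 \<le> (\<Sum>n<M. b n)" for M by (intro sum_nonneg assms)
  have "inf (\<Sum>n<M. b n) (b N) \<le> 0" if "M \<le> N" for M
    using that
  proof (induction M)
    case 0 then show ?case by simp
  next
    case (Suc M)
    have "inf (\<Sum>n<Suc M. b n) (b N) \<le> inf (\<Sum>n<M. b n) (b N) + inf (b M) (b N)"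
      using inf_add_le[OF S[of M] assms(1)[of M] assms(1)[of N]] by simp
    also have "\<dots> \<le> 0" using Suc assms(3)[of M N] by simp
    finally show ?case .
  qed
  then have "inf (\<Sum>n<N. b n) (b N) \<le> 0" by simp
  moreover have "(\<Sum>n<N. b n) + b N = sup (\<Sum>n<N. b n) (b N) + inf (\<Sum>n<N. b n) (b N)"
    by (rule add_eq_inf_sup)
  ultimately have "(\<Sum>n<N. b n) + b N \<le> sup (\<Sum>n<N. b n) (b N) + 0"
    by (metis add_left_mono)
  also have "\<dots> \<le> y" using Suc.IH assms(2) by simp
  finally show ?case by simp
qed (use assms in simp)

text \<open>The parts \<open>G n\<close> of \<open>F\<close> carried by the bands of the \<open>x n\<close> are disjoint, and their sum is dominated by \<open>F\<close>,
  so that \<open>G n z\<close> is absolutely summable and hence p-summable for each \<open>z\<close>. As \<open>A\<close> is almost p-limited,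
  \<open>F (x n) = G n (x n)\<close> is dominated by a p-summable sequence.\<close>

lemma pos_functional_disjoint_tendsto_0:
  fixes A :: "'a::banach_lattice set"
  assumes A: "almost_p_limited p A" and p: "1 \<le> p"
    and x: "\<And>n. x n \<in> A" "\<And>n. 0 \<le> x n" "disjoint_seq x" and F: "pos_functional F"
  shows "(\<lambda>n. blinfun_apply F (x n)) \<longlonglongrightarrow> 0"
proof -
  have "\<forall>n. \<exists>G. (\<forall>y\<ge>0. \<forall>k::nat. blinfun_apply F (inf y (real k *\<^sub>R x n)) \<le> blinfun_apply G y) \<and>
    (\<forall>y\<ge>0. \<forall>e>0. \<exists>k::nat. blinfun_apply G y - e < blinfun_apply F (inf y (real k *\<^sub>R x n)))"
    using exists_carrier_functional[OF F] x(2) by blast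
  then have "\<exists>G. \<forall>n. (\<forall>y\<ge>0. \<forall>k::nat. blinfun_apply F (inf y (real k *\<^sub>R x n)) \<le> blinfun_apply (G n) y) \<and>
    (\<forall>y\<ge>0. \<forall>e>0. \<exists>k::nat. blinfun_apply (G n) y - e < blinfun_apply F (inf y (real k *\<^sub>R x n)))"
    by (rule choice)
  then obtain G where G: "\<And>n y k. 0 \<le> y \<Longrightarrow> blinfun_apply F (inf y (real k *\<^sub>R x n)) \<le> blinfun_apply (G n) y"
    "\<And>n y e. 0 \<le> y \<Longrightarrow> 0 < e \<Longrightarrow> \<exists>k::nat. blinfun_apply (G n) y - e < blinfun_apply F (inf y (real k *\<^sub>R x n))"
    by blast
  have kx: "0 \<le> real k *\<^sub>R x n" for k n using x(2) by (simp add: scaleR_nonneg_nonneg)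
  have dis: "inf (x m) (x n) = 0" if "m \<noteq> n" for m n
    using x(3) that x(2) unfolding disjoint_seq_def by (metis abs_of_nonneg)
  have Gpos: "pos_functional (G n)" for n
    unfolding pos_functional_def
    using G(1)[of _ 0 n] by (auto simp: inf_absorb2)
  have "pairwise_dual_disjoint G"
    unfolding pairwise_dual_disjoint_def
  proof (intro allI impI)
    fix m n :: nat assume mn: "m \<noteq> n"
    show "dual_disjoint (G m) (G n)"
    proof (rule dual_disjointI)
      fix y :: 'a and e :: real assume y: "0 \<le> y" and e: "0 < e"
      obtain k :: nat where k: "blinfun_apply (G m) y - e < blinfun_apply F (inf y (real k *\<^sub>R x m))"
        using G(2)[OF y e] by blast
      \<comment> \<open>\<open>b\<close> lies in the band of \<open>x m\<close>, where \<open>G n\<close> vanishes, and exhausts \<open>G m\<close> up to \<open>e\<close>\<close>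
      define b where "b = inf y (real k *\<^sub>R x m)"
      have b: "0 \<le> b" "b \<le> y" using y kx by (auto simp: b_def)
      have "blinfun_apply F b \<le> blinfun_apply (G m) b"
        using G(1)[OF b(1), of k m] by (simp add: b_def inf_assoc)
      then have 1: "blinfun_apply (G m) (y - b) \<le> e" using k by (simp add: blinfun.diff_right b_def)
      have "blinfun_apply (G n) b \<le> 0"
      proof (rule field_le_epsilon)
        fix d :: real assume "0 < d"
        then obtain l :: nat where l: "blinfun_apply (G n) b - d < blinfun_apply F (inf b (real l *\<^sub>R x n))"
          using G(2)[OF b(1)] by blast
        have "inf (real k *\<^sub>R x m) (real l *\<^sub>R x n) = 0"
          by (rule inf_scaleR_eq_0[OF dis[OF mn]]) auto
        then have "inf b (real l *\<^sub>R x n) = 0"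
          by (rule inf_eq_0_mono) (use b kx in \<open>auto simp: b_def\<close>)
        then show "blinfun_apply (G n) b \<le> 0 + d" using l by simp
      qed
      then show "\<exists>a b. 0 \<le> a \<and> 0 \<le> b \<and> y = a + b \<and>
             blinfun_apply (modulus (G m)) a \<le> e \<and> blinfun_apply (modulus (G n)) b \<le> e"
        using b e 1 by (intro exI[of _ "y - b"] exI[of _ b]) (auto simp: modulus_of_pos[OF Gpos])
    qed
  qed
  moreover have "weak_star_p_summable p G"
    unfolding weak_star_p_summable_def
  proof
    fix z :: 'a
    let ?y = "\<bar>z\<bar>"
    have "(\<Sum>n<N. blinfun_apply (G n) ?y) \<le> blinfun_apply F ?y" for N
    proof (rule field_le_epsilon)
      fix e :: real assume e: "0 < e"
      have "\<forall>n. \<exists>k::nat. blinfun_apply (G n) ?y - e / (real N + 1) < blinfun_apply F (inf ?y (real k *\<^sub>R x n))"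
        using e by (intro allI G(2)) auto
      then obtain k :: "nat \<Rightarrow> nat" where
        k: "\<And>n. blinfun_apply (G n) ?y - e / (real N + 1) < blinfun_apply F (inf ?y (real (k n) *\<^sub>R x n))"
        by (auto dest!: choice)
      define b where "b n = inf ?y (real (k n) *\<^sub>R x n)" for n
      have b0: "0 \<le> b n" for n using kx by (simp add: b_def)
      have "(\<Sum>n<N. b n) \<le> ?y"
      proof (rule sum_disjoint_le)
        fix m n :: nat assume "m \<noteq> n"
        then have "inf (real (k m) *\<^sub>R x m) (real (k n) *\<^sub>R x n) = 0"
          by (intro inf_scaleR_eq_0 dis) auto
        then show "inf (b m) (b n) = 0"
          by (rule inf_eq_0_mono) (use b0 in \<open>auto simp: b_def\<close>)
      qed (use b0 in \<open>auto simp: b_def\<close>)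
      then have "blinfun_apply F (\<Sum>n<N. b n) \<le> blinfun_apply F ?y" by (rule pos_functional_mono[OF F])
      moreover have "(\<Sum>n<N. blinfun_apply (G n) ?y) \<le> (\<Sum>n<N. blinfun_apply F (b n) + e / (real N + 1))"
        using k by (intro sum_mono) (simp add: b_def less_imp_le diff_less_eq)
      moreover have "\<dots> = blinfun_apply F (\<Sum>n<N. b n) + real N * (e / (real N + 1))"
        by (simp add: sum.distrib blinfun.sum_right)
      moreover have "real N * (e / (real N + 1)) \<le> e" using e by (simp add: field_simps)
      ultimately show "(\<Sum>n<N. blinfun_apply (G n) ?y) \<le> blinfun_apply F ?y + e" by linarith
    qed
    then have "summable (\<lambda>n. blinfun_apply (G n) ?y)"
      by (intro summableI_nonneg_bounded) (auto intro: pos_functional_nonneg[OF Gpos])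
    then have "(\<lambda>n. blinfun_apply (G n) ?y) \<in> ell p"
      using p by (intro summable_imp_ell) (auto intro: pos_functional_nonneg[OF Gpos])
    then show "(\<lambda>n. blinfun_apply (G n) z) \<in> ell p"
    proof (rule ell_dominated)
      show "\<bar>blinfun_apply (G n) z\<bar> \<le> \<bar>blinfun_apply (G n) \<bar>z\<bar>\<bar>" for n
        using abs_apply_le_modulus[of z "\<bar>z\<bar>" "G n"] by (simp add: modulus_of_pos[OF Gpos])
    qed (use p in simp)
  qed
  ultimately obtain a where a: "a \<in> ell p" "\<And>z n. z \<in> A \<Longrightarrow> \<bar>blinfun_apply (G n) z\<bar> \<le> a n"
    using A unfolding almost_p_limited_def by blast
  show ?thesis
  proof (rule tendsto_sandwich[OF _ _ tendsto_const ell_tendsto_0[OF a(1)]])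
    show "\<forall>\<^sub>F n in sequentially. 0 \<le> blinfun_apply F (x n)"
      using x(2) F by (simp add: pos_functional_nonneg)
    have "blinfun_apply F (x n) \<le> a n" for n
      using G(1)[of "x n" 1 n] a(2)[OF x(1)[of n], of n] x(2) by simp
    then show "\<forall>\<^sub>F n in sequentially. blinfun_apply F (x n) \<le> a n" by simp
  qed (use p in simp)
qed

definition disjoint_null :: "'a::banach_lattice set \<Rightarrow> bool" where
  "disjoint_null S \<longleftrightarrow> (\<forall>w. disjoint_seq w \<longrightarrow> (\<forall>n. w n \<in> S) \<longrightarrow> w \<longlonglongrightarrow> 0)"

lemma disjoint_null_solid_hull:
  fixes A :: "'a::banach_lattice set"
  assumes H: "\<And>x :: nat \<Rightarrow> 'a. weakly_null x \<Longrightarrow> almost_p_limited_seq p x \<Longrightarrow> norm_null x"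
    and A: "almost_p_limited p A" and p: "1 \<le> p"
  shows "disjoint_null (solid_hull A)"
  unfolding disjoint_null_def
proof (intro allI impI)
  fix w :: "nat \<Rightarrow> 'a" assume w: "disjoint_seq w" "\<forall>n. w n \<in> solid_hull A"
  have S: "almost_p_limited p (solid_hull A)" by (rule almost_p_limited_solid_hull[OF A p])
  have aw: "\<bar>w n\<bar> \<in> solid_hull A" for n using w(2) by (auto simp: solid_hull_def)
  have "weakly_null (\<lambda>n. \<bar>w n\<bar>)"
    unfolding weakly_null_def
  proof
    fix f :: "'a \<Rightarrow>\<^sub>L real"
    have "(\<lambda>n. blinfun_apply (modulus f) \<bar>w n\<bar>) \<longlonglongrightarrow> 0"
      by (rule pos_functional_disjoint_tendsto_0[OF S p aw])
        (use w(1) in \<open>auto simp: pos_functional_modulus disjoint_seq_def\<close>)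
    then show "(\<lambda>n. blinfun_apply f \<bar>w n\<bar>) \<longlonglongrightarrow> 0"
      by (rule Lim_null_comparison[rotated]) (simp add: abs_apply_le_modulus)
  qed
  moreover have "almost_p_limited_seq p (\<lambda>n. \<bar>w n\<bar>)"
    unfolding almost_p_limited_seq_def
    by (rule almost_p_limited_subset[OF S]) (use aw in auto)
  ultimately have "norm_null (\<lambda>n. \<bar>w n\<bar>)" by (rule H)
  then show "w \<longlonglongrightarrow> 0" by (simp add: norm_null_def norm_abs_eq tendsto_norm_zero_iff)
qed

section \<open>Approximate order boundedness\<close>

text \<open>If no \<open>u\<close> works, choose \<open>x n \<in> S\<close> inductively with \<open>\<parallel>(x n - 4\<^sup>n (x 0 + \<dots> + x (n - 1)))\<^sup>+\<parallel> > e\<close>.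
  Subtracting in addition a small multiple of a common majorant \<open>z\<close>, a weighted sum of all \<open>x n\<close>, makes these positive parts
  disjoint without changing their norms much, and they remain in \<open>S\<close>.\<close>

lemma approximately_order_bounded:
  fixes S :: "'a::banach_lattice set"
  assumes S: "disjoint_null S" "bounded S" and solid: "\<And>x y. x \<in> S \<Longrightarrow> \<bar>y\<bar> \<le> \<bar>x\<bar> \<Longrightarrow> y \<in> S"
    and e: "0 < e"
  shows "\<exists>u\<ge>0. \<forall>x\<in>S. norm (pprt (\<bar>x\<bar> - u)) \<le> e"
proof (rule ccontr)
  assume "\<not> ?thesis"
  then have neg: "\<exists>x\<in>S. e < norm (pprt (\<bar>x\<bar> - u))" if "0 \<le> u" for u using that by force
  define pick where "pick u = (SOME x. x \<in> S \<and> e < norm (pprt (\<bar>x\<bar> - u)))" for u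
  have pick: "pick u \<in> S" "e < norm (pprt (\<bar>pick u\<bar> - u))" if "0 \<le> u" for u
    using someI_ex[of "\<lambda>x. x \<in> S \<and> e < norm (pprt (\<bar>x\<bar> - u))"] neg[OF that]
    unfolding pick_def by blast+
  \<comment> \<open>the running sum of the moduli of the chosen elements; the \<open>n\<close>-th choice is made against \<open>4\<^sup>n s n\<close>\<close>
  define s where "s = rec_nat 0 (\<lambda>n t. t + \<bar>pick (4 ^ n *\<^sub>R t)\<bar>)"
  have s0: "s 0 = 0" and sS: "s (Suc n) = s n + \<bar>pick (4 ^ n *\<^sub>R s n)\<bar>" for n
    by (simp_all add: s_def)
  have s_nn: "0 \<le> s n" for n by (induction n) (simp_all add: s0 sS)
  have s4: "0 \<le> (4::real) ^ n *\<^sub>R s n" for n by (intro scaleR_nonneg_nonneg s_nn) simp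
  define x where "x n = \<bar>pick (4 ^ n *\<^sub>R s n)\<bar>" for n
  have x0: "0 \<le> x n" for n by (simp add: x_def)
  have xS: "x n \<in> S" for n unfolding x_def by (rule solid[OF pick(1)[OF s4[of n]]]) simp
  have xe: "e < norm (pprt (x n - 4 ^ n *\<^sub>R s n))" for n using pick(2)[OF s4] by (simp add: x_def)
  have sx: "s (Suc n) = s n + x n" for n by (simp add: sS x_def)
  have s_mono: "s m \<le> s n" if "m \<le> n" for m n
    using that by (induction n rule: dec_induct) (simp_all add: sx x0 add_increasing2)
  obtain B where B: "\<And>x. x \<in> S \<Longrightarrow> norm x \<le> B" using S(2) by (auto simp: bounded_iff)
  define z where "z = (\<Sum>n. (1/2) ^ n *\<^sub>R x n)"
  have summ: "summable (\<lambda>n. (1/2) ^ n *\<^sub>R x n)"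
  proof (rule summable_norm_cancel, rule summable_comparison_test'[where N = 0])
    show "summable (\<lambda>n. B * (1/2::real) ^ n)" by (intro summable_mult summable_geometric) simp
    show "norm (norm ((1/2) ^ n *\<^sub>R x n)) \<le> B * (1/2::real) ^ n" for n
      using B[OF xS[of n]] by (simp add: mult.commute mult_left_mono)
  qed
  have z_ge: "(1/2) ^ n *\<^sub>R x n \<le> z" for n
  proof -
    have nn: "0 \<le> (1/2::real) ^ i *\<^sub>R x i" for i by (intro scaleR_nonneg_nonneg x0) simp
    have "(\<lambda>N. (\<Sum>i<N + Suc n. (1/2) ^ i *\<^sub>R x i) - (1/2) ^ n *\<^sub>R x n) \<longlonglongrightarrow> z - (1/2) ^ n *\<^sub>R x n"
      unfolding z_def by (intro tendsto_intros LIMSEQ_ignore_initial_segment summable_LIMSEQ summ)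
    then have "0 \<le> z - (1/2) ^ n *\<^sub>R x n"
    proof (rule nonneg_tendsto)
      fix N
      have "(1/2) ^ n *\<^sub>R x n \<le> (\<Sum>i<N + Suc n. (1/2) ^ i *\<^sub>R x i)"
        using nn sum_mono2[of "{..<N + Suc n}" "{n}" "\<lambda>i. (1/2) ^ i *\<^sub>R x i"] by simp
      then show "0 \<le> (\<Sum>i<N + Suc n. (1/2) ^ i *\<^sub>R x i) - (1/2) ^ n *\<^sub>R x n" by simp
    qed simp
    then show ?thesis by simp
  qed
  have z0: "0 \<le> z" using z_ge[of 0] x0[of 0] by (simp add: order_trans)
  define w where "w n = pprt (x n - 4 ^ n *\<^sub>R s n - (1/2) ^ n *\<^sub>R z)" for n
  have w0: "0 \<le> w n" for n by (simp add: w_def)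
  have wx: "w n \<le> x n" for n
  proof -
    have "0 \<le> (1/2::real) ^ n *\<^sub>R z" using z0 by (simp add: scaleR_nonneg_nonneg)
    then have "x n - 4 ^ n *\<^sub>R s n - (1/2) ^ n *\<^sub>R z \<le> x n"
      using s4[of n] by (simp add: diff_le_eq add_increasing2)
    then show ?thesis by (simp add: w_def pprt_le_iff x0)
  qed
  have "disjoint_seq w"
  proof (rule disjoint_seqI)
    fix n m :: nat assume nm: "n < m"
    \<comment> \<open>\<open>w n\<close> is dominated by a multiple of the positive part of \<open>?d\<close>, and \<open>w m\<close> by its negative part\<close>
    let ?d = "4 ^ m *\<^sub>R x n - x m"
    have "w m \<le> pprt (- ?d)"
      unfolding w_def
    proof (rule pprt_mono)
      have "x n \<le> s (Suc n)" using s_nn[of n] by (simp add: sx)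
      also have "\<dots> \<le> s m" using nm by (intro s_mono) simp
      finally have "(4::real) ^ m *\<^sub>R x n \<le> 4 ^ m *\<^sub>R s m" by (rule scaleR_left_mono) simp
      moreover have "0 \<le> (1/2::real) ^ m *\<^sub>R z" using z0 by (simp add: scaleR_nonneg_nonneg)
      ultimately have "x m - 4 ^ m *\<^sub>R s m - (1/2) ^ m *\<^sub>R z \<le> x m - 4 ^ m *\<^sub>R x n - 0"
        by (intro diff_mono) auto
      then show "x m - 4 ^ m *\<^sub>R s m - (1/2) ^ m *\<^sub>R z \<le> - ?d" by simp
    qed
    moreover have "w n \<le> pprt ((1/4) ^ m *\<^sub>R ?d)"
      unfolding w_def
    proof (rule pprt_mono)
      have "(1/4::real) ^ m *\<^sub>R x m \<le> ((1/2) ^ n * (1/2) ^ m) *\<^sub>R x m"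
      proof (rule scaleR_right_mono[OF _ x0])
        have "(1/4::real) ^ m = (1/2) ^ m * (1/2) ^ m" by (simp flip: power_mult_distrib)
        also have "\<dots> \<le> (1/2) ^ n * (1/2) ^ m" using nm by (intro mult_right_mono power_decreasing) auto
        finally show "(1/4::real) ^ m \<le> (1/2) ^ n * (1/2) ^ m" .
      qed
      also have "\<dots> = (1/2) ^ n *\<^sub>R ((1/2) ^ m *\<^sub>R x m)" by simp
      also have "\<dots> \<le> (1/2) ^ n *\<^sub>R z" by (intro scaleR_left_mono z_ge) simp
      finally have "x n - 4 ^ n *\<^sub>R s n - (1/2) ^ n *\<^sub>R z \<le> x n - 0 - (1/4::real) ^ m *\<^sub>R x m"
        using s4 by (intro diff_mono) auto
      also have "\<dots> = (1/4) ^ m *\<^sub>R ?d"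
        by (simp add: scaleR_diff_right power_one_over)
      finally show "x n - 4 ^ n *\<^sub>R s n - (1/2) ^ n *\<^sub>R z \<le> (1/4) ^ m *\<^sub>R ?d" .
    qed
    moreover have "inf (pprt ((1/4) ^ m *\<^sub>R ?d)) (pprt (- ?d)) = 0"
      using inf_scaleR_eq_0[OF inf_pprt_pprt_uminus[of ?d], of "(1/4) ^ m" 1] by (simp add: pprt_scaleR)
    ultimately have "inf (w n) (w m) = 0" using w0 inf_eq_0_mono by blast
    then show "inf \<bar>w n\<bar> \<bar>w m\<bar> = 0" by (simp add: w0)
  qed
  moreover have "w n \<in> S" for n using solid[OF xS[of n], of "w n"] w0 wx x0 by simp
  ultimately have "w \<longlonglongrightarrow> 0" using S(1) by (simp add: disjoint_null_def)
  then have "(\<lambda>n. norm (w n) + (1/2) ^ n * norm z) \<longlonglongrightarrow> 0 + 0 * norm z"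
    by (intro tendsto_intros tendsto_norm_zero LIMSEQ_power_zero) simp_all
  then have "\<forall>\<^sub>F n in sequentially. norm (w n) + (1/2) ^ n * norm z < e"
    using e by (intro order_tendstoD) auto
  then obtain n where n: "norm (w n) + (1/2) ^ n * norm z < e" by (auto simp: eventually_sequentially)
  have nn: "0 \<le> (1/2::real) ^ n *\<^sub>R z" using z0 by (simp add: scaleR_nonneg_nonneg)
  have "x n - 4 ^ n *\<^sub>R s n \<le> w n + (1/2) ^ n *\<^sub>R z"
    using le_pprt[of "x n - 4 ^ n *\<^sub>R s n - (1/2) ^ n *\<^sub>R z"] by (simp add: w_def diff_le_eq)
  then have "pprt (x n - 4 ^ n *\<^sub>R s n) \<le> w n + (1/2) ^ n *\<^sub>R z"
    using w0[of n] nn by (simp add: pprt_le_iff)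
  then have "norm (pprt (x n - 4 ^ n *\<^sub>R s n)) \<le> norm (w n + (1/2) ^ n *\<^sub>R z)" by (rule norm_mono[rotated]) simp
  also have "\<dots> \<le> norm (w n) + (1/2) ^ n * norm z"
    using norm_triangle_ineq[of "w n" "(1/2) ^ n *\<^sub>R z"] by simp
  finally show False using n xe[of n] by simp
qed

section \<open>Functionals that control the norm on order intervals\<close>

definition order_interval :: "'a::banach_lattice \<Rightarrow> 'a set" where
  "order_interval u = {x. \<bar>x\<bar> \<le> u}"

lemma order_interval_iff: "x \<in> order_interval u \<longleftrightarrow> - u \<le> x \<and> x \<le> u"
  by (auto simp: order_interval_def abs_le_iff minus_le_iff)

definition closed_sublattice :: "'a::banach_lattice set \<Rightarrow> bool" where
  "closed_sublattice F \<longleftrightarrow> subspace F \<and> closed F \<and> (\<forall>x\<in>F. \<bar>x\<bar> \<in> F)"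

lemma closed_sublattice_sup:
  assumes "closed_sublattice F" "x \<in> F" "y \<in> F"
  shows "sup x y \<in> F"
  using assms unfolding closed_sublattice_def sup_eq_half[of x y]
  by (intro subspace_scale subspace_add) (auto intro: subspace_diff)

definition strictly_positive_on :: "'a::banach_lattice set \<Rightarrow> ('a \<Rightarrow>\<^sub>L real) \<Rightarrow> bool" where
  "strictly_positive_on F f \<longleftrightarrow> pos_functional f \<and> (\<forall>x\<in>F. 0 \<le> x \<longrightarrow> blinfun_apply f x = 0 \<longrightarrow> x = 0)"

lemma incseq_convergent:
  fixes x :: "nat \<Rightarrow> 'a::banach_lattice"
  assumes oc: "\<And>v::'a. 0 \<le> v \<Longrightarrow> disjoint_null (order_interval v)"
    and x: "incseq x" "\<And>n. x n \<in> order_interval u" and u: "0 \<le> u"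
  shows "\<exists>l. x \<longlonglongrightarrow> l \<and> (\<forall>n. x n \<le> l)"
proof -
  have "Cauchy x"
  proof (rule incseq_Cauchy[where u = u])
    fix w :: "nat \<Rightarrow> 'a" assume w: "disjoint_seq w" "\<And>n. 0 \<le> w n \<and> w n \<le> 2 *\<^sub>R u"
    have "disjoint_null (order_interval (2 *\<^sub>R u))"
      using u by (intro oc scaleR_nonneg_nonneg) auto
    then show "w \<longlonglongrightarrow> 0" using w by (simp add: disjoint_null_def order_interval_def)
  qed (use x u in \<open>auto simp: order_interval_iff\<close>)
  then obtain l where l: "x \<longlonglongrightarrow> l" using Cauchy_convergent_iff convergent_def by blast
  have "x n \<le> l" for n
  proof -
    have "(\<lambda>k. x (k + n) - x n) \<longlonglongrightarrow> l - x n"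
      by (intro tendsto_intros LIMSEQ_ignore_initial_segment l)
    then have "0 \<le> l - x n"
      by (rule nonneg_tendsto) (use x(1) in \<open>auto simp: incseq_def\<close>)
    then show ?thesis by simp
  qed
  then show ?thesis using l by blast
qed

text \<open>Otherwise some terms \<open>v n\<close> have norm at least \<open>e\<close> while \<open>f (v n) \<le> 2\<^sup>-\<^sup>n\<close>. The suprema \<open>L n\<close> of the tails exist
  as limits of monotone sequences, satisfy \<open>f (L n) \<le> 2 \<cdot> 2\<^sup>-\<^sup>n\<close>, and decrease to an element of \<open>F\<close> on which \<open>f\<close>
  vanishes. By strict positivity this limit is \<open>0\<close>, although \<open>v n \<le> L n\<close>.\<close>

lemma norm_tendsto_0_of_strictly_positive:
  fixes y :: "nat \<Rightarrow> 'a::banach_lattice"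
  assumes oc: "\<And>v::'a. 0 \<le> v \<Longrightarrow> disjoint_null (order_interval v)"
    and F: "closed_sublattice F" and f: "strictly_positive_on F f"
    and y: "\<And>n. y n \<in> F" "\<And>n. 0 \<le> y n" "\<And>n. y n \<le> u"
    and lim: "(\<lambda>n. blinfun_apply f (y n)) \<longlonglongrightarrow> 0"
  shows "y \<longlonglongrightarrow> 0"
proof (rule ccontr)
  assume "\<not> y \<longlonglongrightarrow> 0"
  then obtain e where e: "0 < e" "\<And>M. \<exists>n\<ge>M. e \<le> norm (y n)"
    unfolding LIMSEQ_iff by (auto simp: not_less)
  have pos: "pos_functional f" using f by (simp add: strictly_positive_on_def)
  have u: "0 \<le> u" using y(2,3) order_trans by blast
  have "\<exists>m. e \<le> norm (y m) \<and> blinfun_apply f (y m) \<le> (1/2) ^ n" for n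
  proof -
    have "\<forall>\<^sub>F m in sequentially. blinfun_apply f (y m) < (1/2) ^ n"
      using lim by (rule order_tendstoD) simp
    then obtain M where "\<And>m. m \<ge> M \<Longrightarrow> blinfun_apply f (y m) < (1/2) ^ n"
      by (auto simp: eventually_sequentially)
    then show ?thesis using e(2)[of M] by (meson less_imp_le)
  qed
  then have "\<exists>r. \<forall>n. e \<le> norm (y (r n)) \<and> blinfun_apply f (y (r n)) \<le> (1/2) ^ n"
    by (intro choice) blast
  then obtain r where r: "\<And>n. e \<le> norm (y (r n))" "\<And>n. blinfun_apply f (y (r n)) \<le> (1/2) ^ n"
    by blast
  define v where "v n = y (r n)" for n
  \<comment> \<open>\<open>S n N\<close> is the supremum of \<open>v n, \<dots>, v (n + N)\<close>\<close>
  define S where "S n = rec_nat (v n) (\<lambda>N s. sup s (v (n + Suc N)))" for n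
  have S0: "S n 0 = v n" and SS: "S n (Suc N) = sup (S n N) (v (n + Suc N))" for n N
    by (simp_all add: S_def)
  have S_nn: "0 \<le> S n N" and S_u: "S n N \<le> u" and S_F: "S n N \<in> F" for n N
    by (induction N; simp add: S0 SS v_def y le_supI1 closed_sublattice_sup[OF F])+
  have S_f: "blinfun_apply f (S n N) \<le> 2 * (1/2) ^ n - (1/2) ^ (n + N)" for n N
  proof (induction N)
    case (Suc N)
    have "S n (Suc N) \<le> S n N + v (n + Suc N)"
      using S_nn[of n N] y(2) by (simp add: SS v_def add_increasing add_increasing2)
    then have "blinfun_apply f (S n (Suc N)) \<le> blinfun_apply f (S n N) + blinfun_apply f (v (n + Suc N))"
      using pos_functional_mono[OF pos] by (metis blinfun.add_right)
    also have "\<dots> \<le> (2 * (1/2) ^ n - (1/2) ^ (n + N)) + (1/2) ^ (n + Suc N)"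
      using Suc r(2)[of "n + Suc N"] by (simp add: v_def)
    finally show ?case by simp
  qed (use r(2)[of n] in \<open>simp add: S0 v_def\<close>)
  have "incseq (S n)" for n by (rule incseq_SucI) (simp add: SS)
  moreover have "S n N \<in> order_interval u" for n N
    using S_nn S_u by (simp add: order_interval_def)
  ultimately have "\<exists>l. S n \<longlonglongrightarrow> l \<and> (\<forall>N. S n N \<le> l)" for n
    using incseq_convergent[OF oc] u by blast
  then have "\<exists>L. \<forall>n. S n \<longlonglongrightarrow> L n \<and> (\<forall>N. S n N \<le> L n)" by (intro choice) blast
  then obtain L where L: "\<And>n. S n \<longlonglongrightarrow> L n" "\<And>n N. S n N \<le> L n" by blast
  have closed: "closed F" using F by (simp add: closed_sublattice_def)
  have L_F: "L n \<in> F" for n by (rule closed_sequentially[OF closed _ L(1)]) (rule S_F)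
  have L_nn: "0 \<le> L n" for n using L(2)[of n 0] S_nn[of n 0] by simp
  have L_u: "L n \<le> u" for n by (rule tendsto_upper[OF L(1)]) (simp_all add: S_u)
  have L_f: "blinfun_apply f (L n) \<le> 2 * (1/2) ^ n" for n
  proof (rule LIMSEQ_le_const2)
    show "(\<lambda>N. blinfun_apply f (S n N)) \<longlonglongrightarrow> blinfun_apply f (L n)" by (intro tendsto_intros L)
    have "blinfun_apply f (S n N) \<le> 2 * (1/2) ^ n" for N
      using S_f[of n N] zero_le_power[of "1/2::real" "n + N"] by linarith
    then show "\<exists>M. \<forall>N\<ge>M. blinfun_apply f (S n N) \<le> 2 * (1/2) ^ n" by blast
  qed
  have L_dec: "L (Suc n) \<le> L n" for n
  proof (rule tendsto_upper[OF L(1)])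
    fix N
    have "S (Suc n) N \<le> S n (Suc N)"
      by (induction N) (simp_all add: S0 SS le_supI1 del: sup.bounded_iff, simp add: le_supI1)
    then show "S (Suc n) N \<le> L n" using L(2)[of n "Suc N"] by (rule order_trans)
  qed simp
  have "\<exists>l. (\<lambda>n. - L n) \<longlonglongrightarrow> l \<and> (\<forall>n. - L n \<le> l)"
  proof (rule incseq_convergent[OF oc _ _ u])
    show "incseq (\<lambda>n. - L n)" by (rule incseq_SucI) (simp add: L_dec)
    show "- L n \<in> order_interval u" for n using L_nn L_u by (simp add: order_interval_def)
  qed
  then obtain l where l: "(\<lambda>n. - L n) \<longlonglongrightarrow> l" by blast
  then have lim_L: "L \<longlonglongrightarrow> - l" using tendsto_minus by fastforce
  have "blinfun_apply f (- l) \<le> 0"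
  proof (rule LIMSEQ_le)
    show "(\<lambda>n. blinfun_apply f (L n)) \<longlonglongrightarrow> blinfun_apply f (- l)" by (intro tendsto_intros lim_L)
    show "(\<lambda>n. 2 * (1/2::real) ^ n) \<longlonglongrightarrow> 0"
      using tendsto_mult_right_zero[OF LIMSEQ_power_zero[of "1/2::real"], of 2] by simp
  qed (use L_f in blast)
  moreover have "- l \<in> F" by (rule closed_sequentially[OF closed _ lim_L]) (rule L_F)
  moreover have "0 \<le> - l" by (rule nonneg_tendsto[OF lim_L]) (simp_all add: L_nn)
  moreover have "0 \<le> blinfun_apply f (- l)"
    using calculation(3) by (rule pos_functional_nonneg[OF pos])
  ultimately have "- l = 0" using f unfolding strictly_positive_on_def by (meson order_antisym)
  then have "(\<lambda>n. norm (L n)) \<longlonglongrightarrow> 0" using lim_L by (simp add: tendsto_norm_zero)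
  then have "\<forall>\<^sub>F n in sequentially. norm (L n) < e" using e(1) by (rule order_tendstoD)
  then obtain n where "norm (L n) < e" by (auto simp: eventually_sequentially)
  moreover have "norm (v n) \<le> norm (L n)"
    using L(2)[of n 0] y(2) by (intro norm_mono) (auto simp: S0 v_def)
  ultimately show False using r(1)[of n] by (simp add: v_def)
qed

section \<open>A strictly convex functional on an order interval\<close>

text \<open>An enumeration, in \<open>[-1, 1]\<close>, that contains all subdivision points \<open>2 k / N - 1\<close> with \<open>k < N\<close>. Capping at
  \<open>1\<close> keeps the values for \<open>k > N\<close> in the interval; \<open>N = 0\<close> gives \<open>-1\<close>.\<close>

definition level :: "nat \<Rightarrow> real" where
  "level j = (case prod_decode j of (k, N) \<Rightarrow> min 1 (2 * real k / real N - 1))"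

lemma level_encode: "k < N \<Longrightarrow> \<exists>j. level j = 2 * real k / real N - 1"
  by (rule exI[of _ "prod_encode (k, N)"]) (simp add: level_def field_simps)

lemma abs_level_le: "\<bar>level j\<bar> \<le> 1"
proof -
  have "\<bar>min 1 (r - 1)\<bar> \<le> 1" if "0 \<le> r" for r :: real using that by auto
  then show ?thesis by (simp add: level_def split: prod.split)
qed

text \<open>A convex function on \<open>[-u, u]\<close>, strictly convex where \<open>f\<close> is strictly positive: no single summand
  is, but the kinks of \<open>y \<mapsto> \<bar>y - t u\<bar>\<close> for a dense set of \<open>t\<close> separate any two elements.\<close>

definition dispersion :: "('a::banach_lattice \<Rightarrow>\<^sub>L real) \<Rightarrow> 'a \<Rightarrow> 'a \<Rightarrow> real" where
  "dispersion f u y = (\<Sum>j. (1/2) ^ j * blinfun_apply f \<bar>y - level j *\<^sub>R u\<bar>)"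

lemma dispersion_term_le:
  assumes f: "pos_functional f" and y: "y \<in> order_interval u" and u: "0 \<le> u"
  shows "blinfun_apply f \<bar>y - level j *\<^sub>R u\<bar> \<le> 2 * blinfun_apply f u"
proof -
  have "\<bar>y - level j *\<^sub>R u\<bar> \<le> \<bar>y\<bar> + \<bar>level j *\<^sub>R u\<bar>" by (rule abs_triangle_ineq4)
  also have "\<dots> \<le> u + 1 *\<^sub>R u"
    using y u abs_level_le[of j]
    by (intro add_mono) (auto simp: order_interval_def abs_scaleR_real intro: scaleR_right_mono[of _ 1, simplified])
  finally have "blinfun_apply f \<bar>y - level j *\<^sub>R u\<bar> \<le> blinfun_apply f (u + 1 *\<^sub>R u)"
    by (rule pos_functional_mono[OF f])
  then show ?thesis by (simp add: blinfun.add_right)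
qed

lemma dispersion_summable:
  assumes f: "pos_functional f" and y: "y \<in> order_interval u" and u: "0 \<le> u"
  shows "summable (\<lambda>j. (1/2) ^ j * blinfun_apply f \<bar>y - level j *\<^sub>R u\<bar>)"
proof (rule summable_comparison_test'[where N = 0])
  show "summable (\<lambda>j. (1/2::real) ^ j * (2 * blinfun_apply f u))"
    by (intro summable_mult2 summable_geometric) simp
  show "norm ((1/2) ^ j * blinfun_apply f \<bar>y - level j *\<^sub>R u\<bar>) \<le> (1/2) ^ j * (2 * blinfun_apply f u)" for j
    using dispersion_term_le[OF f y u, of j] pos_functional_nonneg[OF f, of "\<bar>y - level j *\<^sub>R u\<bar>"]
    by (simp add: abs_mult)
qed

lemma dispersion_bounds:
  assumes f: "pos_functional f" and y: "y \<in> order_interval u" and u: "0 \<le> u"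
  shows "0 \<le> dispersion f u y" "dispersion f u y \<le> 4 * blinfun_apply f u"
proof -
  show "0 \<le> dispersion f u y" unfolding dispersion_def
    by (intro suminf_nonneg dispersion_summable[OF assms]) (simp add: pos_functional_nonneg[OF f])
  have "dispersion f u y \<le> (\<Sum>j. (1/2::real) ^ j * (2 * blinfun_apply f u))"
    unfolding dispersion_def
    by (intro suminf_le dispersion_summable[OF assms] mult_left_mono dispersion_term_le[OF assms]
        summable_mult2 summable_geometric) simp_all
  also have "\<dots> = (\<Sum>j. (1/2::real) ^ j) * (2 * blinfun_apply f u)"
    by (rule suminf_mult2[symmetric]) (simp add: summable_geometric)
  also have "\<dots> = 4 * blinfun_apply f u" by (simp add: suminf_geometric)
  finally show "dispersion f u y \<le> 4 * blinfun_apply f u" .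
qed

lemma convex_order_interval: "convex (order_interval u)"
  unfolding convex_def
proof (intro ballI allI impI)
  fix x y and a b :: real assume *: "x \<in> order_interval u" "y \<in> order_interval u" "0 \<le> a" "0 \<le> b" "a + b = 1"
  have "\<bar>a *\<^sub>R x + b *\<^sub>R y\<bar> \<le> a *\<^sub>R \<bar>x\<bar> + b *\<^sub>R \<bar>y\<bar>"
    using abs_triangle_ineq[of "a *\<^sub>R x" "b *\<^sub>R y"] * by (simp add: abs_scaleR_nonneg)
  also have "\<dots> \<le> a *\<^sub>R u + b *\<^sub>R u"
    using * by (intro add_mono scaleR_left_mono) (auto simp: order_interval_def)
  also have "\<dots> = u" using * by (simp flip: scaleR_add_left)
  finally show "a *\<^sub>R x + b *\<^sub>R y \<in> order_interval u" by (simp add: order_interval_def)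
qed

text \<open>Each summand of the dispersion is convex in \<open>y\<close>, and by the refined triangle inequality the \<open>j\<close>-th one has the
  stated midpoint defect. Since all defects are nonnegative, each of them is a lower bound for the sum.\<close>

lemma dispersion_midpoint:
  assumes f: "pos_functional f" and y: "y \<in> order_interval u" and z: "z \<in> order_interval u" and u: "0 \<le> u"
  shows "(1/2) ^ j * blinfun_apply f (inf (pprt (y - level j *\<^sub>R u)) (pprt (level j *\<^sub>R u - z)))
    \<le> dispersion f u y + dispersion f u z - 2 * dispersion f u ((1/2) *\<^sub>R y + (1/2) *\<^sub>R z)"
proof -
  let ?m = "(1/2) *\<^sub>R y + (1/2) *\<^sub>R z"
  let ?c = "\<lambda>j v. (1/2) ^ j * blinfun_apply f \<bar>v - level j *\<^sub>R u\<bar>"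
  let ?q = "\<lambda>j. inf (pprt (y - level j *\<^sub>R u)) (pprt (level j *\<^sub>R u - z))"
  have m: "?m \<in> order_interval u"
    using convex_order_interval[of u] y z unfolding convex_def by force
  have gap: "(1/2) ^ j * blinfun_apply f (?q j) \<le> ?c j y + ?c j z - 2 * ?c j ?m" for j
  proof -
    have "(y - level j *\<^sub>R u) + (z - level j *\<^sub>R u) = 2 *\<^sub>R (?m - level j *\<^sub>R u)"
      by (simp add: algebra_simps flip: scaleR_2)
    then have ab: "\<bar>(y - level j *\<^sub>R u) + (z - level j *\<^sub>R u)\<bar> = 2 *\<^sub>R \<bar>?m - level j *\<^sub>R u\<bar>"
      by (simp only: abs_scaleR_nonneg zero_le_numeral)
    have "2 *\<^sub>R \<bar>?m - level j *\<^sub>R u\<bar> + (?q j + ?q j) \<le> \<bar>y - level j *\<^sub>R u\<bar> + \<bar>z - level j *\<^sub>R u\<bar>"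
      using abs_add_abs_diff_ge[of "y - level j *\<^sub>R u" "z - level j *\<^sub>R u"] unfolding ab
      by simp
    from pos_functional_mono[OF f this]
    have "2 * blinfun_apply f \<bar>?m - level j *\<^sub>R u\<bar> + 2 * blinfun_apply f (?q j)
        \<le> blinfun_apply f \<bar>y - level j *\<^sub>R u\<bar> + blinfun_apply f \<bar>z - level j *\<^sub>R u\<bar>"
      by (simp add: blinfun.add_right blinfun.scaleR_right)
    moreover have "0 \<le> blinfun_apply f (?q j)" by (intro pos_functional_nonneg[OF f]) simp
    ultimately have "blinfun_apply f (?q j) \<le> blinfun_apply f \<bar>y - level j *\<^sub>R u\<bar>
        + blinfun_apply f \<bar>z - level j *\<^sub>R u\<bar> - 2 * blinfun_apply f \<bar>?m - level j *\<^sub>R u\<bar>" by linarith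
    from mult_left_mono[OF this, of "(1/2) ^ j"] show ?thesis by (simp add: algebra_simps)
  qed
  note s = dispersion_summable[OF f _ u]
  have "(\<lambda>j. ?c j y + ?c j z - 2 * ?c j ?m) sums
      (dispersion f u y + dispersion f u z - 2 * dispersion f u ?m)"
    unfolding dispersion_def
    by (intro sums_diff sums_add sums_mult summable_sums s y z m)
  moreover have "0 \<le> ?c j y + ?c j z - 2 * ?c j ?m" for j
    by (rule order_trans[OF _ gap]) (simp add: pos_functional_nonneg[OF f])
  ultimately have "?c j y + ?c j z - 2 * ?c j ?m \<le> dispersion f u y + dispersion f u z - 2 * dispersion f u ?m"
    using sums_unique sum_le_suminf[of "\<lambda>j. ?c j y + ?c j z - 2 * ?c j ?m" "{j}"] sums_summable by fastforce
  with gap[of j] show ?thesis by (rule order_trans)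
qed

text \<open>Strict convexity of the dispersion, uniformly on the order interval: a vanishing midpoint defect makes every
  summand of \<open>diff_le_sum_levels\<close> small, for both orders of \<open>y\<close> and \<open>z\<close>.\<close>

lemma tendsto_0_of_dispersion_gap:
  assumes f: "pos_functional f" and u: "0 \<le> u"
    and y: "\<And>n. y n \<in> order_interval u" and z: "\<And>n. z n \<in> order_interval u"
    and gap: "(\<lambda>n. dispersion f u (y n) + dispersion f u (z n) -
        2 * dispersion f u ((1/2) *\<^sub>R y n + (1/2) *\<^sub>R z n)) \<longlonglongrightarrow> 0"
  shows "(\<lambda>n. blinfun_apply f \<bar>y n - z n\<bar>) \<longlonglongrightarrow> 0"
proof (rule LIMSEQ_I)
  fix e :: real assume e: "0 < e"
  define P where "P t v w = inf (pprt (v - t *\<^sub>R u)) (pprt (t *\<^sub>R u - w))" for t v w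
  have P0: "0 \<le> P t v w" for t v w by (simp add: P_def)
  have P_lim: "(\<lambda>n. blinfun_apply f (P t (v n) (w n))) \<longlonglongrightarrow> 0"
    if t: "t = level j" and vw: "\<And>n. v n \<in> order_interval u" "\<And>n. w n \<in> order_interval u"
      and g: "(\<lambda>n. dispersion f u (v n) + dispersion f u (w n) -
        2 * dispersion f u ((1/2) *\<^sub>R v n + (1/2) *\<^sub>R w n)) \<longlonglongrightarrow> 0" for t j v w
  proof (rule tendsto_sandwich[OF _ _ tendsto_const])
    let ?g = "\<lambda>n. dispersion f u (v n) + dispersion f u (w n) -
        2 * dispersion f u ((1/2) *\<^sub>R v n + (1/2) *\<^sub>R w n)"
    show "\<forall>\<^sub>F n in sequentially. 0 \<le> blinfun_apply f (P t (v n) (w n))"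
      using pos_functional_nonneg[OF f P0] by simp
    have "blinfun_apply f (P t (v n) (w n)) \<le> 2 ^ j * ?g n" for n
    proof -
      have "(1/2) ^ j * blinfun_apply f (P t (v n) (w n)) \<le> ?g n"
        unfolding P_def t by (rule dispersion_midpoint[OF f vw u])
      from mult_left_mono[OF this, of "2 ^ j"] show ?thesis
        by (simp add: power_one_over)
    qed
    then show "\<forall>\<^sub>F n in sequentially. blinfun_apply f (P t (v n) (w n)) \<le> 2 ^ j * ?g n" by simp
    show "(\<lambda>n. 2 ^ j * ?g n) \<longlonglongrightarrow> 0" using tendsto_mult_right_zero[OF g] by simp
  qed
  have gap': "(\<lambda>n. dispersion f u (z n) + dispersion f u (y n) -
        2 * dispersion f u ((1/2) *\<^sub>R z n + (1/2) *\<^sub>R y n)) \<longlonglongrightarrow> 0"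
    using gap by (simp add: add.commute)
  obtain N :: nat where N: "0 < N" "4 / real N * blinfun_apply f u < e / 2"
  proof -
    obtain N :: nat where N: "8 * blinfun_apply f u / e < real N"
      using reals_Archimedean2 by blast
    moreover have "0 \<le> 8 * blinfun_apply f u / e" using e pos_functional_nonneg[OF f u] by simp
    ultimately have "0 < N" by linarith
    then show ?thesis using N e by (intro that[of N]) (simp_all add: field_simps)
  qed
  let ?t = "\<lambda>k. 2 * real k / real N - 1"
  let ?R = "\<lambda>n. \<Sum>k<N. P (?t k) (y n) (z n) + P (?t k) (z n) (y n)"
  have "(\<lambda>n. \<Sum>k<N. blinfun_apply f (P (?t k) (y n) (z n)) + blinfun_apply f (P (?t k) (z n) (y n))) \<longlonglongrightarrow> 0"
  proof (intro tendsto_null_sum)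
    fix k assume "k \<in> {..<N}"
    then obtain j where j: "?t k = level j" using level_encode[of k N] by (metis lessThan_iff)
    show "(\<lambda>n. blinfun_apply f (P (?t k) (y n) (z n)) + blinfun_apply f (P (?t k) (z n) (y n))) \<longlonglongrightarrow> 0"
      using tendsto_add[OF P_lim[OF j y z gap] P_lim[OF j z y gap']] by simp
  qed
  then have "(\<lambda>n. blinfun_apply f (?R n)) \<longlonglongrightarrow> 0"
    by (simp add: blinfun.sum_right blinfun.add_right)
  then have "\<forall>\<^sub>F n in sequentially. blinfun_apply f (?R n) < e / 2"
    using e by (intro order_tendstoD) auto
  then obtain n0 where n0: "\<And>n. n \<ge> n0 \<Longrightarrow> blinfun_apply f (?R n) < e / 2"
    by (auto simp: eventually_sequentially)
  have le: "\<bar>y n - z n\<bar> \<le> (4 / real N) *\<^sub>R u + ?R n" for n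
  proof -
    have *: "v - w \<le> (4 / real N) *\<^sub>R u + (\<Sum>k<N. P (?t k) v w)"
      if "v \<in> order_interval u" "w \<in> order_interval u" for v w
      unfolding P_def by (rule diff_le_sum_levels) (use N u that in \<open>auto simp: order_interval_iff\<close>)
    have "y n - z n \<le> (4 / real N) *\<^sub>R u + (\<Sum>k<N. P (?t k) (y n) (z n))" by (rule *[OF y z])
    also have "\<dots> \<le> (4 / real N) *\<^sub>R u + ?R n" by (intro add_left_mono sum_mono) (simp add: P0)
    finally have 1: "y n - z n \<le> (4 / real N) *\<^sub>R u + ?R n" .
    have "z n - y n \<le> (4 / real N) *\<^sub>R u + (\<Sum>k<N. P (?t k) (z n) (y n))" by (rule *[OF z y])
    also have "\<dots> \<le> (4 / real N) *\<^sub>R u + ?R n" by (intro add_left_mono sum_mono) (simp add: P0)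
    finally show ?thesis using 1 by (intro abs_leI) simp_all
  qed
  have "norm (blinfun_apply f \<bar>y n - z n\<bar> - 0) < e" if "n \<ge> n0" for n
    using pos_functional_mono[OF f le[of n]] n0[OF that] N(2) pos_functional_nonneg[OF f, of "\<bar>y n - z n\<bar>"]
    by (simp add: blinfun.add_right blinfun.scaleR_right)
  then show "\<exists>no. \<forall>n\<ge>no. norm (blinfun_apply f \<bar>y n - z n\<bar> - 0) < e" by blast
qed

text \<open>Let \<open>b k\<close> nearly minimize the dispersion on the convex hull of the \<open>k\<close>-th tail. The minima increase to a
  limit, and the midpoint of two later choices is still a competitor in the earlier hull, so midpoint defects tend to \<open>0\<close> and
  \<open>b\<close> is Cauchy with respect to \<open>f\<close>. Strict positivity of \<open>f\<close> turns this into the norm.\<close>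

lemma convergent_forward_convex_combinations:
  fixes x :: "nat \<Rightarrow> 'a::banach_lattice"
  assumes oc: "\<And>v::'a. 0 \<le> v \<Longrightarrow> disjoint_null (order_interval v)"
    and F: "closed_sublattice F" and f: "strictly_positive_on F f"
    and x: "\<And>n. x n \<in> F" "\<And>n. x n \<in> order_interval u"
  shows "\<exists>b l. (\<forall>k. b k \<in> convex hull (x ` {k..})) \<and> b \<longlonglongrightarrow> l"
proof -
  have pos: "pos_functional f" using f by (simp add: strictly_positive_on_def)
  have u: "0 \<le> u" using x(2)[of 0] abs_ge_zero order_trans unfolding order_interval_def by blast
  define H where "H k = convex hull (x ` {k..})" for k
  define \<Phi> where "\<Phi> = dispersion f u"
  have H_sub: "H k \<subseteq> F \<inter> order_interval u" for k
    unfolding H_def using x F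
    by (intro hull_minimal convex_Int subspace_imp_convex convex_order_interval)
      (auto simp: closed_sublattice_def)
  have H_mono: "H k \<subseteq> H j" if "j \<le> k" for j k
    unfolding H_def using that by (intro hull_mono image_mono) auto
  have H_mid: "(1/2) *\<^sub>R v + (1/2) *\<^sub>R w \<in> H k" if "v \<in> H k" "w \<in> H k" for v w k
    using convex_convex_hull[of "x ` {k..}"] that unfolding H_def convex_def by force
  have x_H: "x k \<in> H k" for k unfolding H_def by (intro hull_inc) simp
  have \<Phi>_bound: "0 \<le> \<Phi> v" "\<Phi> v \<le> 4 * blinfun_apply f u" if "v \<in> H k" for v k
    using dispersion_bounds[OF pos _ u] H_sub[of k] that unfolding \<Phi>_def by auto
  define m where "m k = Inf (\<Phi> ` H k)" for k
  have bdd: "bdd_below (\<Phi> ` H k)" for k using \<Phi>_bound(1) by (intro bdd_belowI2)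
  have m_le: "m k \<le> \<Phi> v" if "v \<in> H k" for v k
    unfolding m_def using that bdd by (intro cINF_lower)
  have m_inc: "m j \<le> m k" if "j \<le> k" for j k
    unfolding m_def
  proof (rule cINF_superset_mono)
    show "H k \<noteq> {}" using x_H by blast
  qed (use H_mono[OF that] bdd in auto)
  have "m k \<le> 4 * blinfun_apply f u" for k
    using m_le[OF x_H] \<Phi>_bound(2)[OF x_H] by (rule order_trans)
  moreover have "0 \<le> m k" for k
    unfolding m_def using x_H by (intro cINF_greatest \<Phi>_bound(1)) blast+
  ultimately have "norm (m k) \<le> 4 * blinfun_apply f u" for k by (simp add: abs_of_nonneg)
  then have mB: "Bseq m" by (rule BseqI')
  then have "convergent m"
    by (intro Bseq_mono_convergent) (use m_inc mB in auto)
  then obtain M where M: "m \<longlonglongrightarrow> M" by (auto simp: convergent_def)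
  have mM: "m k \<le> M" for k
    by (rule LIMSEQ_le_const[OF M]) (use m_inc in blast)
  have "\<exists>v\<in>H k. \<Phi> v < m k + inverse (real (Suc k))" for k
  proof -
    have "Inf (\<Phi> ` H k) < m k + inverse (real (Suc k))" by (simp add: m_def)
    then show ?thesis using cInf_less_iff[OF _ bdd[of k]] x_H[of k] by blast
  qed
  then have "\<exists>b. \<forall>k. b k \<in> H k \<and> \<Phi> (b k) < m k + inverse (real (Suc k))" by (intro choice) blast
  then obtain b where b: "\<And>k. b k \<in> H k" "\<And>k. \<Phi> (b k) < m k + inverse (real (Suc k))" by blast
  have "Cauchy b"
  proof (rule ccontr)
    assume "\<not> Cauchy b"
    then obtain e where e: "0 < e" "\<forall>K. \<exists>n\<ge>K. \<not> dist (b n) (b K) < e"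
      unfolding Cauchy_altdef2 by auto
    then have "\<exists>r. \<forall>K. K \<le> r K \<and> \<not> dist (b (r K)) (b K) < e" by (intro choice) blast
    then obtain r where r: "\<And>K. K \<le> r K" "\<And>K. \<not> dist (b (r K)) (b K) < e" by blast
    have bi: "b k \<in> order_interval u" "b k \<in> F" for k using b(1)[of k] H_sub[of k] by auto
    have "(\<lambda>K. blinfun_apply f \<bar>b (r K) - b K\<bar>) \<longlonglongrightarrow> 0"
    proof (rule tendsto_0_of_dispersion_gap[OF pos u])
      let ?g = "\<lambda>K. dispersion f u (b (r K)) + dispersion f u (b K) -
        2 * dispersion f u ((1/2) *\<^sub>R b (r K) + (1/2) *\<^sub>R b K)"
      show "?g \<longlonglongrightarrow> 0"
      proof (rule tendsto_sandwich[OF _ _ tendsto_const])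
        show "\<forall>\<^sub>F K in sequentially. 0 \<le> ?g K"
        proof (intro always_eventually allI)
          fix K
          have "0 \<le> (1/2) ^ 0 * blinfun_apply f (inf (pprt (b (r K) - level 0 *\<^sub>R u)) (pprt (level 0 *\<^sub>R u - b K)))"
            by (simp add: pos_functional_nonneg[OF pos])
          also have "\<dots> \<le> ?g K" by (rule dispersion_midpoint[OF pos bi(1) bi(1) u])
          finally show "0 \<le> ?g K" .
        qed
        show "\<forall>\<^sub>F K in sequentially. ?g K \<le> 2 * (M - m K) + 2 * inverse (real (Suc K))"
        proof (intro always_eventually allI)
          fix K
          have "b (r K) \<in> H K" using b(1)[of "r K"] H_mono[OF r(1)[of K]] by blast
          then have "m K \<le> \<Phi> ((1/2) *\<^sub>R b (r K) + (1/2) *\<^sub>R b K)"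
            by (intro m_le H_mid b(1))
          moreover have "\<Phi> (b (r K)) \<le> M + inverse (real (Suc K))"
          proof -
            have "inverse (real (Suc (r K))) \<le> inverse (real (Suc K))"
              using r(1)[of K] by (intro le_imp_inverse_le) auto
            then show ?thesis using b(2)[of "r K"] mM[of "r K"] by linarith
          qed
          moreover have "\<Phi> (b K) \<le> M + inverse (real (Suc K))" using b(2)[of K] mM[of K] by linarith
          ultimately show "?g K \<le> 2 * (M - m K) + 2 * inverse (real (Suc K))"
            unfolding \<Phi>_def by argo
        qed
        have "(\<lambda>K. 2 * (M - m K) + 2 * inverse (real (Suc K))) \<longlonglongrightarrow> 2 * (M - M) + 2 * 0"
          by (intro tendsto_intros M LIMSEQ_inverse_real_of_nat)
        then show "(\<lambda>K. 2 * (M - m K) + 2 * inverse (real (Suc K))) \<longlonglongrightarrow> 0" by simp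
      qed
    qed (rule bi)+
    then have "(\<lambda>K. \<bar>b (r K) - b K\<bar>) \<longlonglongrightarrow> 0"
    proof (rule norm_tendsto_0_of_strictly_positive[OF oc F f, rotated -1])
      fix K
      show "\<bar>b (r K) - b K\<bar> \<in> F"
        using F bi(2) by (auto simp: closed_sublattice_def intro: subspace_diff)
      show "\<bar>b (r K) - b K\<bar> \<le> u + u"
        using abs_triangle_ineq4[of "b (r K)" "b K"] add_mono[of "\<bar>b (r K)\<bar>" u "\<bar>b K\<bar>" u] bi(1)
        unfolding order_interval_def by (force intro: order_trans)
    qed simp_all
    then have "\<forall>\<^sub>F K in sequentially. norm \<bar>b (r K) - b K\<bar> < e"
      using e(1) by (intro order_tendstoD(2)[OF tendsto_norm_zero])
    then obtain K where "norm (b (r K) - b K) < e" by (auto simp: eventually_sequentially norm_abs_eq)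
    then show False using r(2)[of K] by (simp add: dist_norm)
  qed
  then have "convergent b" by (simp add: Cauchy_convergent_iff)
  then show ?thesis using b(1) unfolding convergent_def H_def by blast
qed

section \<open>Separable closed sublattices\<close>

text \<open>Close the range of \<open>x\<close> under addition, rational scaling and modulus in countably many steps, each of which
  keeps the set countable, and take the norm closure.\<close>

lemma exists_separable_closed_sublattice:
  fixes x :: "nat \<Rightarrow> 'a::banach_lattice"
  obtains d :: "nat \<Rightarrow> 'a" where "closed_sublattice (closure (range d))" "range x \<subseteq> closure (range d)"
proof -
  define step :: "'a set \<Rightarrow> 'a set" where
    "step E = E \<union> (\<lambda>(a, b). a + b) ` (E \<times> E) \<union> (\<lambda>(q, a). q *\<^sub>R a) ` (\<rat> \<times> E) \<union> abs ` E" for E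
  define E where "E n = (step ^^ n) (range x)" for n
  have E0: "E 0 = range x" and ES: "E (Suc n) = step (E n)" for n by (simp_all add: E_def)
  have count: "countable (E n)" for n
    by (induction n) (auto simp: E0 ES step_def intro!: countable_SIGMA countable_rat)
  have mono: "E m \<subseteq> E n" if "m \<le> n" for m n
    using that by (induction n rule: dec_induct) (auto simp: ES step_def)
  define D where "D = (\<Union>n. E n)"
  have D_count: "countable D" unfolding D_def using count by blast
  have D_add: "a + b \<in> D" if ab: "a \<in> D" "b \<in> D" for a b
  proof -
    obtain m where "a \<in> E m" using ab(1) unfolding D_def by blast
    moreover obtain n where "b \<in> E n" using ab(2) unfolding D_def by blast
    ultimately have "a \<in> E (max m n)" "b \<in> E (max m n)"
      using mono[of m "max m n"] mono[of n "max m n"] by auto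
    then have "a + b \<in> E (Suc (max m n))" by (force simp: ES step_def)
    then show ?thesis unfolding D_def by blast
  qed
  have D_scale: "q *\<^sub>R a \<in> D" if qa: "q \<in> \<rat>" "a \<in> D" for q a
  proof -
    obtain n where "a \<in> E n" using qa(2) unfolding D_def by blast
    then have "q *\<^sub>R a \<in> E (Suc n)" using qa(1) by (force simp: ES step_def)
    then show ?thesis unfolding D_def by blast
  qed
  have D_abs: "\<bar>a\<bar> \<in> D" if a: "a \<in> D" for a
  proof -
    obtain n where "a \<in> E n" using a unfolding D_def by blast
    then have "\<bar>a\<bar> \<in> E (Suc n)" by (simp add: ES step_def)
    then show ?thesis unfolding D_def by blast
  qed
  have xD: "range x \<subseteq> D" using E0 unfolding D_def by blast
  have ne: "D \<noteq> {}" using xD by auto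
  have "closed_sublattice (closure D)"
    unfolding closed_sublattice_def
  proof (intro conjI ballI subspaceI)
    show "0 \<in> closure D"
      using ne D_scale[of 0] closure_subset[of D] by auto
    fix a b assume "a \<in> closure D" "b \<in> closure D"
    then obtain s t where "\<And>n. s n \<in> D" "s \<longlonglongrightarrow> a" "\<And>n. t n \<in> D" "t \<longlonglongrightarrow> b"
      by (auto simp: closure_sequential)
    then have "\<And>n. s n + t n \<in> D" "(\<lambda>n. s n + t n) \<longlonglongrightarrow> a + b"
      by (auto intro: D_add tendsto_add)
    then show "a + b \<in> closure D" unfolding closure_sequential by (intro exI[of _ "\<lambda>n. s n + t n"]) simp
  next
    fix c a assume "a \<in> closure D"
    then obtain s where s: "\<And>n. s n \<in> D" "s \<longlonglongrightarrow> a" by (auto simp: closure_sequential)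
    have "c \<in> closure (\<rat> :: real set)" by (simp add: Rats_closure_real)
    then obtain q where q: "\<And>n. q n \<in> \<rat>" "q \<longlonglongrightarrow> c" by (auto simp: closure_sequential)
    have "\<And>n. q n *\<^sub>R s n \<in> D" "(\<lambda>n. q n *\<^sub>R s n) \<longlonglongrightarrow> c *\<^sub>R a"
      using s q by (auto intro: D_scale tendsto_scaleR)
    then show "c *\<^sub>R a \<in> closure D"
      unfolding closure_sequential by (intro exI[of _ "\<lambda>n. q n *\<^sub>R s n"]) simp
  next
    fix a assume "a \<in> closure D"
    then obtain s where s: "\<And>n. s n \<in> D" "s \<longlonglongrightarrow> a" by (auto simp: closure_sequential)
    then have "\<And>n. \<bar>s n\<bar> \<in> D" "(\<lambda>n. \<bar>s n\<bar>) \<longlonglongrightarrow> \<bar>a\<bar>" by (auto intro: D_abs tendsto_abs_lattice)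
    then show "\<bar>a\<bar> \<in> closure D" unfolding closure_sequential by (intro exI[of _ "\<lambda>n. \<bar>s n\<bar>"]) simp
  qed simp
  moreover have "range (from_nat_into D) = D" using ne D_count by (rule range_from_nat_into)
  ultimately show ?thesis using xD closure_subset[of D] by (intro that[of "from_nat_into D"]) auto
qed

text \<open>Norming functionals of a dense sequence.\<close>

lemma exists_separating_functionals:
  fixes d :: "nat \<Rightarrow> 'a::real_normed_vector"
  shows "\<exists>\<phi> :: nat \<Rightarrow> ('a \<Rightarrow>\<^sub>L real). (\<forall>i. norm (\<phi> i) \<le> 1) \<and>
    (\<forall>z\<in>closure (range d). (\<forall>i. blinfun_apply (\<phi> i) z = 0) \<longrightarrow> z = 0)"
proof -
  have "\<forall>i. \<exists>f :: 'a \<Rightarrow>\<^sub>L real. norm f \<le> 1 \<and> blinfun_apply f (d i) = norm (d i)"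
    using norming_functional by blast
  then obtain \<phi> :: "nat \<Rightarrow> ('a \<Rightarrow>\<^sub>L real)" where
    \<phi>: "\<And>i. norm (\<phi> i) \<le> 1" "\<And>i. blinfun_apply (\<phi> i) (d i) = norm (d i)"
    by (auto dest!: choice)
  have "z = 0" if z: "z \<in> closure (range d)" "\<forall>i. blinfun_apply (\<phi> i) z = 0" for z
  proof (rule ccontr)
    assume "z \<noteq> 0"
    then obtain i where i: "norm (d i - z) < norm z / 2"
      using z(1) unfolding closure_approachable dist_norm by (metis half_gt_zero rangeE zero_less_norm_iff)
    have "norm (d i) = blinfun_apply (\<phi> i) (d i - z)" using z(2) \<phi>(2) by (simp add: blinfun.diff_right)
    also have "\<dots> \<le> norm (\<phi> i) * norm (d i - z)" using norm_blinfun[of "\<phi> i" "d i - z"] by simp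
    also have "\<dots> \<le> 1 * norm (d i - z)" by (intro mult_right_mono \<phi>) simp
    finally have "norm (d i) \<le> norm (d i - z)" by simp
    moreover have "norm z \<le> norm (d i) + norm (d i - z)"
      using norm_triangle_ineq4[of "d i" "d i - z"] by simp
    ultimately show False using i by simp
  qed
  then show ?thesis using \<phi>(1) by blast
qed

text \<open>Take \<open>f = \<Sum>i. 2\<^sup>-\<^sup>i \<bar>\<phi> i\<bar>\<close>. If \<open>f\<close> vanishes at \<open>z \<ge> 0\<close>, then so does every \<open>\<phi> i\<close>.\<close>

lemma exists_strictly_positive_functional:
  fixes \<phi> :: "nat \<Rightarrow> ('a::banach_lattice \<Rightarrow>\<^sub>L real)"
  assumes \<phi>: "\<And>i. norm (\<phi> i) \<le> 1" "\<And>z. z \<in> F \<Longrightarrow> \<forall>i. blinfun_apply (\<phi> i) z = 0 \<Longrightarrow> z = 0"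
  shows "\<exists>f. strictly_positive_on F f"
proof -
  define f where "f = (\<Sum>i. (1/2::real) ^ i *\<^sub>R modulus (\<phi> i))"
  have summ: "summable (\<lambda>i. (1/2::real) ^ i *\<^sub>R modulus (\<phi> i))"
  proof (rule summable_norm_cancel, rule summable_comparison_test'[where N = 0])
    show "summable (\<lambda>i. (1/2::real) ^ i)" by (intro summable_geometric) simp
    show "norm (norm ((1/2::real) ^ i *\<^sub>R modulus (\<phi> i))) \<le> (1/2) ^ i" for i
      using order_trans[OF norm_modulus_le \<phi>(1)] by (simp add: mult_left_le)
  qed
  have sums: "(\<lambda>i. (1/2) ^ i * blinfun_apply (modulus (\<phi> i)) z) sums blinfun_apply f z" for z
    using bounded_linear.sums[OF blinfun.bounded_linear_left summable_sums[OF summ], of z]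
    by (simp add: f_def blinfun.scaleR_left)
  have nn: "0 \<le> (1/2) ^ i * blinfun_apply (modulus (\<phi> i)) z" if "0 \<le> z" for i z
    using modulus_nonneg[OF that] by simp
  have "pos_functional f"
    unfolding pos_functional_def
    using nn by (auto intro: sums_le[OF _ sums_zero sums])
  moreover have "z = 0" if z: "z \<in> F" "0 \<le> z" "blinfun_apply f z = 0" for z
  proof (rule \<phi>(2)[OF z(1)], intro allI)
    fix i
    have "(1/2) ^ i * blinfun_apply (modulus (\<phi> i)) z = 0"
      using suminf_eq_zero_iff[OF sums_summable[OF sums] nn[OF z(2)]] sums_unique[OF sums, of z] z(3) by simp
    then have "blinfun_apply (modulus (\<phi> i)) z = 0" by simp
    then show "blinfun_apply (\<phi> i) z = 0"
      using abs_apply_le_modulus[of z z "\<phi> i"] z(2) by simp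
  qed
  ultimately show ?thesis by (auto simp: strictly_positive_on_def)
qed

section \<open>Weak sequential compactness of order intervals\<close>

lemma common_convergent_subsequence:
  fixes a :: "nat \<Rightarrow> nat \<Rightarrow> real"
  assumes "\<And>i. bounded (range (a i))"
  obtains r :: "nat \<Rightarrow> nat" where "strict_mono r" "\<And>i. convergent (\<lambda>n. a i (r n))"
proof -
  interpret subseqs "\<lambda>i s. convergent (\<lambda>n. a i (s n))"
  proof
    fix i and s :: "nat \<Rightarrow> nat" assume "strict_mono s"
    have "bounded (range (\<lambda>n. a i (s n)))" by (rule bounded_subset[OF assms[of i]]) auto
    then obtain l r where "strict_mono (r :: nat \<Rightarrow> nat)" "((\<lambda>n. a i (s n)) \<circ> r) \<longlonglongrightarrow> l"
      using bounded_imp_convergent_subsequence by blast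
    then show "\<exists>r'. strict_mono r' \<and> convergent (\<lambda>n. a i ((s \<circ> r') n))"
      by (auto simp: convergent_def o_def)
  qed
  have "convergent (\<lambda>n. a i (diagseq n))" for i
  proof -
    have "convergent (\<lambda>n. a i ((diagseq \<circ> ((+) (Suc i))) n))"
    proof (rule diagseq_holds)
      fix r s :: "nat \<Rightarrow> nat" and n
      assume "strict_mono r" "convergent (\<lambda>k. a n (s k))"
      then show "convergent (\<lambda>k. a n ((s \<circ> r) k))"
        using convergent_subseq_convergent[of "\<lambda>k. a n (s k)" r] by (simp add: o_def)
    qed
    then show ?thesis
      using convergent_ignore_initial_segment[of "\<lambda>n. a i (diagseq n)" "Suc i"] by (simp add: o_def add.commute)
  qed
  then show ?thesis by (rule that[OF subseq_diagseq])
qed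

lemma tendsto_forward_convex_combinations:
  fixes g :: "'a::real_normed_vector \<Rightarrow>\<^sub>L real"
  assumes lim: "(\<lambda>n. blinfun_apply g (x n)) \<longlonglongrightarrow> c" and b: "\<And>k. b k \<in> convex hull (x ` {k..})"
  shows "(\<lambda>k. blinfun_apply g (b k)) \<longlonglongrightarrow> c"
proof (rule LIMSEQ_I)
  fix e :: real assume e: "0 < e"
  then obtain K where K: "\<And>n. n \<ge> K \<Longrightarrow> norm (blinfun_apply g (x n) - c) < e"
    using LIMSEQ_D[OF lim] by blast
  have "norm (blinfun_apply g (b k) - c) < e" if "k \<ge> K" for k
  proof -
    have "convex (blinfun_apply g -` ball c e)"
      by (intro convex_linear_vimage convex_ball bounded_linear.linear blinfun.bounded_linear_right)
    moreover have "x ` {k..} \<subseteq> blinfun_apply g -` ball c e"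
      using K that by (auto simp: dist_real_def abs_minus_commute)
    ultimately have "convex hull (x ` {k..}) \<subseteq> blinfun_apply g -` ball c e" by (intro hull_minimal)
    then show ?thesis using b[of k] by (auto simp: dist_norm norm_minus_commute)
  qed
  then show "\<exists>K. \<forall>k\<ge>K. norm (blinfun_apply g (b k) - c) < e" by blast
qed

text \<open>Pass to a subsequence \<open>X\<close> along which all separating functionals \<open>\<phi> i\<close> converge. Forward convex combinations of any
  further subsequence have a norm limit at which \<open>\<phi> i\<close> takes the value \<open>lim \<phi> i (X n)\<close>; hence this limit \<open>l\<close> is
  always the same. If \<open>g (X n) \<ge> g l + e\<close> along a subsequence, this inequality passes to its
  convex combinations and to their limit \<open>l\<close>, which is absurd.\<close>

lemma weakly_convergent_subsequence:
  fixes x :: "nat \<Rightarrow> 'a::banach_lattice"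
  assumes oc: "\<And>v::'a. 0 \<le> v \<Longrightarrow> disjoint_null (order_interval v)"
    and x: "\<And>n. x n \<in> order_interval u"
  shows "\<exists>r l. strict_mono r \<and> l \<in> order_interval u \<and> weakly_null (\<lambda>n. x (r n) - l)"
proof -
  obtain d :: "nat \<Rightarrow> 'a" where F: "closed_sublattice (closure (range d))" and xF: "range x \<subseteq> closure (range d)"
    by (rule exists_separable_closed_sublattice)
  let ?F = "closure (range d)"
  obtain \<phi> :: "nat \<Rightarrow> ('a \<Rightarrow>\<^sub>L real)" where \<phi>: "\<And>i. norm (\<phi> i) \<le> 1"
    "\<And>z. z \<in> ?F \<Longrightarrow> \<forall>i. blinfun_apply (\<phi> i) z = 0 \<Longrightarrow> z = 0"
    using exists_separating_functionals[of d] by blast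
  obtain f where f: "strictly_positive_on ?F f"
    using exists_strictly_positive_functional[of \<phi> ?F, OF \<phi>] by blast
  have xu: "norm (x n) \<le> norm u" for n using x[of n] by (simp add: order_interval_def norm_le_of_abs_le)
  have "bounded (range (\<lambda>n. blinfun_apply (\<phi> i) (x n)))" for i
  proof (rule boundedI)
    fix t assume "t \<in> range (\<lambda>n. blinfun_apply (\<phi> i) (x n))"
    then obtain n where t: "t = blinfun_apply (\<phi> i) (x n)" by blast
    have "norm t \<le> norm (\<phi> i) * norm (x n)" unfolding t by (rule norm_blinfun)
    also have "\<dots> \<le> 1 * norm u" by (intro mult_mono \<phi>(1) xu) auto
    finally show "norm t \<le> norm u" by simp
  qed
  then obtain r where r: "strict_mono r" "\<And>i. convergent (\<lambda>n. blinfun_apply (\<phi> i) (x (r n)))"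
    using common_convergent_subsequence[of "\<lambda>i n. blinfun_apply (\<phi> i) (x n)"] by blast
  define X where "X n = x (r n)" for n
  have X: "X n \<in> ?F" "X n \<in> order_interval u" for n using xF x by (auto simp: X_def)
  obtain c where c: "\<And>i. (\<lambda>n. blinfun_apply (\<phi> i) (X n)) \<longlonglongrightarrow> c i"
    using r(2) unfolding X_def convergent_def by metis
  have sub: "\<exists>b l. (\<forall>k. b k \<in> convex hull ((X \<circ> s) ` {k..})) \<and> b \<longlonglongrightarrow> l \<and> l \<in> ?F \<and>
      l \<in> order_interval u \<and> (\<forall>i. blinfun_apply (\<phi> i) l = c i)" if s: "strict_mono s" for s
  proof -
    obtain b l where b: "\<And>k. b k \<in> convex hull ((X \<circ> s) ` {k..})" "b \<longlonglongrightarrow> l"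
      using convergent_forward_convex_combinations[OF oc F f, of "X \<circ> s" u] X by auto
    have "convex hull ((X \<circ> s) ` {k..}) \<subseteq> ?F \<inter> order_interval u" for k
      using X F by (intro hull_minimal convex_Int subspace_imp_convex convex_order_interval)
        (auto simp: closed_sublattice_def)
    then have bF: "b k \<in> ?F" "b k \<in> order_interval u" for k using b(1)[of k] by blast+
    have "l \<in> ?F" by (rule closed_sequentially[OF closed_closure bF(1) b(2)])
    moreover have "\<bar>l\<bar> \<le> u"
      by (rule tendsto_upper[OF tendsto_abs_lattice[OF b(2)]]) (use bF in \<open>auto simp: order_interval_def\<close>)
    moreover have "blinfun_apply (\<phi> i) l = c i" for i
    proof (rule LIMSEQ_unique)
      show "(\<lambda>k. blinfun_apply (\<phi> i) (b k)) \<longlonglongrightarrow> blinfun_apply (\<phi> i) l" by (intro tendsto_intros b)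
      show "(\<lambda>k. blinfun_apply (\<phi> i) (b k)) \<longlonglongrightarrow> c i"
        by (rule tendsto_forward_convex_combinations[where x = "X \<circ> s"])
          (use LIMSEQ_subseq_LIMSEQ[OF c s] b(1) in \<open>auto simp: o_def\<close>)
    qed
    ultimately show ?thesis using b by (auto simp: order_interval_def)
  qed
  obtain l where l: "l \<in> ?F" "l \<in> order_interval u" "\<And>i. blinfun_apply (\<phi> i) l = c i"
    using sub[of id] by (auto simp: strict_mono_def)
  have upper: "\<forall>\<^sub>F n in sequentially. blinfun_apply g (X n) < blinfun_apply g l + e" if e: "0 < e" for g :: "'a \<Rightarrow>\<^sub>L real" and e
  proof (rule ccontr)
    assume "\<not> ?thesis"
    then have "\<exists>\<^sub>F n in sequentially. blinfun_apply g l + e \<le> blinfun_apply g (X n)"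
      by (simp add: frequently_def not_le)
    then have "infinite {n. blinfun_apply g l + e \<le> blinfun_apply g (X n)}"
      by (simp add: frequently_cofinite flip: cofinite_eq_sequentially)
    then obtain s :: "nat \<Rightarrow> nat" where s: "strict_mono s" "\<And>n. blinfun_apply g l + e \<le> blinfun_apply g (X (s n))"
      using infinite_enumerate by blast
    obtain b l' where b: "\<And>k. b k \<in> convex hull ((X \<circ> s) ` {k..})" "b \<longlonglongrightarrow> l'" "l' \<in> ?F"
      "\<And>i. blinfun_apply (\<phi> i) l' = c i" using sub[OF s(1)] by blast
    have "l' - l = 0"
    proof (rule \<phi>(2))
      show "l' - l \<in> ?F" using F b(3) l(1) by (auto simp: closed_sublattice_def intro: subspace_diff)
    qed (simp add: blinfun.diff_right b(4) l(3))
    moreover have "blinfun_apply g l + e \<le> blinfun_apply g l'"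
    proof (rule LIMSEQ_le_const)
      show "(\<lambda>k. blinfun_apply g (b k)) \<longlonglongrightarrow> blinfun_apply g l'" by (intro tendsto_intros b)
      have "convex hull ((X \<circ> s) ` {k..}) \<subseteq> blinfun_apply g -` {blinfun_apply g l + e..}" for k
        using s(2) by (intro hull_minimal convex_linear_vimage bounded_linear.linear blinfun.bounded_linear_right
            convex_real_interval) auto
      then have "blinfun_apply g l + e \<le> blinfun_apply g (b k)" for k using b(1)[of k] by auto
      then show "\<exists>N. \<forall>n\<ge>N. blinfun_apply g l + e \<le> blinfun_apply g (b n)" by blast
    qed
    ultimately show False using e by simp
  qed
  have "weakly_null (\<lambda>n. X n - l)"
    unfolding weakly_null_def
  proof (intro allI tendstoI)
    fix g :: "'a \<Rightarrow>\<^sub>L real" and e :: real assume e: "0 < e"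
    show "\<forall>\<^sub>F n in sequentially. dist (blinfun_apply g (X n - l)) 0 < e"
      using upper[OF e, of g] upper[OF e, of "- g"]
      by eventually_elim (simp add: blinfun.diff_right blinfun.minus_left abs_less_iff)
  qed
  then show ?thesis using r(1) l(2) by (auto simp: X_def)
qed

section \<open>Compactness\<close>

text \<open>An order interval is contained in the solid hull of a point, and points are almost p-limited by the definition of
  weak* p-summability.\<close>

lemma almost_p_limited_order_interval:
  fixes u :: "'a::banach_lattice"
  assumes p: "1 \<le> p"
  shows "almost_p_limited p (order_interval u)"
proof -
  have "almost_p_limited p {u}"
    unfolding almost_p_limited_def
  proof (intro allI impI)
    fix f :: "nat \<Rightarrow> ('a \<Rightarrow>\<^sub>L real)"
    assume "pairwise_dual_disjoint f \<and> weak_star_p_summable p f"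
    then have "(\<lambda>n. blinfun_apply (f n) u) \<in> ell p" by (simp add: weak_star_p_summable_def)
    then have "(\<lambda>n. \<bar>blinfun_apply (f n) u\<bar>) \<in> ell p" by (simp add: ell_def)
    then show "\<exists>a\<in>ell p. \<forall>x\<in>{u}. \<forall>n. \<bar>blinfun_apply (f n) x\<bar> \<le> a n" by auto
  qed
  then have "almost_p_limited p (solid_hull {u})" using p by (rule almost_p_limited_solid_hull)
  then show ?thesis
    by (rule almost_p_limited_subset)
      (auto simp: solid_hull_def order_interval_def intro: order_trans[OF _ abs_ge_self])
qed

lemma compact_order_interval:
  fixes u :: "'a::banach_lattice"
  assumes H: "\<And>x :: nat \<Rightarrow> 'a. weakly_null x \<Longrightarrow> almost_p_limited_seq p x \<Longrightarrow> norm_null x"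
    and p: "1 \<le> p"
  shows "compact (order_interval u)"
  unfolding compact_def
proof (intro allI impI)
  fix x :: "nat \<Rightarrow> 'a" assume x: "\<forall>n. x n \<in> order_interval u"
  have oc: "disjoint_null (order_interval v)" for v :: 'a
  proof -
    have "disjoint_null (solid_hull (order_interval v))"
      by (rule disjoint_null_solid_hull[OF H almost_p_limited_order_interval[OF p] p])
    then show ?thesis by (auto simp: disjoint_null_def solid_hull_def)
  qed
  obtain r l where r: "strict_mono r" "l \<in> order_interval u" "weakly_null (\<lambda>n. x (r n) - l)"
    using weakly_convergent_subsequence[OF oc, of x u] x by blast
  have "x (r n) - l \<in> order_interval (u + u)" for n
    using abs_triangle_ineq4[of "x (r n)" l] add_mono[of "\<bar>x (r n)\<bar>" u "\<bar>l\<bar>" u] r(2) x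
    unfolding order_interval_def by (force intro: order_trans)
  then have "almost_p_limited_seq p (\<lambda>n. x (r n) - l)"
    unfolding almost_p_limited_seq_def
    by (intro almost_p_limited_subset[OF almost_p_limited_order_interval[OF p, of "u + u"]]) auto
  then have "norm_null (\<lambda>n. x (r n) - l)" by (rule H[OF r(3)])
  then have "(\<lambda>n. x (r n) - l) \<longlonglongrightarrow> 0" by (simp add: norm_null_def tendsto_norm_zero_iff)
  then have "(x \<circ> r) \<longlonglongrightarrow> l" by (simp add: LIM_zero_iff o_def)
  then show "\<exists>l\<in>order_interval u. \<exists>r. strict_mono r \<and> (x \<circ> r) \<longlonglongrightarrow> l" using r by blast
qed

text \<open>Each element of \<open>A\<close> is the sum of an element of \<open>[-u, u]\<close>, which is compact, and a small remainder.\<close>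

lemma strong_p_GP_of_norm_null:
  assumes H: "\<And>x :: nat \<Rightarrow> 'a. weakly_null x \<Longrightarrow> almost_p_limited_seq p x \<Longrightarrow> norm_null x"
    and p: "1 \<le> p"
  shows "strong_p_GP p TYPE('a::banach_lattice)"
  unfolding strong_p_GP_def relatively_compact_def
proof (intro allI impI)
  fix A :: "'a set" assume A: "almost_p_limited p A"
  let ?S = "solid_hull A"
  have A_S: "A \<subseteq> ?S" by (auto simp: solid_hull_def)
  have approx: "\<exists>k. finite k \<and> A \<subseteq> (\<Union>x\<in>k. ball x e)" if e: "0 < e" for e
  proof -
    have "\<exists>u\<ge>0. \<forall>x\<in>?S. norm (pprt (\<bar>x\<bar> - u)) \<le> e / 2"
    proof (rule approximately_order_bounded)
      show "disjoint_null ?S" by (rule disjoint_null_solid_hull[OF H A p])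
      show "bounded ?S" by (rule almost_p_limited_bounded[OF almost_p_limited_solid_hull[OF A p]])
    qed (use e in \<open>auto simp: solid_hull_def intro: order_trans\<close>)
    then obtain u where u: "0 \<le> u" "\<And>x. x \<in> A \<Longrightarrow> norm (pprt (\<bar>x\<bar> - u)) \<le> e / 2"
      using A_S by blast
    obtain k where k: "finite k" "order_interval u \<subseteq> (\<Union>x\<in>k. ball x (e / 2))"
      using compact_order_interval[OF H p, of u] e unfolding compact_eq_totally_bounded by (meson half_gt_zero)
    have "A \<subseteq> (\<Union>x\<in>k. ball x e)"
    proof
      fix x assume x: "x \<in> A"
      have "\<bar>x\<bar> \<le> u + pprt (\<bar>x\<bar> - u)" using le_pprt[of "\<bar>x\<bar> - u"] by (simp add: diff_le_eq add.commute)
      then obtain v w where vw: "x = v + w" "\<bar>v\<bar> \<le> u" "\<bar>w\<bar> \<le> pprt (\<bar>x\<bar> - u)"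
        using riesz_decomposition[OF _ u(1)] zero_le_pprt by blast
      then obtain a where a: "a \<in> k" "dist a v < e / 2" using k(2) by (auto simp: order_interval_def)
      have "dist v x \<le> e / 2"
        using norm_le_of_abs_le[OF vw(3)] u(2)[OF x] by (simp add: vw(1) dist_norm)
      then have "dist a x < e" using dist_triangle[of a x v] a(2) by simp
      then show "x \<in> (\<Union>x\<in>k. ball x e)" using a(1) by auto
    qed
    then show ?thesis using k(1) by blast
  qed
  have "\<exists>k. finite k \<and> closure A \<subseteq> (\<Union>x\<in>k. ball x e)" if e: "0 < e" for e
  proof -
    obtain k where k: "finite k" "A \<subseteq> (\<Union>x\<in>k. ball x (e / 2))" using approx[of "e / 2"] e by auto
    have "closure A \<subseteq> (\<Union>x\<in>k. cball x (e / 2))"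
      using k by (intro closure_minimal closed_UN) force+
    also have "\<dots> \<subseteq> (\<Union>x\<in>k. ball x e)" using e by (intro UN_mono) auto
    finally show ?thesis using k(1) by blast
  qed
  then show "compact (closure A)"
    by (simp add: compact_eq_totally_bounded complete_eq_closed)
qed

text \<open>A norm limit of a subsequence is annihilated by every functional, hence zero.\<close>

lemma norm_null_of_relatively_compact:
  fixes x :: "nat \<Rightarrow> 'a::real_normed_vector"
  assumes x: "weakly_null x" and c: "compact (closure (range x))"
  shows "norm_null x"
proof (rule ccontr)
  assume "\<not> norm_null x"
  then have "\<not> x \<longlonglongrightarrow> 0" by (simp add: norm_null_def tendsto_norm_zero_iff)
  then obtain e where e: "0 < e" "\<And>M. \<exists>n\<ge>M. e \<le> norm (x n)"
    unfolding LIMSEQ_iff by (auto simp: not_less)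
  then have "infinite {n. e \<le> norm (x n)}"
    unfolding infinite_nat_iff_unbounded_le by blast
  then obtain s :: "nat \<Rightarrow> nat" where s: "strict_mono s" "\<And>n. e \<le> norm (x (s n))"
    using infinite_enumerate by blast
  have "\<forall>n. (x \<circ> s) n \<in> closure (range x)" using closure_subset[of "range x"] by auto
  then obtain l r where r: "strict_mono r" "((x \<circ> s) \<circ> r) \<longlonglongrightarrow> l"
    using c unfolding compact_def by blast
  obtain f :: "'a \<Rightarrow>\<^sub>L real" where f: "blinfun_apply f l = norm l" by (rule norming_functional)
  have "(\<lambda>n. blinfun_apply f (x n)) \<longlonglongrightarrow> 0" using x by (simp add: weakly_null_def)
  then have "(\<lambda>n. blinfun_apply f (((x \<circ> s) \<circ> r) n)) \<longlonglongrightarrow> 0"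
    using LIMSEQ_subseq_LIMSEQ[OF _ strict_mono_o[OF s(1) r(1)]] by (fastforce simp: o_def)
  moreover have "(\<lambda>n. blinfun_apply f (((x \<circ> s) \<circ> r) n)) \<longlonglongrightarrow> norm l"
    unfolding f[symmetric] by (intro tendsto_intros r)
  ultimately have "norm l = 0" using LIMSEQ_unique by blast
  moreover have "e \<le> norm l"
    by (rule LIMSEQ_le_const[OF tendsto_norm[OF r(2)]]) (use s(2) in auto)
  ultimately show False using e(1) by simp
qed

theorem theorem3p3:
  fixes p :: real
  assumes "1 \<le> p"
  shows "strong_p_GP p TYPE('a::banach_lattice) \<longleftrightarrow>
    (\<forall>x :: nat \<Rightarrow> 'a. weakly_null x \<and> almost_p_limited_seq p x \<longrightarrow> norm_null x)"
proof
  assume "strong_p_GP p TYPE('a)"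
  then show "\<forall>x :: nat \<Rightarrow> 'a. weakly_null x \<and> almost_p_limited_seq p x \<longrightarrow> norm_null x"
    unfolding strong_p_GP_def relatively_compact_def almost_p_limited_seq_def
    by (blast intro: norm_null_of_relatively_compact)
next
  assume "\<forall>x :: nat \<Rightarrow> 'a. weakly_null x \<and> almost_p_limited_seq p x \<longrightarrow> norm_null x"
  then show "strong_p_GP p TYPE('a)" using assms by (intro strong_p_GP_of_norm_null) auto
qed

end
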